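(* Let $(M,g,S(TM))$ be a coisotropic submanifold of a semi-Riemannian manifold $(\overline{M},\overline{g})$ such that the radical distribution $\mathrm{Rad}\,TM$ is integrable and such that, on coordinate neighbourhoods $\mathcal{U}$ of $M$, there are smooth functions $\varphi_i$ with $$\stackrel{*}{h}_{i}(X,PY)=\varphi_{i}\,h_{i}^{l}(X,PY),\qquad\forall X,Y\in\Gamma(TM|_{\mathcal{U}}),\ 1\le i\le r.$$ Then the induced Riemann curvature $R$ of $M$ defines an algebraic curvature tensor if the following holonomy condition is satisfied: $$\overline{R}(X,PY)\,\mathrm{Rad}\,TM\subset \mathrm{Rad}\,TM,\qquad\forall X,Y\in\Gamma(TM).$$
   Context: $(\overline{M},\overline{g})$ is an $(m+n)$-dimensional semi-Riemannian manifold of constant index $\nu$, $1\le\nu<m+n$, $m,n\ge1$, with Levi-Civita connection $\overline{\nabla}$ and curvature tensor $\overline{R}$; $M$ is a submanifold of codimension $n$ with induced tensor $g=\overline{g}|_{TM}$. $\Gamma(E)$ denotes smooth sections of $E$. $T_uM^{\perp}=\{X\in T_u\overline{M}:\overline{g}(X,Y)=0\ \forall Y\in T_uM\}$ and $\mathrm{Rad}\,T_uM=T_uM\cap T_uM^{\perp}$. $M$ is $r$-lightlike if $u\mapsto \mathrm{Rad}\,T_uM$ is a smooth distribution of rank $r>0$; it is coisotropic if $r=n$ (so $TM^{\perp}=\mathrm{Rad}\,TM$). A screen distribution $S(TM)$ is a semi-Riemannian (non-degenerate) complement of $\mathrm{Rad}\,TM$ in $TM$; $P$ is the projection of $TM$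 onto $S(TM)$ along $\mathrm{Rad}\,TM$. For any local frame $\{\xi_i\}_{i=1}^r$ of $\mathrm{Rad}\,TM$ there are local sections $N_i$ of $S(TM)^{\perp}$ with $\overline{g}(\xi_i,N_j)=\delta_{ij}$, $\overline{g}(N_i,N_j)=0$; they span the lightlike transversal bundle $ltr(TM)$, and $T\overline{M}|_M=TM\oplus ltr(TM)$. For $X,Y\in\Gamma(TM)$: $\overline{\nabla}_XY=\nabla_XY+h^{l}(X,Y)$ with $\nabla_XY\in\Gamma(TM)$, $h^l(X,Y)\in\Gamma(ltr(TM))$, and $\nabla_XPY=\stackrel{*}{\nabla}_XPY+\stackrel{*}{h}(X,PY)$ with $\stackrel{*}{\nabla}_XPY\in\Gamma(S(TM))$, $\stackrel{*}{h}(X,PY)\in\Gamma(\mathrm{Rad}\,TM)$. The local second fundamental forms are $h^l_i(X,Y)=\overline{g}(h^l(X,Y),\xi_i)$ (of $M$) and $\stackrel{*}{h}_i(X,PY)=\overline{g}(\stackrel{*}{h}(X,PY),N_i)$ (of $S(TM)$). The induced Riemann curvature is $R(X,Y)Z=\nabla_X\nabla_YZ-\nabla_Y\nabla_XZ-\nabla_{[X,Y]}Z$, $R(X,Y,Z,U)=g(R(X,Y)Z,U)$. $R$ is an algebraic curvature tensor if at each point, for all tangent $x,y,z,w$: $R(x,y,z,w)=-R(y,x,z,w)=R(z,w,x,y)$ and $R(x,y,z,w)+R(y,z,x,w)+R(z,x,y,w)=0$. *)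

theory Defs
  imports "HOL-Analysis.Analysis"
begin

section \<open>Smooth maps between open subsets of normed spaces\<close>

text \<open>Both notions are only meant for open \<open>S\<close>.\<close>

primrec Ck_on :: "nat \<Rightarrow> 'a::real_normed_vector set \<Rightarrow> ('a \<Rightarrow> 'b::real_normed_vector) \<Rightarrow> bool" where
  "Ck_on 0 S f \<longleftrightarrow> continuous_on S f"
| "Ck_on (Suc k) S f \<longleftrightarrow>
     (\<forall>x\<in>S. f differentiable at x) \<and> (\<forall>v. Ck_on k S (\<lambda>x. frechet_derivative f (at x) v))"

definition smooth_on :: "'a::real_normed_vector set \<Rightarrow> ('a \<Rightarrow> 'b::real_normed_vector) \<Rightarrow> bool" where
  "smooth_on S f \<longleftrightarrow> (\<forall>k. Ck_on k S f)"

section \<open>Smooth manifolds\<close>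

text \<open>The ambient manifold is the whole type \<open>'p\<close>, a Hausdorff second countable space carrying a
  smooth atlas modelled on the Euclidean space \<open>'e\<close>; its dimension is \<open>DIM('e)\<close>. A chart is a pair
  of its domain and its coordinate map.\<close>

type_synonym ('p, 'e) chart = "'p set \<times> ('p \<Rightarrow> 'e)"

definition chart_inv :: "('p, 'e) chart \<Rightarrow> 'e \<Rightarrow> 'p" where
  "chart_inv c = inv_into (fst c) (snd c)"

definition is_chart :: "('p::topological_space, 'e::euclidean_space) chart \<Rightarrow> bool" where
  "is_chart c \<longleftrightarrow> open (fst c) \<and> open (snd c ` fst c) \<and>
     homeomorphism (fst c) (snd c ` fst c) (snd c) (chart_inv c)"

definition compatible ::
  "('p, 'e::euclidean_space) chart \<Rightarrow> ('p, 'e) chart \<Rightarrow> bool" where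
  "compatible c d \<longleftrightarrow>
     smooth_on (snd c ` (fst c \<inter> fst d)) (snd d \<circ> chart_inv c) \<and>
     smooth_on (snd d ` (fst c \<inter> fst d)) (snd c \<circ> chart_inv d)"

definition smooth_atlas :: "('p::topological_space, 'e::euclidean_space) chart set \<Rightarrow> bool" where
  "smooth_atlas A \<longleftrightarrow> (\<forall>c\<in>A. is_chart c) \<and> (\<Union>c\<in>A. fst c) = UNIV \<and>
     (\<forall>c\<in>A. \<forall>d\<in>A. compatible c d)"

definition maximal_atlas ::
  "('p::topological_space, 'e::euclidean_space) chart set \<Rightarrow> ('p, 'e) chart set" where
  "maximal_atlas A = {c. is_chart c \<and> (\<forall>d\<in>A. compatible c d)}"

subsection \<open>Tangent vectors, vector fields\<close>

text \<open>Every point \<open>p\<close> gets a preferred chart around it. The tangent space at \<open>p\<close> is the model space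
  \<open>'e\<close>: a tangent vector is given by its components in the preferred chart at \<open>p\<close>. Thus a vector
  field is a function \<open>'p \<Rightarrow> 'e\<close>, but its smoothness has to be read off its components
  \<open>tcomp\<close> in a fixed chart, since the preferred chart varies with the point.\<close>

definition chart_at :: "('p, 'e) chart set \<Rightarrow> 'p \<Rightarrow> ('p, 'e) chart" where
  "chart_at A p = (SOME c. c \<in> A \<and> p \<in> fst c)"

text \<open>\<open>tcomp A c p v\<close>: components in the chart \<open>c\<close> of the tangent vector \<open>v\<close> at \<open>p\<close>;
  \<open>tvec A c p\<close> is its inverse.\<close>

definition tcomp ::
  "('p, 'e::euclidean_space) chart set \<Rightarrow> ('p, 'e) chart \<Rightarrow> 'p \<Rightarrow> 'e \<Rightarrow> 'e" where
  "tcomp A c p v =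
     frechet_derivative (snd c \<circ> chart_inv (chart_at A p)) (at (snd (chart_at A p) p)) v"

definition tvec ::
  "('p, 'e::euclidean_space) chart set \<Rightarrow> ('p, 'e) chart \<Rightarrow> 'p \<Rightarrow> 'e \<Rightarrow> 'e" where
  "tvec A c p v = frechet_derivative (snd (chart_at A p) \<circ> chart_inv c) (at (snd c p)) v"

definition smooth_fun ::
  "('p, 'e::euclidean_space) chart set \<Rightarrow> 'p set \<Rightarrow> ('p \<Rightarrow> real) \<Rightarrow> bool" where
  "smooth_fun A U f \<longleftrightarrow> (\<forall>c\<in>A. smooth_on (snd c ` (U \<inter> fst c)) (f \<circ> chart_inv c))"

definition local_rep ::
  "('p, 'e::euclidean_space) chart set \<Rightarrow> ('p, 'e) chart \<Rightarrow> ('p \<Rightarrow> 'e) \<Rightarrow> 'e \<Rightarrow> 'e" where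
  "local_rep A c X x = tcomp A c (chart_inv c x) (X (chart_inv c x))"

text \<open>\<open>smooth_vf A U X\<close>: \<open>X\<close> restricts to a smooth vector field on the open set \<open>U\<close>.\<close>

definition smooth_vf ::
  "('p, 'e::euclidean_space) chart set \<Rightarrow> 'p set \<Rightarrow> ('p \<Rightarrow> 'e) \<Rightarrow> bool" where
  "smooth_vf A U X \<longleftrightarrow> (\<forall>c\<in>A. smooth_on (snd c ` (U \<inter> fst c)) (local_rep A c X))"

definition vderiv ::
  "('p, 'e::euclidean_space) chart set \<Rightarrow> ('p \<Rightarrow> real) \<Rightarrow> 'p \<Rightarrow> 'e \<Rightarrow> real" where
  "vderiv A f p v =
     frechet_derivative (f \<circ> chart_inv (chart_at A p)) (at (snd (chart_at A p) p)) v"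

definition lie_bracket ::
  "('p, 'e::euclidean_space) chart set \<Rightarrow> ('p \<Rightarrow> 'e) \<Rightarrow> ('p \<Rightarrow> 'e) \<Rightarrow> 'p \<Rightarrow> 'e" where
  "lie_bracket A X Y p =
     (let c = chart_at A p in
        frechet_derivative (local_rep A c Y) (at (snd c p)) (X p)
      - frechet_derivative (local_rep A c X) (at (snd c p)) (Y p))"

section \<open>Semi-Riemannian metrics and the Levi-Civita connection\<close>

definition form_index :: "('e::euclidean_space \<Rightarrow> 'e \<Rightarrow> real) \<Rightarrow> nat" where
  "form_index b =
     (GREATEST k. \<exists>W. subspace W \<and> dim W = k \<and> (\<forall>w\<in>W. w \<noteq> 0 \<longrightarrow> b w w < 0))"

definition semi_riemannian_metric ::
  "('p::topological_space, 'e::euclidean_space) chart set \<Rightarrow> ('p \<Rightarrow> 'e \<Rightarrow> 'e \<Rightarrow> real) \<Rightarrow> nat \<Rightarrow> bool"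
where
  "semi_riemannian_metric A g \<nu> \<longleftrightarrow>
     (\<forall>p. bilinear (g p) \<and> (\<forall>x y. g p x y = g p y x) \<and>
          (\<forall>x. (\<forall>y. g p x y = 0) \<longrightarrow> x = 0) \<and> form_index (g p) = \<nu>) \<and>
     (\<forall>U X Y. open U \<and> smooth_vf A U X \<and> smooth_vf A U Y \<longrightarrow>
        smooth_fun A U (\<lambda>p. g p (X p) (Y p)))"

text \<open>Connections act on vector fields defined on arbitrary open sets \<open>U\<close>. As vector fields are
  total functions, the second clause says that the values of \<open>D X Y\<close> on \<open>U\<close> depend only on
  \<open>X\<close> and \<open>Y\<close> on \<open>U\<close>; in particular \<open>D\<close> commutes with restriction to smaller open sets.\<close>

definition affine_connection ::
  "('p::topological_space, 'e::euclidean_space) chart set \<Rightarrow>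
   (('p \<Rightarrow> 'e) \<Rightarrow> ('p \<Rightarrow> 'e) \<Rightarrow> 'p \<Rightarrow> 'e) \<Rightarrow> bool" where
  "affine_connection A D \<longleftrightarrow> (\<forall>U. open U \<longrightarrow>
     (\<forall>X Y. smooth_vf A U X \<and> smooth_vf A U Y \<longrightarrow> smooth_vf A U (D X Y)) \<and>
     (\<forall>X X' Y Y'. smooth_vf A U X \<and> smooth_vf A U Y \<and> smooth_vf A U X' \<and> smooth_vf A U Y' \<and>
        (\<forall>q\<in>U. X q = X' q \<and> Y q = Y' q) \<longrightarrow> (\<forall>q\<in>U. D X Y q = D X' Y' q)) \<and>
     (\<forall>X X' Y. smooth_vf A U X \<and> smooth_vf A U X' \<and> smooth_vf A U Y \<longrightarrow>
        (\<forall>q\<in>U. D (\<lambda>p. X p + X' p) Y q = D X Y q + D X' Y q)) \<and>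
     (\<forall>f X Y. smooth_fun A U f \<and> smooth_vf A U X \<and> smooth_vf A U Y \<longrightarrow>
        (\<forall>q\<in>U. D (\<lambda>p. f p *\<^sub>R X p) Y q = f q *\<^sub>R D X Y q)) \<and>
     (\<forall>X Y Y'. smooth_vf A U X \<and> smooth_vf A U Y \<and> smooth_vf A U Y' \<longrightarrow>
        (\<forall>q\<in>U. D X (\<lambda>p. Y p + Y' p) q = D X Y q + D X Y' q)) \<and>
     (\<forall>f X Y. smooth_fun A U f \<and> smooth_vf A U X \<and> smooth_vf A U Y \<longrightarrow>
        (\<forall>q\<in>U. D X (\<lambda>p. f p *\<^sub>R Y p) q = vderiv A f q (X q) *\<^sub>R Y q + f q *\<^sub>R D X Y q)))"

definition levi_civita ::
  "('p::topological_space, 'e::euclidean_space) chart set \<Rightarrow> ('p \<Rightarrow> 'e \<Rightarrow> 'e \<Rightarrow> real) \<Rightarrow>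
   (('p \<Rightarrow> 'e) \<Rightarrow> ('p \<Rightarrow> 'e) \<Rightarrow> 'p \<Rightarrow> 'e) \<Rightarrow> bool" where
  "levi_civita A g D \<longleftrightarrow> affine_connection A D \<and> (\<forall>U. open U \<longrightarrow>
     (\<forall>X Y. smooth_vf A U X \<and> smooth_vf A U Y \<longrightarrow>
        (\<forall>q\<in>U. D X Y q - D Y X q = lie_bracket A X Y q)) \<and>
     (\<forall>X Y Z. smooth_vf A U X \<and> smooth_vf A U Y \<and> smooth_vf A U Z \<longrightarrow>
        (\<forall>q\<in>U. vderiv A (\<lambda>p. g p (Y p) (Z p)) q (X q)
                 = g q (D X Y q) (Z q) + g q (Y q) (D X Z q))))"

definition curvature_field ::
  "('p, 'e::euclidean_space) chart set \<Rightarrow> (('p \<Rightarrow> 'e) \<Rightarrow> ('p \<Rightarrow> 'e) \<Rightarrow> 'p \<Rightarrow> 'e) \<Rightarrow>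
   ('p \<Rightarrow> 'e) \<Rightarrow> ('p \<Rightarrow> 'e) \<Rightarrow> ('p \<Rightarrow> 'e) \<Rightarrow> 'p \<Rightarrow> 'e" where
  "curvature_field A D X Y Z p = D X (D Y Z) p - D Y (D X Z) p - D (lie_bracket A X Y) Z p"

text \<open>The value of the curvature tensor on tangent vectors at \<open>p\<close> is computed with the extensions
  whose components in the preferred chart at \<open>p\<close> are constant; by tensoriality every other choice
  of extensions gives the same value.\<close>

definition curvature_at ::
  "('p, 'e::euclidean_space) chart set \<Rightarrow> (('p \<Rightarrow> 'e) \<Rightarrow> ('p \<Rightarrow> 'e) \<Rightarrow> 'p \<Rightarrow> 'e) \<Rightarrow>
   'p \<Rightarrow> 'e \<Rightarrow> 'e \<Rightarrow> 'e \<Rightarrow> 'e" where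
  "curvature_at A D p x y z =
     (let E = (\<lambda>v q. tvec A (chart_at A p) q v) in curvature_field A D (E x) (E y) (E z) p)"

section \<open>Submanifolds\<close>

definition slice_chart ::
  "('p::topological_space, 'e::euclidean_space) chart set \<Rightarrow> 'p set \<Rightarrow> nat \<Rightarrow>
   ('p, 'e) chart \<Rightarrow> 'e set \<Rightarrow> bool" where
  "slice_chart A M k c E \<longleftrightarrow> c \<in> maximal_atlas A \<and> subspace E \<and> dim E = k \<and>
     snd c ` (fst c \<inter> M) = snd c ` fst c \<inter> E"

definition submanifold ::
  "('p::topological_space, 'e::euclidean_space) chart set \<Rightarrow> 'p set \<Rightarrow> nat \<Rightarrow> bool" where
  "submanifold A M k \<longleftrightarrow> (\<forall>p\<in>M. \<exists>c E. p \<in> fst c \<and> slice_chart A M k c E)"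

definition tangent_space ::
  "('p::topological_space, 'e::euclidean_space) chart set \<Rightarrow> 'p set \<Rightarrow> 'p \<Rightarrow> 'e set" where
  "tangent_space A M p =
     {v. \<exists>c E k. p \<in> fst c \<and> slice_chart A M k c E \<and> tcomp A c p v \<in> E}"

text \<open>Smoothness along an arbitrary subset \<open>V\<close> means local extendability to smooth objects on the
  ambient manifold. If \<open>V\<close> is open in an embedded submanifold, this is smoothness in the
  submanifold's own differentiable structure.\<close>

definition smooth_fun_along ::
  "('p::topological_space, 'e::euclidean_space) chart set \<Rightarrow> 'p set \<Rightarrow> ('p \<Rightarrow> real) \<Rightarrow> bool" where
  "smooth_fun_along A V f \<longleftrightarrow>
     (\<forall>p\<in>V. \<exists>U F. open U \<and> p \<in> U \<and> smooth_fun A U F \<and> (\<forall>q\<in>U \<inter> V. F q = f q))"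

definition smooth_vf_along ::
  "('p::topological_space, 'e::euclidean_space) chart set \<Rightarrow> 'p set \<Rightarrow> ('p \<Rightarrow> 'e) \<Rightarrow> bool" where
  "smooth_vf_along A V X \<longleftrightarrow>
     (\<forall>p\<in>V. \<exists>U Z. open U \<and> p \<in> U \<and> smooth_vf A U Z \<and> (\<forall>q\<in>U \<inter> V. Z q = X q))"

definition sections ::
  "('p::topological_space, 'e::euclidean_space) chart set \<Rightarrow> 'p set \<Rightarrow> ('p \<Rightarrow> 'e set) \<Rightarrow>
   ('p \<Rightarrow> 'e) set" where
  "sections A V B = {X. smooth_vf_along A V X \<and> (\<forall>q\<in>V. X q \<in> B q)}"

definition frame_on ::
  "('p::topological_space, 'e::euclidean_space) chart set \<Rightarrow> 'p set \<Rightarrow> nat \<Rightarrow> ('p \<Rightarrow> 'e set) \<Rightarrow>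
   (nat \<Rightarrow> 'p \<Rightarrow> 'e) \<Rightarrow> bool" where
  "frame_on A V k B \<xi> \<longleftrightarrow> (\<forall>i\<in>{1..k}. smooth_vf_along A V (\<xi> i)) \<and>
     (\<forall>q\<in>V. inj_on (\<lambda>i. \<xi> i q) {1..k} \<and> independent ((\<lambda>i. \<xi> i q) ` {1..k}) \<and>
            span ((\<lambda>i. \<xi> i q) ` {1..k}) = B q)"

text \<open>The fibres of \<open>B\<close> lie in the ambient tangent spaces; they need not be tangent to \<open>M\<close>.\<close>

definition smooth_distribution ::
  "('p::topological_space, 'e::euclidean_space) chart set \<Rightarrow> 'p set \<Rightarrow> nat \<Rightarrow> ('p \<Rightarrow> 'e set) \<Rightarrow> bool"
where
  "smooth_distribution A M k B \<longleftrightarrow>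
     (\<forall>p\<in>M. \<exists>V \<xi>. p \<in> V \<and> openin (top_of_set M) V \<and> frame_on A V k B \<xi>)"

text \<open>Integrability: there is an integral manifold through every point.\<close>

definition integrable_distribution ::
  "('p::topological_space, 'e::euclidean_space) chart set \<Rightarrow> 'p set \<Rightarrow> nat \<Rightarrow> ('p \<Rightarrow> 'e set) \<Rightarrow> bool"
where
  "integrable_distribution A M k B \<longleftrightarrow>
     (\<forall>p\<in>M. \<exists>I. p \<in> I \<and> I \<subseteq> M \<and> submanifold A I k \<and> (\<forall>q\<in>I. tangent_space A I q = B q))"

text \<open>A chosen local extension, near \<open>p\<close>, of a vector field along \<open>M\<close> (which need not be
  tangent to \<open>M\<close>) to the ambient manifold. The operations below do not depend on the choice when
  the fields that are differentiated along are tangent to \<open>M\<close>.\<close>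

definition extension ::
  "('p::topological_space, 'e::euclidean_space) chart set \<Rightarrow> 'p set \<Rightarrow> ('p \<Rightarrow> 'e) \<Rightarrow> 'p \<Rightarrow> 'p \<Rightarrow> 'e"
where
  "extension A M X p =
     (SOME Z. \<exists>U. open U \<and> p \<in> U \<and> smooth_vf A U Z \<and> (\<forall>q\<in>U \<inter> M. Z q = X q))"

definition bracket_along ::
  "('p::topological_space, 'e::euclidean_space) chart set \<Rightarrow> 'p set \<Rightarrow>
   ('p \<Rightarrow> 'e) \<Rightarrow> ('p \<Rightarrow> 'e) \<Rightarrow> 'p \<Rightarrow> 'e" where
  "bracket_along A M X Y p = lie_bracket A (extension A M X p) (extension A M Y p) p"

definition nabla_bar ::
  "('p::topological_space, 'e::euclidean_space) chart set \<Rightarrow>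
   (('p \<Rightarrow> 'e) \<Rightarrow> ('p \<Rightarrow> 'e) \<Rightarrow> 'p \<Rightarrow> 'e) \<Rightarrow> 'p set \<Rightarrow> ('p \<Rightarrow> 'e) \<Rightarrow> ('p \<Rightarrow> 'e) \<Rightarrow> 'p \<Rightarrow> 'e" where
  "nabla_bar A D M X Y p = D (extension A M X p) (extension A M Y p) p"

section \<open>Lightlike submanifolds\<close>

definition perp_in :: "('e \<Rightarrow> 'e \<Rightarrow> real) \<Rightarrow> 'e set \<Rightarrow> 'e set" where
  "perp_in b W = {x. \<forall>y\<in>W. b x y = 0}"

definition Rad ::
  "('p::topological_space, 'e::euclidean_space) chart set \<Rightarrow> ('p \<Rightarrow> 'e \<Rightarrow> 'e \<Rightarrow> real) \<Rightarrow>
   'p set \<Rightarrow> 'p \<Rightarrow> 'e set" where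
  "Rad A g M p = tangent_space A M p \<inter> perp_in (g p) (tangent_space A M p)"

definition lightlike_submanifold ::
  "('p::topological_space, 'e::euclidean_space) chart set \<Rightarrow> ('p \<Rightarrow> 'e \<Rightarrow> 'e \<Rightarrow> real) \<Rightarrow>
   'p set \<Rightarrow> nat \<Rightarrow> bool" where
  "lightlike_submanifold A g M r \<longleftrightarrow> 0 < r \<and> smooth_distribution A M r (Rad A g M)"

text \<open>\<open>proj_along V W\<close>: projection onto \<open>V\<close> along \<open>W\<close>, meant for vectors in the direct sum of
  \<open>V\<close> and \<open>W\<close>.\<close>

definition proj_along :: "'e::ab_group_add set \<Rightarrow> 'e set \<Rightarrow> 'e \<Rightarrow> 'e" where
  "proj_along V W x = (THE v. v \<in> V \<and> x - v \<in> W)"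

definition screen_distribution ::
  "('p::topological_space, 'e::euclidean_space) chart set \<Rightarrow> ('p \<Rightarrow> 'e \<Rightarrow> 'e \<Rightarrow> real) \<Rightarrow>
   'p set \<Rightarrow> ('p \<Rightarrow> 'e set) \<Rightarrow> bool" where
  "screen_distribution A g M S \<longleftrightarrow> (\<exists>k. smooth_distribution A M k S) \<and>
     (\<forall>p\<in>M. S p \<inter> Rad A g M p = {0} \<and>
        {s + \<xi> | s \<xi>. s \<in> S p \<and> \<xi> \<in> Rad A g M p} = tangent_space A M p \<and>
        (\<forall>x\<in>S p. (\<forall>y\<in>S p. g p x y = 0) \<longrightarrow> x = 0))"

definition screen_proj ::
  "('p::topological_space, 'e::euclidean_space) chart set \<Rightarrow> ('p \<Rightarrow> 'e \<Rightarrow> 'e \<Rightarrow> real) \<Rightarrow>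
   'p set \<Rightarrow> ('p \<Rightarrow> 'e set) \<Rightarrow> 'p \<Rightarrow> 'e \<Rightarrow> 'e" where
  "screen_proj A g M S p = proj_along (S p) (Rad A g M p)"

text \<open>\<open>N\<close> is a local frame of the transversal bundle \<open>L\<close>, dual to the frame \<open>\<xi>\<close> of \<open>Rad\<close>.\<close>

definition transversal_frame ::
  "('p::topological_space, 'e::euclidean_space) chart set \<Rightarrow> ('p \<Rightarrow> 'e \<Rightarrow> 'e \<Rightarrow> real) \<Rightarrow>
   ('p \<Rightarrow> 'e set) \<Rightarrow> nat \<Rightarrow> ('p \<Rightarrow> 'e set) \<Rightarrow> 'p set \<Rightarrow>
   (nat \<Rightarrow> 'p \<Rightarrow> 'e) \<Rightarrow> (nat \<Rightarrow> 'p \<Rightarrow> 'e) \<Rightarrow> bool" where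
  "transversal_frame A g S r L V \<xi> N \<longleftrightarrow>
     (\<forall>i\<in>{1..r}. smooth_vf_along A V (N i)) \<and>
     (\<forall>q\<in>V. (\<forall>i\<in>{1..r}. N i q \<in> perp_in (g q) (S q)) \<and>
        (\<forall>i\<in>{1..r}. \<forall>j\<in>{1..r}. g q (\<xi> i q) (N j q) = (if i = j then 1 else 0) \<and>
                                 g q (N i q) (N j q) = 0) \<and>
        span ((\<lambda>i. N i q) ` {1..r}) = L q)"

text \<open>For \<open>r > 1\<close> the screen distribution does not determine the sections \<open>N i\<close> nor their span,
  so the lightlike transversal bundle \<open>L\<close> is a datum of its own.\<close>

definition lightlike_transversal ::
  "('p::topological_space, 'e::euclidean_space) chart set \<Rightarrow> ('p \<Rightarrow> 'e \<Rightarrow> 'e \<Rightarrow> real) \<Rightarrow>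
   'p set \<Rightarrow> ('p \<Rightarrow> 'e set) \<Rightarrow> nat \<Rightarrow> ('p \<Rightarrow> 'e set) \<Rightarrow> bool" where
  "lightlike_transversal A g M S r L \<longleftrightarrow>
     (\<forall>V \<xi>. openin (top_of_set M) V \<and> frame_on A V r (Rad A g M) \<xi> \<longrightarrow>
        (\<exists>N. transversal_frame A g S r L V \<xi> N))"

definition nabla ::
  "('p::topological_space, 'e::euclidean_space) chart set \<Rightarrow>
   (('p \<Rightarrow> 'e) \<Rightarrow> ('p \<Rightarrow> 'e) \<Rightarrow> 'p \<Rightarrow> 'e) \<Rightarrow> 'p set \<Rightarrow> ('p \<Rightarrow> 'e set) \<Rightarrow>
   ('p \<Rightarrow> 'e) \<Rightarrow> ('p \<Rightarrow> 'e) \<Rightarrow> 'p \<Rightarrow> 'e" where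
  "nabla A D M L X Y p = proj_along (tangent_space A M p) (L p) (nabla_bar A D M X Y p)"

definition h_l ::
  "('p::topological_space, 'e::euclidean_space) chart set \<Rightarrow>
   (('p \<Rightarrow> 'e) \<Rightarrow> ('p \<Rightarrow> 'e) \<Rightarrow> 'p \<Rightarrow> 'e) \<Rightarrow> 'p set \<Rightarrow> ('p \<Rightarrow> 'e set) \<Rightarrow>
   ('p \<Rightarrow> 'e) \<Rightarrow> ('p \<Rightarrow> 'e) \<Rightarrow> 'p \<Rightarrow> 'e" where
  "h_l A D M L X Y p = proj_along (L p) (tangent_space A M p) (nabla_bar A D M X Y p)"

text \<open>In \<open>h_star\<close> the second vector field is a section of \<open>S\<close>.\<close>

definition h_star ::
  "('p::topological_space, 'e::euclidean_space) chart set \<Rightarrow> ('p \<Rightarrow> 'e \<Rightarrow> 'e \<Rightarrow> real) \<Rightarrow>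
   (('p \<Rightarrow> 'e) \<Rightarrow> ('p \<Rightarrow> 'e) \<Rightarrow> 'p \<Rightarrow> 'e) \<Rightarrow> 'p set \<Rightarrow> ('p \<Rightarrow> 'e set) \<Rightarrow> ('p \<Rightarrow> 'e set) \<Rightarrow>
   ('p \<Rightarrow> 'e) \<Rightarrow> ('p \<Rightarrow> 'e) \<Rightarrow> 'p \<Rightarrow> 'e" where
  "h_star A g D M S L X Y p = proj_along (Rad A g M p) (S p) (nabla A D M L X Y p)"

text \<open>The condition relating the local second fundamental forms of the screen distribution and of
  \<open>M\<close>, with respect to local dual frames \<open>\<xi>\<close>, \<open>N\<close> around every point.\<close>

definition screen_conformal ::
  "('p::topological_space, 'e::euclidean_space) chart set \<Rightarrow> ('p \<Rightarrow> 'e \<Rightarrow> 'e \<Rightarrow> real) \<Rightarrow>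
   (('p \<Rightarrow> 'e) \<Rightarrow> ('p \<Rightarrow> 'e) \<Rightarrow> 'p \<Rightarrow> 'e) \<Rightarrow> 'p set \<Rightarrow> ('p \<Rightarrow> 'e set) \<Rightarrow> nat \<Rightarrow>
   ('p \<Rightarrow> 'e set) \<Rightarrow> bool" where
  "screen_conformal A g D M S r L \<longleftrightarrow>
     (\<forall>p\<in>M. \<exists>V \<xi> N \<phi>. p \<in> V \<and> openin (top_of_set M) V \<and>
        frame_on A V r (Rad A g M) \<xi> \<and> transversal_frame A g S r L V \<xi> N \<and>
        (\<forall>i\<in>{1..r}. smooth_fun_along A V (\<phi> i)) \<and>
        (\<forall>X\<in>sections A V (tangent_space A M). \<forall>Y\<in>sections A V (tangent_space A M).
           let PY = (\<lambda>q. screen_proj A g M S q (Y q)) in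
           \<forall>i\<in>{1..r}. \<forall>q\<in>V.
             g q (h_star A g D M S L X PY q) (N i q) = \<phi> i q * g q (h_l A D M L X PY q) (\<xi> i q)))"

section \<open>The induced curvature\<close>

definition induced_curvature ::
  "('p::topological_space, 'e::euclidean_space) chart set \<Rightarrow>
   (('p \<Rightarrow> 'e) \<Rightarrow> ('p \<Rightarrow> 'e) \<Rightarrow> 'p \<Rightarrow> 'e) \<Rightarrow> 'p set \<Rightarrow> ('p \<Rightarrow> 'e set) \<Rightarrow>
   ('p \<Rightarrow> 'e) \<Rightarrow> ('p \<Rightarrow> 'e) \<Rightarrow> ('p \<Rightarrow> 'e) \<Rightarrow> 'p \<Rightarrow> 'e" where
  "induced_curvature A D M L X Y Z p =
     nabla A D M L X (nabla A D M L Y Z) p - nabla A D M L Y (nabla A D M L X Z) p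
     - nabla A D M L (bracket_along A M X Y) Z p"

definition linear_on_sub :: "'e::real_vector set \<Rightarrow> ('e \<Rightarrow> real) \<Rightarrow> bool" where
  "linear_on_sub W f \<longleftrightarrow> (\<forall>x\<in>W. \<forall>y\<in>W. \<forall>a b. f (a *\<^sub>R x + b *\<^sub>R y) = a * f x + b * f y)"

definition algebraic_curvature_tensor ::
  "'e::real_vector set \<Rightarrow> ('e \<Rightarrow> 'e \<Rightarrow> 'e \<Rightarrow> 'e \<Rightarrow> real) \<Rightarrow> bool" where
  "algebraic_curvature_tensor W F \<longleftrightarrow>
     (\<forall>x\<in>W. \<forall>y\<in>W. \<forall>z\<in>W.
        linear_on_sub W (\<lambda>t. F t x y z) \<and> linear_on_sub W (\<lambda>t. F x t y z) \<and>
        linear_on_sub W (\<lambda>t. F x y t z) \<and> linear_on_sub W (\<lambda>t. F x y z t)) \<and>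
     (\<forall>x\<in>W. \<forall>y\<in>W. \<forall>z\<in>W. \<forall>w\<in>W.
        F x y z w = - F y x z w \<and> F x y z w = F z w x y \<and>
        F x y z w + F y z x w + F z x y w = 0)"

text \<open>An operator \<open>R\<close> on local sections of the tangent bundle of \<open>M\<close> defines an algebraic curvature
  tensor: at every point, \<open>g (R(X,Y)Z, U)\<close> depends only on the values of the sections, and does so
  through a form \<open>F\<close> with the required properties. As every tangent vector is the value of a local
  section, \<open>F\<close> is unique on the tangent space.\<close>

definition defines_algebraic_curvature_tensor ::
  "('p::topological_space, 'e::euclidean_space) chart set \<Rightarrow> ('p \<Rightarrow> 'e \<Rightarrow> 'e \<Rightarrow> real) \<Rightarrow> 'p set \<Rightarrow>
   (('p \<Rightarrow> 'e) \<Rightarrow> ('p \<Rightarrow> 'e) \<Rightarrow> ('p \<Rightarrow> 'e) \<Rightarrow> 'p \<Rightarrow> 'e) \<Rightarrow> bool" where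
  "defines_algebraic_curvature_tensor A g M R \<longleftrightarrow>
     (\<forall>p\<in>M. \<exists>F. algebraic_curvature_tensor (tangent_space A M p) F \<and>
        (\<forall>V X Y Z U. p \<in> V \<and> openin (top_of_set M) V \<and>
           {X, Y, Z, U} \<subseteq> sections A V (tangent_space A M) \<longrightarrow>
           g p (R X Y Z p) (U p) = F (X p) (Y p) (Z p) (U p)))"

end

theory Submission
  imports Defs
begin

text \<open>
  Write \<open>T\<close> for the tangent spaces of \<open>M\<close>, \<open>Rd\<close> for the radical and \<open>P\<close> for the projection of \<open>T\<close>
  onto the screen. The idea is to compare the induced curvature with the ambient one by a Gauss
  equation and to see that both parts of the comparison have the required symmetries.

  Since the radical is orthogonal to \<open>T\<close>, the number \<open>g (R(X,Y)Z, U)\<close> does not change when \<open>U\<close> is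
  replaced by \<open>P U\<close>, and the latter is orthogonal to the transversal bundle. Differentiating
  \<open>nabla Y Z = D Y Z - (\<Sum>i. h i (Y,Z) N i)\<close> once more gives (lemma \<open>Gauss_equation\<close>)
  \<open>g (R(X,Y)Z, U) = R4 X Y Z (P U) + (\<Sum>i. h i (Y,Z) * b i (X,P U) - h i (X,Z) * b i (Y,P U))\<close>,
  where \<open>R4\<close> is the ambient curvature and \<open>h i\<close>, \<open>b i\<close> are the second fundamental forms with respect
  to \<open>\<xi> i\<close>, \<open>N i\<close>. The hypothesis of screen conformality says \<open>b i (X,P U) = \<phi> i * h i (X,P U)\<close>.

  Integrability of the radical makes \<open>h i (X,\<xi> j)\<close> vanish (lemma \<open>h_Rad\<close>): it is skew in \<open>i\<close> and \<open>j\<close>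
  because \<open>g (\<xi> i) (\<xi> j) = 0\<close>, and it is symmetric in \<open>i\<close> and \<open>j\<close> because \<open>[\<xi> i, \<xi> j]\<close> is radical.
  Hence \<open>h i (X,P U) = h i (X,U)\<close>, and the sum becomes a combination of the Gauss terms of the
  symmetric forms \<open>h i\<close>, which are algebraic curvature tensors. The holonomy condition and the pair
  symmetry of \<open>R4\<close> give \<open>R4 x y z (P u) = R4 (P x) (P y) (P z) (P u)\<close> (lemma \<open>R4_screen\<close>), the
  pull-back of an algebraic curvature tensor.

  All these formulas are pointwise, whereas connections act on fields. The symmetries of \<open>R4\<close> are
  therefore proved for vector fields, and its tensoriality follows from them: the last argument
  obviously enters through its value only, and skew-symmetry and pair symmetry move every other
  argument to the last place. The forms \<open>h i\<close> and \<open>b i\<close> are written in Weingarten form, as derivatives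
  of \<open>\<xi> i\<close> and \<open>N i\<close>, so that they are pointwise from the start. That covariant
  derivatives along \<open>M\<close> do not depend on extensions rests on tensoriality of \<open>D\<close> in its first
  argument and on compatibility with the metric.
\<close>

section \<open>Calculus of smooth maps\<close>

abbreviation fd :: "('a::real_normed_vector \<Rightarrow> 'b::real_normed_vector) \<Rightarrow> 'a \<Rightarrow> 'a \<Rightarrow> 'b" where
  "fd f x \<equiv> frechet_derivative f (at x)"

lemma fd_eq: "(f has_derivative f') (at x) \<Longrightarrow> fd f x = f'"
  by (rule frechet_derivative_at[symmetric])

lemma has_derivative_fd: "f differentiable at x \<Longrightarrow> (f has_derivative fd f x) (at x)"
  by (simp add: frechet_derivative_works)

lemma fd_chain:
  assumes "g differentiable at x" "f differentiable at (g x)"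
  shows "fd (\<lambda>x. f (g x)) x v = fd f (g x) (fd g x v)"
  using fd_eq[OF diff_chain_at[OF has_derivative_fd[OF assms(1)] has_derivative_fd[OF assms(2)]]]
  by (simp add: o_def)

lemma has_derivative_cong_open:
  assumes "open S" "x \<in> S" "\<And>y. y \<in> S \<Longrightarrow> f y = g y"
  shows "(f has_derivative f') (at x) \<longleftrightarrow> (g has_derivative f') (at x)"
proof
  assume "(f has_derivative f') (at x)"
  then show "(g has_derivative f') (at x)"
    by (rule has_derivative_transform_within_open[OF _ assms(1,2)]) (rule assms(3))
next
  assume "(g has_derivative f') (at x)"
  then show "(f has_derivative f') (at x)"
    by (rule has_derivative_transform_within_open[OF _ assms(1,2)]) (rule assms(3)[symmetric])
qed

lemma fd_cong:
  assumes "open S" "x \<in> S" "\<And>y. y \<in> S \<Longrightarrow> f y = g y"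
  shows "fd f x = fd g x"
  unfolding frechet_derivative_def by (simp add: has_derivative_cong_open[OF assms])

lemma differentiable_cong_open:
  assumes "open S" "x \<in> S" "\<And>y. y \<in> S \<Longrightarrow> f y = g y"
  shows "f differentiable at x \<longleftrightarrow> g differentiable at x"
  unfolding differentiable_def by (simp add: has_derivative_cong_open[OF assms])

lemma Ck_on_cong:
  assumes "open S" "\<And>x. x \<in> S \<Longrightarrow> f x = g x"
  shows "Ck_on k S f \<longleftrightarrow> Ck_on k S g"
  using assms(2)
proof (induction k arbitrary: f g)
  case 0
  then show ?case by (auto cong: continuous_on_cong)
next
  case (Suc k)
  have "Ck_on k S (\<lambda>x. fd f x v) \<longleftrightarrow> Ck_on k S (\<lambda>x. fd g x v)" for v
    by (rule Suc.IH) (simp add: fd_cong[OF assms(1) _ Suc.prems])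
  moreover have "f differentiable at x \<longleftrightarrow> g differentiable at x" if "x \<in> S" for x
    by (rule differentiable_cong_open[OF assms(1) that Suc.prems])
  ultimately show ?case by auto
qed

lemma Ck_on_congI: "open S \<Longrightarrow> Ck_on k S g \<Longrightarrow> (\<And>x. x \<in> S \<Longrightarrow> f x = g x) \<Longrightarrow> Ck_on k S f"
  by (simp add: Ck_on_cong[of S f g])

lemma Ck_on_subset: "Ck_on k S f \<Longrightarrow> T \<subseteq> S \<Longrightarrow> Ck_on k T f"
  by (induction k arbitrary: f) (auto intro: continuous_on_subset)

lemma Ck_on_Suc_imp: "Ck_on (Suc k) S f \<Longrightarrow> Ck_on k S f"
proof (induction k arbitrary: f)
  case 0
  then show ?case
    by (auto intro!: continuous_at_imp_continuous_on differentiable_imp_continuous_within)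
next
  case (Suc k)
  have "Ck_on k S (\<lambda>x. fd f x v)" for v by (rule Suc.IH) (use Suc.prems in simp)
  then show ?case using Suc.prems by simp
qed

lemma Ck_on_locally:
  assumes "\<And>x. x \<in> S \<Longrightarrow> \<exists>U. open U \<and> x \<in> U \<and> Ck_on k U f"
  shows "Ck_on k S f"
  using assms
proof (induction k arbitrary: f)
  case 0
  have "isCont f x" if "x \<in> S" for x
    using 0[OF that] continuous_on_eq_continuous_at by auto
  then show ?case by (simp add: continuous_at_imp_continuous_on)
next
  case (Suc k)
  have "Ck_on k S (\<lambda>x. fd f x v)" for v
  proof (rule Suc.IH)
    fix x assume "x \<in> S"
    from Suc.prems[OF this] show "\<exists>U. open U \<and> x \<in> U \<and> Ck_on k U (\<lambda>x. fd f x v)" by auto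
  qed
  moreover have "f differentiable at x" if "x \<in> S" for x
    using Suc.prems[OF that] by auto
  ultimately show ?case by simp
qed

lemma Ck_on_const: "Ck_on k S (\<lambda>x. c)"
  by (induction k arbitrary: c) auto

lemma Ck_on_bounded_linear:
  assumes "bounded_linear T" "open S" "Ck_on k S f"
  shows "Ck_on k S (\<lambda>x. T (f x))"
  using assms(3)
proof (induction k arbitrary: f)
  case 0
  then show ?case using assms(1) by (simp add: bounded_linear.continuous_on)
next
  case (Suc k)
  have d: "((\<lambda>x. T (f x)) has_derivative (\<lambda>v. T (fd f x v))) (at x)" if "x \<in> S" for x
    using bounded_linear.has_derivative[OF assms(1) has_derivative_fd] Suc.prems that by auto
  have "Ck_on k S (\<lambda>x. fd (\<lambda>x. T (f x)) x v)" for v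
  proof -
    have "Ck_on k S (\<lambda>x. T (fd f x v))" using Suc by simp
    then show ?thesis by (rule Ck_on_congI[OF assms(2)]) (simp add: fd_eq[OF d])
  qed
  then show ?case using differentiableI[OF d] by simp
qed

lemma Ck_on_add:
  assumes "open S" "Ck_on k S f" "Ck_on k S g"
  shows "Ck_on k S (\<lambda>x. f x + g x)"
  using assms(2,3)
proof (induction k arbitrary: f g)
  case 0
  then show ?case by (simp add: continuous_on_add)
next
  case (Suc k)
  have d: "((\<lambda>x. f x + g x) has_derivative (\<lambda>v. fd f x v + fd g x v)) (at x)" if "x \<in> S" for x
    using Suc.prems that by (auto intro!: has_derivative_add has_derivative_fd)
  have "Ck_on k S (\<lambda>x. fd (\<lambda>x. f x + g x) x v)" for v
  proof -
    have "Ck_on k S (\<lambda>x. fd f x v + fd g x v)" using Suc by simp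
    then show ?thesis by (rule Ck_on_congI[OF assms(1)]) (simp add: fd_eq[OF d])
  qed
  then show ?case using differentiableI[OF d] by simp
qed

lemma Ck_on_bounded_bilinear:
  assumes "bounded_bilinear B" "open S" "Ck_on k S f" "Ck_on k S g"
  shows "Ck_on k S (\<lambda>x. B (f x) (g x))"
  using assms(3,4)
proof (induction k arbitrary: f g)
  case 0
  then show ?case using bounded_bilinear.continuous_on[OF assms(1)] by simp
next
  case (Suc k)
  have d: "((\<lambda>x. B (f x) (g x)) has_derivative (\<lambda>v. B (f x) (fd g x v) + B (fd f x v) (g x))) (at x)"
    if "x \<in> S" for x
    using Suc.prems that
    by (intro bounded_bilinear.FDERIV[OF assms(1)] has_derivative_fd) auto
  have "Ck_on k S (\<lambda>x. fd (\<lambda>x. B (f x) (g x)) x v)" for v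
  proof -
    have "Ck_on k S (\<lambda>x. B (f x) (fd g x v) + B (fd f x v) (g x))"
      by (intro Ck_on_add[OF assms(2)] Suc.IH)
        (use Suc.prems Ck_on_Suc_imp in auto)
    then show ?thesis by (rule Ck_on_congI[OF assms(2)]) (simp add: fd_eq[OF d])
  qed
  then show ?case using differentiableI[OF d] by simp
qed

lemma Ck_on_sum:
  assumes "open S" "\<And>i. i \<in> I \<Longrightarrow> Ck_on k S (f i)"
  shows "Ck_on k S (\<lambda>x. \<Sum>i\<in>I. f i x)"
  using assms(2)
  by (induction I rule: infinite_finite_induct) (auto simp: Ck_on_const intro!: Ck_on_add[OF assms(1)])

lemma linear_Basis_expansion:
  fixes f :: "'a::euclidean_space \<Rightarrow> 'b::real_vector"
  assumes "linear f"
  shows "f v = (\<Sum>b\<in>Basis. (v \<bullet> b) *\<^sub>R f b)"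
proof -
  have "f v = f (\<Sum>b\<in>Basis. (v \<bullet> b) *\<^sub>R b)" by (simp add: euclidean_representation)
  then show ?thesis by (simp add: linear_sum[OF assms] linear_scale[OF assms])
qed

lemma fd_Basis_expansion:
  fixes f :: "'a::euclidean_space \<Rightarrow> 'b::real_normed_vector"
  assumes "f differentiable at x"
  shows "fd f x v = (\<Sum>b\<in>Basis. (v \<bullet> b) *\<^sub>R fd f x b)"
  by (rule linear_Basis_expansion[OF linear_frechet_derivative[OF assms]])

text \<open>\<open>Ck_on\<close> differentiates in fixed directions only, but the chain rule produces the moving direction
  \<open>fd g x v\<close>. Expanding it in a basis leaves a sum of products of functions to which the induction
  hypothesis applies; this is why the intermediate space is Euclidean.\<close>

lemma Ck_on_compose:
  fixes f :: "'b::euclidean_space \<Rightarrow> 'c::real_normed_vector" and g :: "'a::real_normed_vector \<Rightarrow> 'b"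
  assumes "open S" "open T" "g ` S \<subseteq> T" "Ck_on k T f" "Ck_on k S g"
  shows "Ck_on k S (\<lambda>x. f (g x))"
  using assms(4,5)
proof (induction k arbitrary: f)
  case 0
  then show ?case using assms(3) continuous_on_compose2[of T f S g] by auto
next
  case (Suc k)
  have df: "f differentiable at (g x)" and dg: "g differentiable at x" if "x \<in> S" for x
    using Suc.prems that assms(3) by auto
  have d: "((\<lambda>x. f (g x)) has_derivative (\<lambda>v. fd f (g x) (fd g x v))) (at x)" if "x \<in> S" for x
    using diff_chain_at[OF has_derivative_fd[OF dg] has_derivative_fd[OF df]] that
    by (simp add: o_def)
  have g: "Ck_on k S g" using Suc.prems Ck_on_Suc_imp by blast
  have "Ck_on k S (\<lambda>x. fd (\<lambda>x. f (g x)) x v)" for v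
  proof -
    have "Ck_on k S (\<lambda>x. \<Sum>b\<in>Basis. (fd g x v \<bullet> b) *\<^sub>R fd f (g x) b)"
      using Suc g
      by (intro Ck_on_sum[OF assms(1)] Ck_on_bounded_bilinear[OF bounded_bilinear_scaleR assms(1)]
          Ck_on_bounded_linear[OF bounded_linear_inner_left assms(1)] Suc.IH) auto
    moreover have "fd (\<lambda>x. f (g x)) x v = (\<Sum>b\<in>Basis. (fd g x v \<bullet> b) *\<^sub>R fd f (g x) b)"
      if "x \<in> S" for x
      by (simp add: fd_eq[OF d[OF that]] fd_Basis_expansion[OF df[OF that], of "fd g x v"])
    ultimately show ?thesis by (rule Ck_on_congI[OF assms(1)])
  qed
  then show ?case using differentiableI[OF d] by simp
qed

lemma smooth_on_cong: "open S \<Longrightarrow> (\<And>x. x \<in> S \<Longrightarrow> f x = g x) \<Longrightarrow> smooth_on S f \<longleftrightarrow> smooth_on S g"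
  by (simp add: smooth_on_def Ck_on_cong[of S f g])

lemma smooth_on_congI: "open S \<Longrightarrow> smooth_on S g \<Longrightarrow> (\<And>x. x \<in> S \<Longrightarrow> f x = g x) \<Longrightarrow> smooth_on S f"
  by (simp add: smooth_on_cong[of S f g])

lemma smooth_on_subset: "smooth_on S f \<Longrightarrow> T \<subseteq> S \<Longrightarrow> smooth_on T f"
  by (auto simp: smooth_on_def intro: Ck_on_subset)

lemma smooth_on_locally:
  "(\<And>x. x \<in> S \<Longrightarrow> \<exists>U. open U \<and> x \<in> U \<and> smooth_on U f) \<Longrightarrow> smooth_on S f"
  unfolding smooth_on_def by (intro allI Ck_on_locally) blast

lemma smooth_on_const: "smooth_on S (\<lambda>x. c)"
  by (simp add: smooth_on_def Ck_on_const)

lemma smooth_on_add: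
  "open S \<Longrightarrow> smooth_on S f \<Longrightarrow> smooth_on S g \<Longrightarrow> smooth_on S (\<lambda>x. f x + g x)"
  by (simp add: smooth_on_def Ck_on_add)

lemma smooth_on_sum:
  "open S \<Longrightarrow> (\<And>i. i \<in> I \<Longrightarrow> smooth_on S (f i)) \<Longrightarrow> smooth_on S (\<lambda>x. \<Sum>i\<in>I. f i x)"
  by (simp add: smooth_on_def Ck_on_sum)

lemma smooth_on_scaleR:
  "open S \<Longrightarrow> smooth_on S f \<Longrightarrow> smooth_on S g \<Longrightarrow> smooth_on S (\<lambda>x. f x *\<^sub>R g x)"
  by (simp add: smooth_on_def Ck_on_bounded_bilinear[OF bounded_bilinear_scaleR])

lemma smooth_on_inner:
  "open S \<Longrightarrow> smooth_on S f \<Longrightarrow> smooth_on S g \<Longrightarrow> smooth_on S (\<lambda>x. f x \<bullet> g x)"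
  by (simp add: smooth_on_def Ck_on_bounded_bilinear[OF bounded_bilinear_inner])

lemma smooth_on_compose:
  fixes f :: "'b::euclidean_space \<Rightarrow> 'c::real_normed_vector" and g :: "'a::real_normed_vector \<Rightarrow> 'b"
  assumes "open S" "open T" "g ` S \<subseteq> T" "smooth_on T f" "smooth_on S g"
  shows "smooth_on S (\<lambda>x. f (g x))"
  using assms(4,5) by (simp add: smooth_on_def Ck_on_compose[OF assms(1-3)])

lemma smooth_on_differentiable: "smooth_on S f \<Longrightarrow> x \<in> S \<Longrightarrow> f differentiable at x"
  unfolding smooth_on_def by (drule spec[of _ "Suc 0"]) simp

lemma smooth_on_fd: "smooth_on S f \<Longrightarrow> smooth_on S (\<lambda>x. fd f x v)"
  unfolding smooth_on_def
proof
  fix k assume "\<forall>k. Ck_on k S f"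
  then have "Ck_on (Suc k) S f" by blast
  then show "Ck_on k S (\<lambda>x. fd f x v)" by simp
qed

lemma smooth_on_continuous_on: "smooth_on S f \<Longrightarrow> continuous_on S f"
  unfolding smooth_on_def by (drule spec[of _ 0]) simp

lemma smooth_on_ident: "smooth_on S (\<lambda>x. x)"
  unfolding smooth_on_def
proof
  fix k show "Ck_on k S (\<lambda>x. x)" by (cases k) (auto simp: Ck_on_const)
qed

section \<open>Symmetry of second derivatives\<close>

text \<open>The mean value theorem is applied twice, in the direction \<open>u\<close> to a difference in the direction \<open>v\<close>,
  and then in the direction \<open>v\<close>. The point of the formula is that its left-hand side is symmetric in
  \<open>u\<close> and \<open>v\<close>.\<close>

lemma second_difference_mvt:
  fixes F :: "'a::real_normed_vector \<Rightarrow> real"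
  assumes h: "h > 0"
    and dF: "\<And>s t. 0 \<le> s \<Longrightarrow> s \<le> h \<Longrightarrow> 0 \<le> t \<Longrightarrow> t \<le> h \<Longrightarrow> F differentiable at (x + s *\<^sub>R u + t *\<^sub>R v)"
    and ddF: "\<And>s t. 0 \<le> s \<Longrightarrow> s \<le> h \<Longrightarrow> 0 \<le> t \<Longrightarrow> t \<le> h \<Longrightarrow>
      (\<lambda>y. fd F y u) differentiable at (x + s *\<^sub>R u + t *\<^sub>R v)"
  shows "\<exists>s t. 0 \<le> s \<and> s \<le> h \<and> 0 \<le> t \<and> t \<le> h \<and>
     F (x + h *\<^sub>R u + h *\<^sub>R v) - F (x + h *\<^sub>R u) - F (x + h *\<^sub>R v) + F x
     = h * h * fd (\<lambda>y. fd F y u) (x + s *\<^sub>R u + t *\<^sub>R v) v"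
proof -
  define G where "G s = F (x + s *\<^sub>R u + h *\<^sub>R v) - F (x + s *\<^sub>R u + 0 *\<^sub>R v)" for s
  have line: "((\<lambda>s. F (x + s *\<^sub>R u + t *\<^sub>R v)) has_derivative
        (\<lambda>r. fd F (x + s *\<^sub>R u + t *\<^sub>R v) (r *\<^sub>R u))) (at s)"
    if "0 \<le> s" "s \<le> h" "0 \<le> t" "t \<le> h" for s t
  proof -
    have "((\<lambda>s. x + s *\<^sub>R u + t *\<^sub>R v) has_derivative (\<lambda>r. r *\<^sub>R u)) (at s)"
      by (auto intro!: derivative_eq_intros)
    from diff_chain_at[OF this has_derivative_fd[OF dF[OF that]]] show ?thesis by (simp add: o_def)
  qed
  have lin: "fd F (x + s *\<^sub>R u + t *\<^sub>R v) (r *\<^sub>R u) = r * fd F (x + s *\<^sub>R u + t *\<^sub>R v) u"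
    if "0 \<le> s" "s \<le> h" "0 \<le> t" "t \<le> h" for r s t
    using linear_scale[OF linear_frechet_derivative[OF dF[OF that]]] by simp
  have dG: "(G has_real_derivative
      (fd F (x + s *\<^sub>R u + h *\<^sub>R v) u - fd F (x + s *\<^sub>R u + 0 *\<^sub>R v) u)) (at s)" if "0 \<le> s" "s \<le> h" for s
  proof -
    have "(G has_derivative (\<lambda>r. fd F (x + s *\<^sub>R u + h *\<^sub>R v) (r *\<^sub>R u)
        - fd F (x + s *\<^sub>R u + 0 *\<^sub>R v) (r *\<^sub>R u))) (at s)"
      unfolding G_def by (intro has_derivative_diff line) (use that h in auto)
    moreover have "(\<lambda>r. fd F (x + s *\<^sub>R u + h *\<^sub>R v) (r *\<^sub>R u) - fd F (x + s *\<^sub>R u + 0 *\<^sub>R v) (r *\<^sub>R u))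
        = (*) (fd F (x + s *\<^sub>R u + h *\<^sub>R v) u - fd F (x + s *\<^sub>R u + 0 *\<^sub>R v) u)"
    proof
      fix r
      have "fd F (x + s *\<^sub>R u + h *\<^sub>R v) (r *\<^sub>R u) = r * fd F (x + s *\<^sub>R u + h *\<^sub>R v) u"
        by (rule lin) (use that h in auto)
      moreover have "fd F (x + s *\<^sub>R u + 0 *\<^sub>R v) (r *\<^sub>R u) = r * fd F (x + s *\<^sub>R u + 0 *\<^sub>R v) u"
        by (rule lin) (use that h in auto)
      ultimately show "fd F (x + s *\<^sub>R u + h *\<^sub>R v) (r *\<^sub>R u) - fd F (x + s *\<^sub>R u + 0 *\<^sub>R v) (r *\<^sub>R u)
        = (fd F (x + s *\<^sub>R u + h *\<^sub>R v) u - fd F (x + s *\<^sub>R u + 0 *\<^sub>R v) u) * r"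
        by (simp only: right_diff_distrib left_diff_distrib mult.commute[of _ r])
    qed
    ultimately show ?thesis unfolding has_field_derivative_def by simp
  qed
  from MVT2[OF h dG] obtain s where s: "0 < s" "s < h"
    and G: "G h - G 0 = (h - 0) * (fd F (x + s *\<^sub>R u + h *\<^sub>R v) u - fd F (x + s *\<^sub>R u + 0 *\<^sub>R v) u)"
    by blast
  define K where "K t = fd F (x + s *\<^sub>R u + t *\<^sub>R v) u" for t
  have dK: "(K has_real_derivative fd (\<lambda>y. fd F y u) (x + s *\<^sub>R u + t *\<^sub>R v) v) (at t)"
    if "0 \<le> t" "t \<le> h" for t
  proof -
    note dd = ddF[OF _ _ that, of s]
    have "((\<lambda>t. x + s *\<^sub>R u + t *\<^sub>R v) has_derivative (\<lambda>r. r *\<^sub>R v)) (at t)"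
      by (auto intro!: derivative_eq_intros)
    from diff_chain_at[OF this has_derivative_fd[OF dd]] s
    have "(K has_derivative (\<lambda>r. fd (\<lambda>y. fd F y u) (x + s *\<^sub>R u + t *\<^sub>R v) (r *\<^sub>R v))) (at t)"
      by (simp add: o_def K_def[abs_def])
    then show ?thesis
      unfolding has_field_derivative_def
      using linear_scale[OF linear_frechet_derivative[OF dd]] s by (simp add: mult_commute_abs)
  qed
  from MVT2[OF h dK] obtain t where t: "0 < t" "t < h"
    and K: "K h - K 0 = (h - 0) * fd (\<lambda>y. fd F y u) (x + s *\<^sub>R u + t *\<^sub>R v) v"
    by blast
  have "F (x + h *\<^sub>R u + h *\<^sub>R v) - F (x + h *\<^sub>R u) - F (x + h *\<^sub>R v) + F x = G h - G 0"
    by (simp add: G_def)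
  also have "\<dots> = h * (K h - K 0)" using G by (simp add: K_def)
  also have "\<dots> = h * h * fd (\<lambda>y. fd F y u) (x + s *\<^sub>R u + t *\<^sub>R v) v" using K by simp
  finally show ?thesis using s t by (intro exI[of _ s] exI[of _ t]) auto
qed

text \<open>Over any small parallelogram at \<open>x\<close> the symmetric second difference is the area factor times either
  mixed derivative, each taken at some point of the parallelogram. By continuity the two mixed
  derivatives cannot be separated at \<open>x\<close>.\<close>

lemma second_derivative_symmetric_real:
  fixes F :: "'a::real_normed_vector \<Rightarrow> real"
  assumes S: "open S" "x \<in> S" and F: "smooth_on S F"
  shows "fd (\<lambda>y. fd F y u) x v = fd (\<lambda>y. fd F y v) x u"
proof (rule ccontr)
  define P where "P y = fd (\<lambda>y. fd F y u) y v" for y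
  define Q where "Q y = fd (\<lambda>y. fd F y v) y u" for y
  assume "\<not> ?thesis"
  then have ne: "P x \<noteq> Q x" by (simp add: P_def Q_def)
  (* half the gap: two values within e of P x and of Q x cannot agree *)
  define e where "e = \<bar>P x - Q x\<bar> / 2"
  have e: "e > 0" using ne by (simp add: e_def)
  have cont: "isCont (\<lambda>y. fd (\<lambda>y. fd F y a) y b) x" for a b
    using smooth_on_continuous_on[OF smooth_on_fd[OF smooth_on_fd[OF F]]] S
    by (simp add: continuous_on_eq_continuous_at)
  have "isCont P x" unfolding P_def[abs_def] by (rule cont)
  then have "\<exists>d>0. \<forall>y. dist y x < d \<longrightarrow> dist (P y) (P x) < e"
    using e unfolding continuous_at_eps_delta by simp
  then obtain d1 where d1: "d1 > 0" "\<And>y. dist y x < d1 \<Longrightarrow> dist (P y) (P x) < e" by auto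
  have "isCont Q x" unfolding Q_def[abs_def] by (rule cont)
  then have "\<exists>d>0. \<forall>y. dist y x < d \<longrightarrow> dist (Q y) (Q x) < e"
    using e unfolding continuous_at_eps_delta by simp
  then obtain d2 where d2: "d2 > 0" "\<And>y. dist y x < d2 \<Longrightarrow> dist (Q y) (Q x) < e" by auto
  obtain d3 where d3: "d3 > 0" "ball x d3 \<subseteq> S"
    by (rule openE[OF S])
  define d where "d = min d1 (min d2 d3)"
  have d: "d > 0" using d1 d2 d3 by (simp add: d_def)
  (* the parallelogram spanned by h u and h v then lies in the d-ball around x *)
  define h where "h = d / (2 * (norm u + norm v + 1))"
  have h: "h > 0" using d by (simp add: h_def add_nonneg_pos)
  have close: "dist (x + s *\<^sub>R a + t *\<^sub>R b) x < d"
    if "0 \<le> s" "s \<le> h" "0 \<le> t" "t \<le> h" "norm a + norm b = norm u + norm v" for s t a b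
  proof -
    have "dist (x + s *\<^sub>R a + t *\<^sub>R b) x = norm (s *\<^sub>R a + t *\<^sub>R b)"
      by (simp only: dist_norm add.assoc add_diff_cancel_left')
    also have "\<dots> \<le> norm (s *\<^sub>R a) + norm (t *\<^sub>R b)" by (rule norm_triangle_ineq)
    also have "\<dots> = s * norm a + t * norm b" using that(1,3) by simp
    also have "\<dots> \<le> h * norm a + h * norm b"
      by (intro add_mono mult_right_mono that norm_ge_zero)
    also have "\<dots> = h * (norm u + norm v)" unfolding that(5)[symmetric] by (simp only: distrib_left)
    also have "\<dots> \<le> h * (norm u + norm v + 1)" by (rule mult_left_mono) (use h in auto)
    also have "\<dots> = d / 2"
    proof -
      have "norm u + norm v + 1 > 0" by (simp add: add_nonneg_pos)
      then have "d / (2 * K) * K = d / 2" if "K = norm u + norm v + 1" for K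
        unfolding that[symmetric] by simp
      from this[OF refl] show ?thesis by (simp only: h_def)
    qed
    finally show ?thesis using d by simp
  qed
  have inS: "y \<in> S" if "dist y x < d" for y
    by (rule subsetD[OF d3(2)]) (use that in \<open>simp add: d_def dist_commute\<close>)
  have dF: "F differentiable at (x + s *\<^sub>R a + t *\<^sub>R b)"
    if "0 \<le> s" "s \<le> h" "0 \<le> t" "t \<le> h" "norm a + norm b = norm u + norm v" for s t a b
    by (rule smooth_on_differentiable[OF F inS[OF close[OF that]]])
  have ddF: "(\<lambda>y. fd F y c) differentiable at (x + s *\<^sub>R a + t *\<^sub>R b)"
    if "0 \<le> s" "s \<le> h" "0 \<le> t" "t \<le> h" "norm a + norm b = norm u + norm v" for s t a b c
    by (rule smooth_on_differentiable[OF smooth_on_fd[OF F] inS[OF close[OF that]]])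
  have "\<exists>s t. 0 \<le> s \<and> s \<le> h \<and> 0 \<le> t \<and> t \<le> h \<and>
     F (x + h *\<^sub>R u + h *\<^sub>R v) - F (x + h *\<^sub>R u) - F (x + h *\<^sub>R v) + F x
     = h * h * P (x + s *\<^sub>R u + t *\<^sub>R v)"
    unfolding P_def by (rule second_difference_mvt[OF h]; rule dF ddF; simp)
  then obtain s t where st: "0 \<le> s" "s \<le> h" "0 \<le> t" "t \<le> h"
    and 1: "F (x + h *\<^sub>R u + h *\<^sub>R v) - F (x + h *\<^sub>R u) - F (x + h *\<^sub>R v) + F x
     = h * h * P (x + s *\<^sub>R u + t *\<^sub>R v)" by blast
  have "\<exists>s t. 0 \<le> s \<and> s \<le> h \<and> 0 \<le> t \<and> t \<le> h \<and>
     F (x + h *\<^sub>R v + h *\<^sub>R u) - F (x + h *\<^sub>R v) - F (x + h *\<^sub>R u) + F x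
     = h * h * Q (x + s *\<^sub>R v + t *\<^sub>R u)"
    unfolding Q_def by (rule second_difference_mvt[OF h]; rule dF ddF; simp)
  then obtain s' t' where st': "0 \<le> s'" "s' \<le> h" "0 \<le> t'" "t' \<le> h"
    and 2: "F (x + h *\<^sub>R v + h *\<^sub>R u) - F (x + h *\<^sub>R v) - F (x + h *\<^sub>R u) + F x
     = h * h * Q (x + s' *\<^sub>R v + t' *\<^sub>R u)" by blast
  have "h * h * P (x + s *\<^sub>R u + t *\<^sub>R v) = h * h * Q (x + s' *\<^sub>R v + t' *\<^sub>R u)"
    using 1 2 by (simp add: algebra_simps)
  then have eq: "P (x + s *\<^sub>R u + t *\<^sub>R v) = Q (x + s' *\<^sub>R v + t' *\<^sub>R u)" using h by simp
  have "dist (P (x + s *\<^sub>R u + t *\<^sub>R v)) (P x) < e" using d1(2) close[OF st] by (simp add: d_def)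
  moreover have "dist (Q (x + s' *\<^sub>R v + t' *\<^sub>R u)) (Q x) < e"
    using d2(2) close[OF st'] by (simp add: d_def add.commute)
  ultimately have "\<bar>P x - Q x\<bar> < 2 * e" using eq by (simp add: dist_real_def)
  then show False by (simp add: e_def)
qed

lemma second_derivative_symmetric:
  fixes f :: "'a::real_normed_vector \<Rightarrow> 'b::euclidean_space"
  assumes S: "open S" "x \<in> S" and f: "smooth_on S f"
  shows "fd (\<lambda>y. fd f y u) x v = fd (\<lambda>y. fd f y v) x u"
proof (rule euclidean_eqI)
  fix b :: 'b assume b: "b \<in> Basis"
  have inner_fd: "fd (\<lambda>y. h y \<bullet> b) y w = fd h y w \<bullet> b" if "smooth_on S h" "y \<in> S" for h :: "'a \<Rightarrow> 'b" and y w
    using fd_eq[OF has_derivative_inner_left[OF has_derivative_fd[OF smooth_on_differentiable[OF that]]]]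
    by simp
  have sm: "smooth_on S (\<lambda>y. f y \<bullet> b)"
    using smooth_on_inner[OF S(1) f smooth_on_const] .
  have "fd (\<lambda>y. fd f y u) x v \<bullet> b = fd (\<lambda>y. fd (\<lambda>y. f y \<bullet> b) y u) x v" for u v
  proof -
    have "fd (\<lambda>y. fd f y u) x v \<bullet> b = fd (\<lambda>y. fd f y u \<bullet> b) x v"
      using inner_fd[OF smooth_on_fd[OF f] S(2)] by simp
    also have "\<dots> = fd (\<lambda>y. fd (\<lambda>y. f y \<bullet> b) y u) x v"
      by (subst fd_cong[OF S]) (auto simp: inner_fd[OF f])
    finally show ?thesis .
  qed
  then show "fd (\<lambda>y. fd f y u) x v \<bullet> b = fd (\<lambda>y. fd f y v) x u \<bullet> b"
    using second_derivative_symmetric_real[OF S sm] by simp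
qed

text \<open>The product rule for \<open>f'(y)(w y)\<close>. Derivatives of functions along vector fields and changes of
  charts for vector fields both have this form in coordinates.\<close>

lemma has_derivative_fd_apply:
  fixes f :: "'a::euclidean_space \<Rightarrow> 'b::euclidean_space"
  assumes S: "open S" "x \<in> S" and f: "smooth_on S f" and w: "w differentiable at x"
  shows "((\<lambda>y. fd f y (w y)) has_derivative
           (\<lambda>v. fd (\<lambda>y. fd f y (w x)) x v + fd f x (fd w x v))) (at x)"
proof -
  have df: "f differentiable at y" if "y \<in> S" for y using smooth_on_differentiable[OF f that] .
  have ddf: "(\<lambda>y. fd f y b) differentiable at x" for b
    using smooth_on_differentiable[OF smooth_on_fd[OF f] S(2)] .
  have "((\<lambda>y. \<Sum>b\<in>Basis. (w y \<bullet> b) *\<^sub>R fd f y b) has_derivative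
      (\<lambda>v. \<Sum>b\<in>Basis. (w x \<bullet> b) *\<^sub>R fd (\<lambda>y. fd f y b) x v + (fd w x v \<bullet> b) *\<^sub>R fd f x b)) (at x)"
    by (intro has_derivative_sum has_derivative_scaleR has_derivative_inner_left has_derivative_fd w ddf)
  moreover have "(\<Sum>b\<in>Basis. (w x \<bullet> b) *\<^sub>R fd (\<lambda>y. fd f y b) x v + (fd w x v \<bullet> b) *\<^sub>R fd f x b)
     = fd (\<lambda>y. fd f y (w x)) x v + fd f x (fd w x v)" for v
  proof -
    have lin: "linear (fd (\<lambda>y. fd f y v) x)" using linear_frechet_derivative[OF ddf] .
    have "(\<Sum>b\<in>Basis. (w x \<bullet> b) *\<^sub>R fd (\<lambda>y. fd f y b) x v)
        = (\<Sum>b\<in>Basis. (w x \<bullet> b) *\<^sub>R fd (\<lambda>y. fd f y v) x b)"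
      by (simp add: second_derivative_symmetric[OF S f, of _ v])
    also have "\<dots> = fd (\<lambda>y. fd f y v) x (w x)" using linear_Basis_expansion[OF lin, of "w x"] by simp
    also have "\<dots> = fd (\<lambda>y. fd f y (w x)) x v" by (rule second_derivative_symmetric[OF S f])
    finally show ?thesis
      using fd_Basis_expansion[OF df[OF S(2)], of "fd w x v"] by (simp add: sum.distrib)
  qed
  ultimately have "((\<lambda>y. \<Sum>b\<in>Basis. (w y \<bullet> b) *\<^sub>R fd f y b) has_derivative
      (\<lambda>v. fd (\<lambda>y. fd f y (w x)) x v + fd f x (fd w x v))) (at x)" by simp
  then show ?thesis
    by (rule has_derivative_transform_within_open[OF _ S]) (rule fd_Basis_expansion[OF df, symmetric])
qed

lemma smooth_on_fd_apply:
  fixes f :: "'a::euclidean_space \<Rightarrow> 'b::real_normed_vector"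
  assumes S: "open S" and f: "smooth_on S f" and w: "smooth_on S w"
  shows "smooth_on S (\<lambda>y. fd f y (w y))"
proof -
  have "smooth_on S (\<lambda>y. \<Sum>b\<in>Basis. (w y \<bullet> b) *\<^sub>R fd f y b)"
    by (rule smooth_on_sum[OF S smooth_on_scaleR[OF S smooth_on_inner[OF S w smooth_on_const] smooth_on_fd[OF f]]])
  moreover have "fd f y (w y) = (\<Sum>b\<in>Basis. (w y \<bullet> b) *\<^sub>R fd f y b)" if "y \<in> S" for y
    by (rule fd_Basis_expansion[OF smooth_on_differentiable[OF f that]])
  ultimately show ?thesis by (rule smooth_on_congI[OF S])
qed

section \<open>Smooth functions and vector fields in charts\<close>

abbreviation transition :: "('p, 'e) chart \<Rightarrow> ('p, 'e) chart \<Rightarrow> 'e \<Rightarrow> 'e" where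
  "transition c d \<equiv> \<lambda>x. snd d (chart_inv c x)"

lemma chart_inv_snd: "is_chart c \<Longrightarrow> q \<in> fst c \<Longrightarrow> chart_inv c (snd c q) = q"
  unfolding is_chart_def using homeomorphism_apply1 by blast

lemma open_chart_image:
  assumes "is_chart c" "open U" "U \<subseteq> fst c"
  shows "open (snd c ` U)"
proof -
  have h: "homeomorphism (fst c) (snd c ` fst c) (snd c) (chart_inv c)" and o: "open (snd c ` fst c)"
    using assms(1) by (simp_all add: is_chart_def)
  have "openin (top_of_set (fst c)) U" using assms(2,3) by (rule open_subset[rotated])
  from homeomorphism_imp_open_map[OF h this] o show ?thesis by (rule openin_open_trans)
qed

locale smooth_mfd =
  fixes A :: "('p::t2_space, 'e::euclidean_space) chart set"
  assumes atlas: "smooth_atlas A"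
begin

lemma atlas_maximal: "c \<in> A \<Longrightarrow> c \<in> maximal_atlas A"
  using atlas by (simp add: smooth_atlas_def maximal_atlas_def)

lemma maximal_is_chart: "c \<in> maximal_atlas A \<Longrightarrow> is_chart c"
  by (simp add: maximal_atlas_def)

lemma maximal_open: "c \<in> maximal_atlas A \<Longrightarrow> open (fst c)"
  by (simp add: maximal_atlas_def is_chart_def)

lemma chart_at_mem: "chart_at A p \<in> A" and chart_at_dom: "p \<in> fst (chart_at A p)"
proof -
  have "p \<in> (\<Union>c\<in>A. fst c)" using atlas by (simp add: smooth_atlas_def)
  then have "\<exists>c. c \<in> A \<and> p \<in> fst c" by auto
  then have "chart_at A p \<in> A \<and> p \<in> fst (chart_at A p)"
    unfolding chart_at_def by (rule someI_ex)
  then show "chart_at A p \<in> A" "p \<in> fst (chart_at A p)" by auto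
qed

lemmas chart_at_maximal = atlas_maximal[OF chart_at_mem]

lemma inv_snd: "c \<in> maximal_atlas A \<Longrightarrow> q \<in> fst c \<Longrightarrow> chart_inv c (snd c q) = q"
  by (rule chart_inv_snd[OF maximal_is_chart])

lemma open_image: "c \<in> maximal_atlas A \<Longrightarrow> open U \<Longrightarrow> U \<subseteq> fst c \<Longrightarrow> open (snd c ` U)"
  by (rule open_chart_image[OF maximal_is_chart])

lemma smooth_change_chart:
  fixes h :: "'p \<Rightarrow> 'b::real_normed_vector"
  assumes c: "c \<in> maximal_atlas A" and d: "d \<in> maximal_atlas A" and U: "open U" "U \<subseteq> fst c" "U \<subseteq> fst d"
    and transition: "smooth_on (snd c ` U) (transition c d)"
    and h: "smooth_on (snd d ` U) (\<lambda>x. h (chart_inv d x))"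
  shows "smooth_on (snd c ` U) (\<lambda>x. h (chart_inv c x))"
proof -
  have o: "open (snd c ` U)" "open (snd d ` U)" by (rule open_image; fact)+
  have sub: "transition c d ` snd c ` U \<subseteq> snd d ` U"
    using U(2) inv_snd[OF c] by auto
  have "smooth_on (snd c ` U) (\<lambda>x. h (chart_inv d (snd d (chart_inv c x))))"
    by (rule smooth_on_compose[OF o sub h transition])
  then show ?thesis
  proof (rule smooth_on_congI[OF o(1)])
    fix x assume "x \<in> snd c ` U"
    then obtain q where q: "q \<in> U" "x = snd c q" by auto
    moreover have "q \<in> fst c" "q \<in> fst d" using q U by auto
    ultimately show "h (chart_inv c x) = h (chart_inv d (snd d (chart_inv c x)))"
      by (simp add: inv_snd[OF c] inv_snd[OF d])
  qed
qed

text \<open>Two charts of the maximal atlas are by definition compatible with the charts of \<open>A\<close>, not with each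
  other. Near each point the transition map factors through a chart of \<open>A\<close>.\<close>

lemma transition_smooth:
  assumes c: "c \<in> maximal_atlas A" and d: "d \<in> maximal_atlas A"
  shows "smooth_on (snd c ` (fst c \<inter> fst d)) (transition c d)"
proof (rule smooth_on_locally)
  fix x assume "x \<in> snd c ` (fst c \<inter> fst d)"
  then obtain q where q: "q \<in> fst c" "q \<in> fst d" "x = snd c q" by auto
  define a where "a = chart_at A q"
  have a: "a \<in> A" "q \<in> fst a" and am: "a \<in> maximal_atlas A"
    using chart_at_mem chart_at_dom chart_at_maximal by (auto simp: a_def)
  define U where "U = fst c \<inter> fst d \<inter> fst a"
  have U: "open U" "U \<subseteq> fst c" "U \<subseteq> fst a" "U \<subseteq> fst d"
    using maximal_open[OF c] maximal_open[OF d] maximal_open[OF am] by (auto simp: U_def)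
  have ca: "smooth_on (snd c ` (fst c \<inter> fst a)) (transition c a)"
    using c a(1) by (simp add: maximal_atlas_def compatible_def o_def)
  have ad: "smooth_on (snd a ` (fst d \<inter> fst a)) (transition a d)"
    using d a(1) by (simp add: maximal_atlas_def compatible_def o_def)
  have "smooth_on (snd c ` U) (transition c d)"
  proof (rule smooth_change_chart[OF c am U(1-3)])
    show "smooth_on (snd c ` U) (transition c a)" by (rule smooth_on_subset[OF ca]) (auto simp: U_def)
    show "smooth_on (snd a ` U) (transition a d)" by (rule smooth_on_subset[OF ad]) (auto simp: U_def)
  qed
  moreover have "open (snd c ` U)" by (rule open_image[OF c U(1,2)])
  moreover have "x \<in> snd c ` U" using q a by (auto simp: U_def)
  ultimately show "\<exists>U. open U \<and> x \<in> U \<and> smooth_on U (transition c d)" by (intro exI[of _ "snd c ` U"] conjI)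
qed

lemma transition_differentiable:
  assumes "c \<in> maximal_atlas A" "d \<in> maximal_atlas A" "q \<in> fst c" "q \<in> fst d"
  shows "transition c d differentiable at (snd c q)"
  by (rule smooth_on_differentiable[OF transition_smooth[OF assms(1,2)]]) (use assms(3,4) in auto)

lemma fd_transition_compose:
  assumes c: "c \<in> maximal_atlas A" "q \<in> fst c" and d: "d \<in> maximal_atlas A" "q \<in> fst d"
    and e: "e \<in> maximal_atlas A" "q \<in> fst e"
  shows "fd (transition d e) (snd d q) (fd (transition c d) (snd c q) v) = fd (transition c e) (snd c q) v"
proof -
  define U where "U = snd c ` (fst c \<inter> fst d)"
  have U: "open U"
    unfolding U_def by (rule open_image[OF c(1)]) (use maximal_open[OF c(1)] maximal_open[OF d(1)] in auto)
  have "fd (transition c e) (snd c q) = fd (\<lambda>x. transition d e (transition c d x)) (snd c q)"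
  proof (rule fd_cong[OF U])
    show "snd c q \<in> U" using c d by (auto simp: U_def)
    fix y assume "y \<in> U"
    then obtain p where p: "p \<in> fst c" "p \<in> fst d" "y = snd c p" by (auto simp: U_def)
    then show "transition c e y = transition d e (transition c d y)" by (simp add: inv_snd[OF c(1)] inv_snd[OF d(1)])
  qed
  moreover have "fd (\<lambda>x. transition d e (transition c d x)) (snd c q) v
      = fd (transition d e) (transition c d (snd c q)) (fd (transition c d) (snd c q) v)"
    using transition_differentiable[OF c(1) d(1) c(2) d(2)] transition_differentiable[OF d(1) e(1) d(2) e(2)]
    by (intro fd_chain) (simp_all add: inv_snd[OF c])
  ultimately show ?thesis by (simp add: inv_snd[OF c])
qed

lemma fd_transition_self:
  assumes c: "c \<in> maximal_atlas A" "q \<in> fst c"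
  shows "fd (transition c c) (snd c q) v = v"
proof -
  have "fd (transition c c) (snd c q) = fd (\<lambda>x. x) (snd c q)"
    by (rule fd_cong[OF open_image[OF c(1) maximal_open[OF c(1)] subset_refl]])
      (use c inv_snd[OF c(1)] in auto)
  then show ?thesis by simp
qed

lemma tcomp_eq: "tcomp A c q v = fd (transition (chart_at A q) c) (snd (chart_at A q) q) v"
  by (simp add: tcomp_def o_def)

lemma tvec_eq: "tvec A c q v = fd (transition c (chart_at A q)) (snd c q) v"
  by (simp add: tvec_def o_def)

lemma tcomp_change:
  assumes "c \<in> maximal_atlas A" "q \<in> fst c" "d \<in> maximal_atlas A" "q \<in> fst d"
  shows "fd (transition c d) (snd c q) (tcomp A c q v) = tcomp A d q v"
  unfolding tcomp_eq using fd_transition_compose[OF chart_at_maximal chart_at_dom assms] by simp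

lemma linear_tcomp:
  assumes "c \<in> maximal_atlas A" "q \<in> fst c"
  shows "linear (tcomp A c q)"
  unfolding tcomp_eq[abs_def]
  using linear_frechet_derivative[OF transition_differentiable[OF chart_at_maximal assms(1) chart_at_dom assms(2)]]
  by simp

lemma linear_tvec:
  assumes "c \<in> maximal_atlas A" "q \<in> fst c"
  shows "linear (tvec A c q)"
  unfolding tvec_eq[abs_def]
  using linear_frechet_derivative[OF transition_differentiable[OF assms(1) chart_at_maximal assms(2) chart_at_dom]]
  by simp

lemma tcomp_tvec:
  assumes "c \<in> maximal_atlas A" "q \<in> fst c"
  shows "tcomp A c q (tvec A c q v) = v"
  unfolding tcomp_eq tvec_eq
  using fd_transition_compose[OF assms chart_at_maximal chart_at_dom assms] fd_transition_self[OF assms] by simp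

lemma tvec_tcomp:
  assumes "c \<in> maximal_atlas A" "q \<in> fst c"
  shows "tvec A c q (tcomp A c q v) = v"
  unfolding tcomp_eq tvec_eq
  using fd_transition_compose[OF chart_at_maximal chart_at_dom assms chart_at_maximal chart_at_dom]
    fd_transition_self[OF chart_at_maximal chart_at_dom] by simp

lemma tcomp_chart_at: "tcomp A (chart_at A q) q v = v"
  unfolding tcomp_eq by (rule fd_transition_self[OF chart_at_maximal chart_at_dom])

lemma tvec_chart_at: "tvec A (chart_at A q) q v = v"
  unfolding tvec_eq by (rule fd_transition_self[OF chart_at_maximal chart_at_dom])

text \<open>Smoothness is defined by the charts of \<open>A\<close>, but slice charts of submanifolds belong to the maximal
  atlas. This lemma and its converse, together with the analogues for vector fields, make
  the difference irrelevant.\<close>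

lemma smooth_fun_chart:
  assumes U: "open U" and f: "smooth_fun A U f" and c: "c \<in> maximal_atlas A"
  shows "smooth_on (snd c ` (U \<inter> fst c)) (\<lambda>x. f (chart_inv c x))"
proof (rule smooth_on_locally)
  fix x assume "x \<in> snd c ` (U \<inter> fst c)"
  then obtain q where q: "q \<in> U" "q \<in> fst c" "x = snd c q" by auto
  define a where "a = chart_at A q"
  have a: "a \<in> A" "q \<in> fst a" and am: "a \<in> maximal_atlas A"
    using chart_at_mem chart_at_dom chart_at_maximal by (auto simp: a_def)
  define W where "W = U \<inter> fst c \<inter> fst a"
  have W: "open W" "W \<subseteq> fst c" "W \<subseteq> fst a"
    using U maximal_open[OF c] maximal_open[OF am] by (auto simp: W_def)
  have fa: "smooth_on (snd a ` (U \<inter> fst a)) (\<lambda>x. f (chart_inv a x))"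
    using f a(1) by (simp add: smooth_fun_def o_def)
  have "smooth_on (snd c ` W) (\<lambda>x. f (chart_inv c x))"
  proof (rule smooth_change_chart[OF c am W])
    show "smooth_on (snd c ` W) (transition c a)"
      by (rule smooth_on_subset[OF transition_smooth[OF c am]]) (auto simp: W_def)
    show "smooth_on (snd a ` W) (\<lambda>x. f (chart_inv a x))"
      by (rule smooth_on_subset[OF fa]) (auto simp: W_def)
  qed
  moreover have "open (snd c ` W)" by (rule open_image[OF c W(1,2)])
  moreover have "x \<in> snd c ` W" using q a by (auto simp: W_def)
  ultimately show "\<exists>U. open U \<and> x \<in> U \<and> smooth_on U (\<lambda>x. f (chart_inv c x))"
    by (intro exI[of _ "snd c ` W"] conjI)
qed

lemma smooth_funI_chart:
  assumes U: "open U" "U \<subseteq> fst c" and c: "c \<in> maximal_atlas A"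
    and f: "smooth_on (snd c ` U) (\<lambda>x. f (chart_inv c x))"
  shows "smooth_fun A U f"
  unfolding smooth_fun_def o_def
proof
  fix d assume "d \<in> A"
  then have d: "d \<in> maximal_atlas A" by (rule atlas_maximal)
  show "smooth_on (snd d ` (U \<inter> fst d)) (\<lambda>x. f (chart_inv d x))"
  proof (rule smooth_change_chart[OF d c])
    show "open (U \<inter> fst d)" using U maximal_open[OF d] by auto
    show "U \<inter> fst d \<subseteq> fst d" "U \<inter> fst d \<subseteq> fst c" using U by auto
    show "smooth_on (snd d ` (U \<inter> fst d)) (transition d c)"
      by (rule smooth_on_subset[OF transition_smooth[OF d c]]) (use U in auto)
    show "smooth_on (snd c ` (U \<inter> fst d)) (\<lambda>x. f (chart_inv c x))"
      by (rule smooth_on_subset[OF f]) auto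
  qed
qed

lemma smooth_fun_differentiable:
  assumes "open U" "smooth_fun A U f" "c \<in> maximal_atlas A" "p \<in> U" "p \<in> fst c"
  shows "(\<lambda>x. f (chart_inv c x)) differentiable at (snd c p)"
  by (rule smooth_on_differentiable[OF smooth_fun_chart[OF assms(1-3)]]) (use assms(4,5) in auto)

lemma smooth_fun_const: "smooth_fun A U (\<lambda>_. k)"
  by (simp add: smooth_fun_def o_def smooth_on_const)

lemma local_rep_snd: "c \<in> maximal_atlas A \<Longrightarrow> q \<in> fst c \<Longrightarrow> local_rep A c X (snd c q) = tcomp A c q (X q)"
  by (simp add: local_rep_def inv_snd)

lemma local_rep_change:
  assumes "c \<in> maximal_atlas A" "q \<in> fst c" "d \<in> maximal_atlas A" "q \<in> fst d"
  shows "local_rep A d X (snd d q) = fd (transition c d) (snd c q) (local_rep A c X (snd c q))"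
  by (simp add: local_rep_snd assms tcomp_change)

lemma smooth_local_rep_change:
  assumes c: "c \<in> maximal_atlas A" and d: "d \<in> maximal_atlas A"
    and U: "open U" "U \<subseteq> fst c" "U \<subseteq> fst d"
    and X: "smooth_on (snd c ` U) (local_rep A c X)"
  shows "smooth_on (snd d ` U) (local_rep A d X)"
proof -
  have o: "open (snd c ` U)" "open (snd d ` U)" by (rule open_image; fact)+
  have cd: "smooth_on (snd c ` U) (transition c d)"
    by (rule smooth_on_subset[OF transition_smooth[OF c d]]) (use U in auto)
  have dc: "smooth_on (snd d ` U) (transition d c)"
    by (rule smooth_on_subset[OF transition_smooth[OF d c]]) (use U in auto)
  have sub: "transition d c ` snd d ` U \<subseteq> snd c ` U" using U inv_snd[OF d] by auto
  have "smooth_on (snd d ` U) (\<lambda>y. fd (transition c d) (transition d c y) (local_rep A c X (transition d c y)))"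
    using smooth_on_compose[OF o(2,1) sub smooth_on_fd_apply[OF o(1) cd X] dc] .
  then show ?thesis
  proof (rule smooth_on_congI[OF o(2)])
    fix y assume "y \<in> snd d ` U"
    then obtain q where q: "q \<in> U" "y = snd d q" by auto
    then have "q \<in> fst c" "q \<in> fst d" using U by auto
    then show "local_rep A d X y = fd (transition c d) (transition d c y) (local_rep A c X (transition d c y))"
      using q by (simp add: inv_snd[OF d] local_rep_change[OF c _ d])
  qed
qed

lemma smooth_vf_chart:
  assumes U: "open U" and X: "smooth_vf A U X" and c: "c \<in> maximal_atlas A"
  shows "smooth_on (snd c ` (U \<inter> fst c)) (local_rep A c X)"
proof (rule smooth_on_locally)
  fix x assume "x \<in> snd c ` (U \<inter> fst c)"
  then obtain q where q: "q \<in> U" "q \<in> fst c" "x = snd c q" by auto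
  define a where "a = chart_at A q"
  have a: "a \<in> A" "q \<in> fst a" and am: "a \<in> maximal_atlas A"
    using chart_at_mem chart_at_dom chart_at_maximal by (auto simp: a_def)
  define W where "W = U \<inter> fst c \<inter> fst a"
  have W: "open W" "W \<subseteq> fst a" "W \<subseteq> fst c"
    using U maximal_open[OF c] maximal_open[OF am] by (auto simp: W_def)
  have fa: "smooth_on (snd a ` (U \<inter> fst a)) (local_rep A a X)"
    using X a(1) by (simp add: smooth_vf_def)
  have "smooth_on (snd c ` W) (local_rep A c X)"
    by (rule smooth_local_rep_change[OF am c W smooth_on_subset[OF fa]]) (auto simp: W_def)
  moreover have "open (snd c ` W)" by (rule open_image[OF c W(1,3)])
  moreover have "x \<in> snd c ` W" using q a by (auto simp: W_def)
  ultimately show "\<exists>U. open U \<and> x \<in> U \<and> smooth_on U (local_rep A c X)"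
    by (intro exI[of _ "snd c ` W"] conjI)
qed

lemma smooth_vfI_chart:
  assumes U: "open U" "U \<subseteq> fst c" and c: "c \<in> maximal_atlas A"
    and X: "smooth_on (snd c ` U) (local_rep A c X)"
  shows "smooth_vf A U X"
  unfolding smooth_vf_def
proof
  fix d assume "d \<in> A"
  then have d: "d \<in> maximal_atlas A" by (rule atlas_maximal)
  show "smooth_on (snd d ` (U \<inter> fst d)) (local_rep A d X)"
  proof (rule smooth_local_rep_change[OF c d])
    show "open (U \<inter> fst d)" using U maximal_open[OF d] by auto
    show "U \<inter> fst d \<subseteq> fst d" "U \<inter> fst d \<subseteq> fst c" using U by auto
    show "smooth_on (snd c ` (U \<inter> fst d)) (local_rep A c X)"
      by (rule smooth_on_subset[OF X]) auto
  qed
qed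

lemma local_rep_differentiable:
  assumes "open U" "smooth_vf A U X" "c \<in> maximal_atlas A" "p \<in> U" "p \<in> fst c"
  shows "local_rep A c X differentiable at (snd c p)"
  by (rule smooth_on_differentiable[OF smooth_vf_chart[OF assms(1-3)]]) (use assms(4,5) in auto)

lemma smooth_vf_subset: "smooth_vf A U X \<Longrightarrow> V \<subseteq> U \<Longrightarrow> smooth_vf A V X"
  unfolding smooth_vf_def by (rule ballI, drule bspec, assumption, erule smooth_on_subset) auto

lemma smooth_vf_locally:
  assumes "open U" "\<And>p. p \<in> U \<Longrightarrow> \<exists>V. open V \<and> p \<in> V \<and> smooth_vf A V X"
  shows "smooth_vf A U X"
  unfolding smooth_vf_def
proof
  fix d assume "d \<in> A"
  then have d: "d \<in> maximal_atlas A" by (rule atlas_maximal)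
  show "smooth_on (snd d ` (U \<inter> fst d)) (local_rep A d X)"
  proof (rule smooth_on_locally)
    fix x assume "x \<in> snd d ` (U \<inter> fst d)"
    then obtain q where q: "q \<in> U" "q \<in> fst d" "x = snd d q" by auto
    obtain V where V: "open V" "q \<in> V" "smooth_vf A V X" using assms(2)[OF q(1)] by auto
    have "open (snd d ` (V \<inter> fst d))"
      by (rule open_image[OF d]) (use V maximal_open[OF d] in auto)
    moreover have "smooth_on (snd d ` (V \<inter> fst d)) (local_rep A d X)" by (rule smooth_vf_chart[OF V(1,3) d])
    ultimately show "\<exists>U. open U \<and> x \<in> U \<and> smooth_on U (local_rep A d X)"
      using q V by (intro exI[of _ "snd d ` (V \<inter> fst d)"]) auto
  qed
qed

lemma smooth_vf_congI:
  assumes U: "open U" and Y: "smooth_vf A U Y" and eq: "\<And>q. q \<in> U \<Longrightarrow> X q = Y q"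
  shows "smooth_vf A U X"
  unfolding smooth_vf_def
proof
  fix d assume d: "d \<in> A"
  then have dm: "d \<in> maximal_atlas A" by (rule atlas_maximal)
  have Yd: "smooth_on (snd d ` (U \<inter> fst d)) (local_rep A d Y)" using Y d by (simp add: smooth_vf_def)
  show "smooth_on (snd d ` (U \<inter> fst d)) (local_rep A d X)"
  proof (rule smooth_on_congI[OF open_image[OF dm] Yd])
    show "open (U \<inter> fst d)" using U maximal_open[OF dm] by auto
    show "local_rep A d X x = local_rep A d Y x" if "x \<in> snd d ` (U \<inter> fst d)" for x
      using that eq inv_snd[OF dm] by (auto simp: local_rep_def)
  qed auto
qed

lemma smooth_vf_add:
  assumes U: "open U" and X: "smooth_vf A U X" and Y: "smooth_vf A U Y"
  shows "smooth_vf A U (\<lambda>q. X q + Y q)"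
  unfolding smooth_vf_def
proof
  fix d assume d: "d \<in> A"
  then have dm: "d \<in> maximal_atlas A" by (rule atlas_maximal)
  have o: "open (snd d ` (U \<inter> fst d))"
    by (rule open_image[OF dm]) (use U maximal_open[OF dm] in auto)
  have "smooth_on (snd d ` (U \<inter> fst d)) (\<lambda>x. local_rep A d X x + local_rep A d Y x)"
    by (rule smooth_on_add[OF o]) (use X Y d in \<open>simp_all add: smooth_vf_def\<close>)
  then show "smooth_on (snd d ` (U \<inter> fst d)) (local_rep A d (\<lambda>q. X q + Y q))"
  proof (rule smooth_on_congI[OF o])
    fix x assume "x \<in> snd d ` (U \<inter> fst d)"
    then obtain q where "q \<in> fst d" "x = snd d q" by auto
    then show "local_rep A d (\<lambda>q. X q + Y q) x = local_rep A d X x + local_rep A d Y x"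
      by (simp add: local_rep_snd[OF dm] linear_add[OF linear_tcomp[OF dm]])
  qed
qed

lemma smooth_vf_scale:
  assumes U: "open U" and f: "smooth_fun A U f" and X: "smooth_vf A U X"
  shows "smooth_vf A U (\<lambda>q. f q *\<^sub>R X q)"
  unfolding smooth_vf_def
proof
  fix d assume d: "d \<in> A"
  then have dm: "d \<in> maximal_atlas A" by (rule atlas_maximal)
  have o: "open (snd d ` (U \<inter> fst d))"
    by (rule open_image[OF dm]) (use U maximal_open[OF dm] in auto)
  have "smooth_on (snd d ` (U \<inter> fst d)) (\<lambda>x. f (chart_inv d x) *\<^sub>R local_rep A d X x)"
    by (rule smooth_on_scaleR[OF o smooth_fun_chart[OF U f dm] smooth_vf_chart[OF U X dm]])
  then show "smooth_on (snd d ` (U \<inter> fst d)) (local_rep A d (\<lambda>q. f q *\<^sub>R X q))"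
  proof (rule smooth_on_congI[OF o])
    fix x assume "x \<in> snd d ` (U \<inter> fst d)"
    then obtain q where "q \<in> fst d" "x = snd d q" by auto
    then show "local_rep A d (\<lambda>q. f q *\<^sub>R X q) x = f (chart_inv d x) *\<^sub>R local_rep A d X x"
      by (simp add: local_rep_snd[OF dm] inv_snd[OF dm] linear_scale[OF linear_tcomp[OF dm]])
  qed
qed

lemma smooth_vf_zero: "open U \<Longrightarrow> smooth_vf A U (\<lambda>_. 0)"
proof (rule smooth_vf_locally)
  fix p
  define c where "c = chart_at A p"
  have c: "c \<in> maximal_atlas A" "p \<in> fst c" using chart_at_maximal chart_at_dom by (auto simp: c_def)
  have o: "open (snd c ` fst c)" by (rule open_image[OF c(1) maximal_open[OF c(1)]]) simp
  have "smooth_on (snd c ` fst c) (local_rep A c (\<lambda>_. 0))"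
    by (rule smooth_on_congI[OF o smooth_on_const[where c=0]])
      (auto simp: local_rep_snd[OF c(1)] linear_0[OF linear_tcomp[OF c(1)]])
  then have "smooth_vf A (fst c) (\<lambda>_. 0)"
    by (rule smooth_vfI_chart[OF maximal_open[OF c(1)] subset_refl c(1)])
  then show "\<exists>V. open V \<and> p \<in> V \<and> smooth_vf A V (\<lambda>_. 0)" using c maximal_open[OF c(1)] by auto
qed

lemma smooth_vf_sum:
  assumes "open U" "\<And>i. i \<in> I \<Longrightarrow> smooth_vf A U (X i)"
  shows "smooth_vf A U (\<lambda>q. \<Sum>i\<in>I. X i q)"
  using assms(2)
  by (induction I rule: infinite_finite_induct)
    (auto simp: smooth_vf_zero[OF assms(1)] intro!: smooth_vf_add[OF assms(1)])

lemma smooth_vf_uminus: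
  assumes U: "open U" and X: "smooth_vf A U X"
  shows "smooth_vf A U (\<lambda>q. - X q)"
  using smooth_vf_scale[OF U smooth_fun_const[of U "-1"] X] by simp

lemma smooth_vf_diff:
  assumes U: "open U" and X: "smooth_vf A U X" and Y: "smooth_vf A U Y"
  shows "smooth_vf A U (\<lambda>q. X q - Y q)"
  using smooth_vf_add[OF U X smooth_vf_uminus[OF U Y]] by simp

lemma smooth_vf_tvec:
  assumes c: "c \<in> maximal_atlas A"
  shows "smooth_vf A (fst c) (\<lambda>q. tvec A c q v)"
proof (rule smooth_vfI_chart[OF maximal_open[OF c] subset_refl c])
  have o: "open (snd c ` fst c)" by (rule open_image[OF c maximal_open[OF c]]) simp
  show "smooth_on (snd c ` fst c) (local_rep A c (\<lambda>q. tvec A c q v))"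
    by (rule smooth_on_congI[OF o smooth_on_const[where c=v]])
      (auto simp: local_rep_snd[OF c] tcomp_tvec[OF c])
qed

lemma smooth_fun_tcomp:
  assumes U: "open U" and X: "smooth_vf A U X" and c: "c \<in> maximal_atlas A"
  shows "smooth_fun A (U \<inter> fst c) (\<lambda>q. tcomp A c q (X q) \<bullet> b)"
proof (rule smooth_funI_chart[OF _ _ c])
  show o: "open (U \<inter> fst c)" using U maximal_open[OF c] by auto
  have o': "open (snd c ` (U \<inter> fst c))" by (rule open_image[OF c o]) auto
  show "smooth_on (snd c ` (U \<inter> fst c)) (\<lambda>x. tcomp A c (chart_inv c x) (X (chart_inv c x)) \<bullet> b)"
    using smooth_on_inner[OF o' smooth_vf_chart[OF U X c] smooth_on_const]
    by (simp add: local_rep_def)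
qed auto

section \<open>Lie brackets\<close>

lemma vderiv_chart:
  assumes c: "c \<in> maximal_atlas A" "p \<in> fst c" and f: "(\<lambda>x. f (chart_inv c x)) differentiable at (snd c p)"
  shows "vderiv A f p v = fd (\<lambda>x. f (chart_inv c x)) (snd c p) (tcomp A c p v)"
proof -
  define a where "a = chart_at A p"
  have a: "a \<in> maximal_atlas A" "p \<in> fst a" using chart_at_maximal chart_at_dom by (auto simp: a_def)
  define U where "U = snd a ` (fst a \<inter> fst c)"
  have U: "open U"
    unfolding U_def by (rule open_image[OF a(1)]) (use maximal_open[OF c(1)] maximal_open[OF a(1)] in auto)
  have "fd (\<lambda>x. f (chart_inv a x)) (snd a p) = fd (\<lambda>x. f (chart_inv c (transition a c x))) (snd a p)"
  proof (rule fd_cong[OF U])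
    show "snd a p \<in> U" using a c by (auto simp: U_def)
    fix y assume "y \<in> U"
    then obtain q where p: "q \<in> fst a" "q \<in> fst c" "y = snd a q" by (auto simp: U_def)
    then show "f (chart_inv a y) = f (chart_inv c (transition a c y))" by (simp add: inv_snd[OF c(1)] inv_snd[OF a(1)])
  qed
  moreover have "fd (\<lambda>x. f (chart_inv c (transition a c x))) (snd a p) v
      = fd (\<lambda>x. f (chart_inv c x)) (transition a c (snd a p)) (fd (transition a c) (snd a p) v)"
    by (rule fd_chain[OF transition_differentiable[OF a(1) c(1) a(2) c(2)]])
      (use f in \<open>simp add: inv_snd[OF a]\<close>)
  ultimately show ?thesis
    by (simp add: vderiv_def o_def tcomp_eq a_def[symmetric] inv_snd[OF a])
qed

text \<open>The bracket at \<open>q\<close> is defined by the preferred chart at \<open>q\<close>, which jumps with \<open>q\<close>; to differentiate a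
  bracket it has to be expressed in one chart near the point. The transition map contributes a second
  derivative to each term, and the two contributions cancel by symmetry.\<close>

lemma lie_bracket_chart:
  assumes U: "open U" "q \<in> U" and X: "smooth_vf A U X" and Y: "smooth_vf A U Y"
    and c: "c \<in> maximal_atlas A" "q \<in> fst c"
  shows "tcomp A c q (lie_bracket A X Y q)
      = fd (local_rep A c Y) (snd c q) (tcomp A c q (X q)) - fd (local_rep A c X) (snd c q) (tcomp A c q (Y q))"
proof -
  define a where "a = chart_at A q"
  have a: "a \<in> maximal_atlas A" "q \<in> fst a" using chart_at_maximal chart_at_dom by (auto simp: a_def)
  define W where "W = snd a ` (U \<inter> fst a \<inter> fst c)"
  have W: "open W"
    unfolding W_def by (rule open_image[OF a(1)]) (use U maximal_open[OF c(1)] maximal_open[OF a(1)] in auto)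
  have qW: "snd a q \<in> W" using U a c by (auto simp: W_def)
  have t: "smooth_on W (transition a c)"
    by (rule smooth_on_subset[OF transition_smooth[OF a(1) c(1)]]) (auto simp: W_def)
  have tc: "tcomp A c q v = fd (transition a c) (snd a q) v" for v by (simp add: tcomp_eq a_def)
  have rep: "local_rep A a Z (snd a q) = Z q" for Z
    using local_rep_snd[OF a] tcomp_chart_at by (simp add: a_def)
  have key: "fd (local_rep A c Z) (snd c q) (tcomp A c q v)
      = fd (\<lambda>y. fd (transition a c) y (Z q)) (snd a q) v + tcomp A c q (fd (local_rep A a Z) (snd a q) v)"
    if Z: "smooth_vf A U Z" for Z v
  proof -
    have Za: "local_rep A a Z differentiable at (snd a q)"
      by (rule local_rep_differentiable[OF U(1) Z a(1) U(2) a(2)])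
    have Zc: "local_rep A c Z differentiable at (transition a c (snd a q))"
      using local_rep_differentiable[OF U(1) Z c(1) U(2) c(2)] by (simp add: inv_snd[OF a])
    have "fd (\<lambda>x. local_rep A c Z (transition a c x)) (snd a q) = fd (\<lambda>x. fd (transition a c) x (local_rep A a Z x)) (snd a q)"
    proof (rule fd_cong[OF W qW])
      fix y assume "y \<in> W"
      then obtain p where p: "p \<in> fst a" "p \<in> fst c" "y = snd a p" by (auto simp: W_def)
      then show "local_rep A c Z (transition a c y) = fd (transition a c) y (local_rep A a Z y)"
        by (simp add: inv_snd[OF a(1)] local_rep_change[OF a(1) p(1) c(1) p(2)])
    qed
    moreover have "fd (\<lambda>x. local_rep A c Z (transition a c x)) (snd a q) v
        = fd (local_rep A c Z) (snd c q) (tcomp A c q v)"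
      using fd_chain[OF transition_differentiable[OF a(1) c(1) a(2) c(2)] Zc]
      by (simp add: inv_snd[OF a] tc)
    moreover have "fd (\<lambda>x. fd (transition a c) x (local_rep A a Z x)) (snd a q) v
        = fd (\<lambda>y. fd (transition a c) y (Z q)) (snd a q) v + tcomp A c q (fd (local_rep A a Z) (snd a q) v)"
      using fd_eq[OF has_derivative_fd_apply[OF W qW t Za]] unfolding rep tc by simp
    ultimately show ?thesis by simp
  qed
  have "tcomp A c q (lie_bracket A X Y q)
     = tcomp A c q (fd (local_rep A a Y) (snd a q) (X q)) - tcomp A c q (fd (local_rep A a X) (snd a q) (Y q))"
    by (simp add: lie_bracket_def Let_def a_def[symmetric] linear_diff[OF linear_tcomp[OF c]])
  then show ?thesis
    unfolding key[OF X] key[OF Y] using second_derivative_symmetric[OF W qW t] by simp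
qed

text \<open>In coordinates, the second derivatives of \<open>f\<close> cancel.\<close>

lemma vderiv_lie_bracket:
  assumes U: "open U" "p \<in> U" and f: "smooth_fun A U f" and X: "smooth_vf A U X" and Y: "smooth_vf A U Y"
  shows "vderiv A f p (lie_bracket A X Y p)
     = vderiv A (\<lambda>q. vderiv A f q (Y q)) p (X p) - vderiv A (\<lambda>q. vderiv A f q (X q)) p (Y p)"
proof -
  define a where "a = chart_at A p"
  have a: "a \<in> maximal_atlas A" "p \<in> fst a" using chart_at_maximal chart_at_dom by (auto simp: a_def)
  define F where "F = (\<lambda>x. f (chart_inv a x))"
  define W where "W = snd a ` (U \<inter> fst a)"
  have W: "open W"
    unfolding W_def by (rule open_image[OF a(1)]) (use U maximal_open[OF a(1)] in auto)
  have pW: "snd a p \<in> W" using U a by (auto simp: W_def)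
  have F: "smooth_on W F" unfolding F_def W_def by (rule smooth_fun_chart[OF U(1) f a(1)])
  have vd: "vderiv A h p v = fd (\<lambda>x. h (chart_inv a x)) (snd a p) v" for h v
    by (simp add: vderiv_def o_def a_def)
  have rep: "local_rep A a Z (snd a p) = Z p" for Z
    using local_rep_snd[OF a] tcomp_chart_at by (simp add: a_def)
  have key: "vderiv A (\<lambda>q. vderiv A f q (Z q)) p v
      = fd (\<lambda>y. fd F y (Z p)) (snd a p) v + fd F (snd a p) (fd (local_rep A a Z) (snd a p) v)"
    if Z: "smooth_vf A U Z" for Z v
  proof -
    have Za: "local_rep A a Z differentiable at (snd a p)"
      by (rule local_rep_differentiable[OF U(1) Z a(1) U(2) a(2)])
    have "fd (\<lambda>x. vderiv A f (chart_inv a x) (Z (chart_inv a x))) (snd a p)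
        = fd (\<lambda>x. fd F x (local_rep A a Z x)) (snd a p)"
    proof (rule fd_cong[OF W pW])
      fix y assume "y \<in> W"
      then obtain q where q: "q \<in> U" "q \<in> fst a" "y = snd a q" by (auto simp: W_def)
      have "vderiv A f q (Z q) = fd F (snd a q) (tcomp A a q (Z q))"
        unfolding F_def by (rule vderiv_chart[OF a(1) q(2) smooth_fun_differentiable[OF U(1) f a(1) q(1,2)]])
      then show "vderiv A f (chart_inv a y) (Z (chart_inv a y)) = fd F y (local_rep A a Z y)"
        using q by (simp add: inv_snd[OF a(1)] local_rep_snd[OF a(1)])
    qed
    then show ?thesis unfolding vd
      using fd_eq[OF has_derivative_fd_apply[OF W pW F Za]] unfolding rep by simp
  qed
  have "vderiv A f p (lie_bracket A X Y p) = fd F (snd a p) (fd (local_rep A a Y) (snd a p) (X p))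
      - fd F (snd a p) (fd (local_rep A a X) (snd a p) (Y p))"
    unfolding vd F_def[symmetric]
    by (simp add: lie_bracket_def Let_def a_def[symmetric]
        linear_diff[OF linear_frechet_derivative[OF smooth_on_differentiable[OF F pW]]])
  then show ?thesis unfolding key[OF X] key[OF Y]
    using second_derivative_symmetric[OF W pW F] by simp
qed

text \<open>Expanded in a chart, every second derivative and every product of first derivatives occurs twice,
  with opposite signs.\<close>

lemma lie_bracket_Jacobi:
  assumes U: "open U" "p \<in> U" and X: "smooth_vf A U X" and Y: "smooth_vf A U Y" and Z: "smooth_vf A U Z"
  shows "lie_bracket A X (lie_bracket A Y Z) p + lie_bracket A Y (lie_bracket A Z X) p
      + lie_bracket A Z (lie_bracket A X Y) p = 0"
proof -
  define a where "a = chart_at A p"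
  have a: "a \<in> maximal_atlas A" "p \<in> fst a" using chart_at_maximal chart_at_dom by (auto simp: a_def)
  define W where "W = snd a ` (U \<inter> fst a)"
  have W: "open W"
    unfolding W_def by (rule open_image[OF a(1)]) (use U maximal_open[OF a(1)] in auto)
  have pW: "snd a p \<in> W" using U a by (auto simp: W_def)
  have sm: "smooth_on W (local_rep A a V)" if "smooth_vf A U V" for V
    unfolding W_def by (rule smooth_vf_chart[OF U(1) that a(1)])
  define d where "d V = fd (local_rep A a V) (snd a p)" for V
  define dd where "dd V u = fd (\<lambda>y. fd (local_rep A a V) y u) (snd a p)" for V u
  have sym: "dd V u v = dd V v u" if "smooth_vf A U V" for V u v
    unfolding dd_def by (rule second_derivative_symmetric[OF W pW sm[OF that]])
  have lin: "linear (d V)" if "smooth_vf A U V" for V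
    unfolding d_def by (rule linear_frechet_derivative[OF smooth_on_differentiable[OF sm[OF that] pW]])
  have br: "lie_bracket A V V' p = d V' (V p) - d V (V' p)" for V V'
    by (simp add: lie_bracket_def d_def a_def Let_def)
  have rep: "local_rep A a V (snd a p) = V p" for V
    using local_rep_snd[OF a] tcomp_chart_at by (simp add: a_def)
  have dbr: "d (lie_bracket A V V') v = dd V' (V p) v + d V' (d V v) - dd V (V' p) v - d V (d V' v)"
    if V: "smooth_vf A U V" and V': "smooth_vf A U V'" for V V' v
  proof -
    have dif: "local_rep A a Q differentiable at (snd a p)" if "smooth_vf A U Q" for Q
      by (rule smooth_on_differentiable[OF sm[OF that] pW])
    have "fd (local_rep A a (lie_bracket A V V')) (snd a p)
      = fd (\<lambda>x. fd (local_rep A a V') x (local_rep A a V x) - fd (local_rep A a V) x (local_rep A a V' x)) (snd a p)"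
    proof (rule fd_cong[OF W pW])
      fix y assume "y \<in> W"
      then obtain q where q: "q \<in> U" "q \<in> fst a" "y = snd a q" by (auto simp: W_def)
      then show "local_rep A a (lie_bracket A V V') y
         = fd (local_rep A a V') y (local_rep A a V y) - fd (local_rep A a V) y (local_rep A a V' y)"
        by (simp add: local_rep_snd[OF a(1)] lie_bracket_chart[OF U(1) q(1) V V' a(1) q(2)])
    qed
    also have "\<dots> = (\<lambda>v. (dd V' (V p) v + d V' (d V v)) - (dd V (V' p) v + d V (d V' v)))"
      using fd_eq[OF has_derivative_diff[OF has_derivative_fd_apply[OF W pW sm[OF V'] dif[OF V]]
          has_derivative_fd_apply[OF W pW sm[OF V] dif[OF V']]]]
      unfolding d_def dd_def rep by simp
    finally show ?thesis by (simp add: d_def)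
  qed
  show ?thesis
    unfolding br[of _ "lie_bracket A _ _"] br[of Y Z] br[of Z X] br[of X Y]
      dbr[OF Y Z] dbr[OF Z X] dbr[OF X Y]
    using sym[OF X, of "Y p" "Z p"] sym[OF Y, of "X p" "Z p"] sym[OF Z, of "X p" "Y p"]
    by (simp add: linear_diff[OF lin[OF X]] linear_diff[OF lin[OF Y]] linear_diff[OF lin[OF Z]])
qed

end

section \<open>The Levi-Civita connection and its curvature\<close>

text \<open>The classical octahedron argument: a signed sum of the four cyclic identities, in each of which
  another argument stays in the last place, leaves twice the difference of the two sides.\<close>

lemma pair_symmetry:
  fixes R :: "'a \<Rightarrow> 'a \<Rightarrow> 'a \<Rightarrow> 'a \<Rightarrow> real"
  assumes "\<And>x y z w. x \<in> B \<Longrightarrow> y \<in> B \<Longrightarrow> z \<in> B \<Longrightarrow> w \<in> B \<Longrightarrow> R x y z w = - R y x z w"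
    and "\<And>x y z w. x \<in> B \<Longrightarrow> y \<in> B \<Longrightarrow> z \<in> B \<Longrightarrow> w \<in> B \<Longrightarrow> R x y z w = - R x y w z"
    and "\<And>x y z w. x \<in> B \<Longrightarrow> y \<in> B \<Longrightarrow> z \<in> B \<Longrightarrow> w \<in> B \<Longrightarrow> R x y z w + R y z x w + R z x y w = 0"
    and B: "x \<in> B" "y \<in> B" "z \<in> B" "w \<in> B"
  shows "R x y z w = R z w x y"
proof -
  note A1 = assms(1) and A2 = assms(2) and Bi = assms(3)
  have "R x y z w + R y z x w + R z x y w = 0" "R y z w x + R z w y x + R w y z x = 0"
    "R z w x y + R w x z y + R x z w y = 0" "R w x y z + R x y w z + R y w x z = 0"
    by (rule Bi; rule B)+
  moreover have "R y z w x = - R y z x w" "R z w y x = - R z w x y" "R x y w z = - R x y z w"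
     "R w x z y = - R w x y z"
    by (rule A2; rule B)+
  moreover have "R z x y w = - R x z y w" "R w y z x = - R y w z x" by (rule A1; rule B)+
  moreover have "R x z w y = - R x z y w" "R y w x z = - R y w z x" by (rule A2; rule B)+
  ultimately show ?thesis by linarith
qed

context smooth_mfd
begin

lemma vderiv_cong:
  assumes U: "open U" "p \<in> U" and eq: "\<And>q. q \<in> U \<Longrightarrow> f q = h q"
  shows "vderiv A f p v = vderiv A h p v"
proof -
  define a where "a = chart_at A p"
  have a: "a \<in> maximal_atlas A" "p \<in> fst a" using chart_at_maximal chart_at_dom by (auto simp: a_def)
  have o: "open (snd a ` (U \<inter> fst a))"
    by (rule open_image[OF a(1)]) (use U maximal_open[OF a(1)] in auto)
  have "fd (\<lambda>x. f (chart_inv a x)) (snd a p) = fd (\<lambda>x. h (chart_inv a x)) (snd a p)"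
    by (rule fd_cong[OF o]) (use U a eq inv_snd[OF a(1)] in auto)
  then show ?thesis by (simp add: vderiv_def o_def a_def)
qed

lemma vderiv_add:
  assumes U: "open U" "p \<in> U" and f: "smooth_fun A U f" and h: "smooth_fun A U h"
  shows "vderiv A (\<lambda>q. f q + h q) p v = vderiv A f p v + vderiv A h p v"
proof -
  define a where "a = chart_at A p"
  have a: "a \<in> maximal_atlas A" "p \<in> fst a" using chart_at_maximal chart_at_dom by (auto simp: a_def)
  note d = has_derivative_add[OF has_derivative_fd[OF smooth_fun_differentiable[OF U(1) f a(1) U(2) a(2)]]
      has_derivative_fd[OF smooth_fun_differentiable[OF U(1) h a(1) U(2) a(2)]]]
  show ?thesis unfolding vderiv_def o_def a_def[symmetric] fd_eq[OF d] by simp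
qed

end

locale semi_riemannian = smooth_mfd A
  for A :: "('p::t2_space, 'e::euclidean_space) chart set" +
  fixes g :: "'p \<Rightarrow> 'e \<Rightarrow> 'e \<Rightarrow> real" and D :: "('p \<Rightarrow> 'e) \<Rightarrow> ('p \<Rightarrow> 'e) \<Rightarrow> 'p \<Rightarrow> 'e" and \<nu> :: nat
  assumes metric: "semi_riemannian_metric A g \<nu>" and lc: "levi_civita A g D"
begin

lemmas metric_unfolded = metric[unfolded semi_riemannian_metric_def]

lemma g_bilinear: "bilinear (g p)"
  by (rule metric_unfolded[THEN conjunct1, THEN spec, THEN conjunct1])

lemma g_sym: "g p x y = g p y x"
  by (rule metric_unfolded[THEN conjunct1, THEN spec, THEN conjunct2, THEN conjunct1, THEN spec, THEN spec])

lemma g_nondegenerate: "(\<And>y. g p x y = 0) \<Longrightarrow> x = 0"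
  using metric_unfolded[THEN conjunct1, THEN spec, THEN conjunct2, THEN conjunct2, THEN conjunct1, THEN spec, THEN mp, of p x]
  by simp

lemma g_smooth: "open U \<Longrightarrow> smooth_vf A U X \<Longrightarrow> smooth_vf A U Y \<Longrightarrow> smooth_fun A U (\<lambda>p. g p (X p) (Y p))"
  using metric_unfolded[THEN conjunct2, THEN spec, THEN spec, THEN spec, THEN mp, of U X Y] by simp

lemma g_eqI:
  assumes "\<And>w. g p x w = g p y w"
  shows "x = y"
proof -
  have "x - y = 0"
    by (rule g_nondegenerate[of p]) (simp add: bilinear_lsub[OF g_bilinear] assms)
  then show ?thesis by simp
qed

lemmas g_simps = bilinear_ladd[OF g_bilinear] bilinear_radd[OF g_bilinear]
  bilinear_lsub[OF g_bilinear] bilinear_rsub[OF g_bilinear] bilinear_lmul[OF g_bilinear]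
  bilinear_rmul[OF g_bilinear] bilinear_lneg[OF g_bilinear] bilinear_rneg[OF g_bilinear]
  bilinear_lzero[OF g_bilinear] bilinear_rzero[OF g_bilinear]

lemma g_sum_left: "g p (\<Sum>i\<in>I. f i) y = (\<Sum>i\<in>I. g p (f i) y)"
  by (induction I rule: infinite_finite_induct) (auto simp: g_simps)

lemma affine: "affine_connection A D"
  using lc by (simp add: levi_civita_def)

lemmas affine_open = affine[unfolded affine_connection_def, THEN spec, THEN mp]

lemma D_smooth: "open U \<Longrightarrow> smooth_vf A U X \<Longrightarrow> smooth_vf A U Y \<Longrightarrow> smooth_vf A U (D X Y)"
  using affine_open[THEN conjunct1, of U] by simp

lemma D_cong:
  assumes U: "open U" and s: "smooth_vf A U X" "smooth_vf A U Y" "smooth_vf A U X'" "smooth_vf A U Y'"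
    and eq: "\<And>q. q \<in> U \<Longrightarrow> X q = X' q" "\<And>q. q \<in> U \<Longrightarrow> Y q = Y' q" and q: "q \<in> U"
  shows "D X Y q = D X' Y' q"
  by (rule affine_open[THEN conjunct2, THEN conjunct1, OF U, THEN spec, THEN spec, THEN spec, THEN spec,
        THEN mp, THEN bspec, OF _ q]) (intro conjI ballI s eq)

lemma D_add_left:
  "open U \<Longrightarrow> smooth_vf A U X \<Longrightarrow> smooth_vf A U X' \<Longrightarrow> smooth_vf A U Y \<Longrightarrow> q \<in> U \<Longrightarrow>
    D (\<lambda>p. X p + X' p) Y q = D X Y q + D X' Y q"
  using affine_open[THEN conjunct2, THEN conjunct2, THEN conjunct1, of U] by simp

lemma D_scale_left:
  "open U \<Longrightarrow> smooth_fun A U f \<Longrightarrow> smooth_vf A U X \<Longrightarrow> smooth_vf A U Y \<Longrightarrow> q \<in> U \<Longrightarrow>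
    D (\<lambda>p. f p *\<^sub>R X p) Y q = f q *\<^sub>R D X Y q"
  using affine_open[THEN conjunct2, THEN conjunct2, THEN conjunct2, THEN conjunct1, of U] by simp

lemma D_add_right:
  "open U \<Longrightarrow> smooth_vf A U X \<Longrightarrow> smooth_vf A U Y \<Longrightarrow> smooth_vf A U Y' \<Longrightarrow> q \<in> U \<Longrightarrow>
    D X (\<lambda>p. Y p + Y' p) q = D X Y q + D X Y' q"
  using affine_open[THEN conjunct2, THEN conjunct2, THEN conjunct2, THEN conjunct2, THEN conjunct1, of U] by simp

lemma D_scale_right:
  "open U \<Longrightarrow> smooth_fun A U f \<Longrightarrow> smooth_vf A U X \<Longrightarrow> smooth_vf A U Y \<Longrightarrow> q \<in> U \<Longrightarrow>
    D X (\<lambda>p. f p *\<^sub>R Y p) q = vderiv A f q (X q) *\<^sub>R Y q + f q *\<^sub>R D X Y q"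
  using affine_open[THEN conjunct2, THEN conjunct2, THEN conjunct2, THEN conjunct2, THEN conjunct2, of U] by simp

lemmas lc_open = lc[unfolded levi_civita_def, THEN conjunct2, THEN spec, THEN mp]

lemma torsion_free:
  "open U \<Longrightarrow> smooth_vf A U X \<Longrightarrow> smooth_vf A U Y \<Longrightarrow> q \<in> U \<Longrightarrow> D X Y q - D Y X q = lie_bracket A X Y q"
  using lc_open[THEN conjunct1, of U] by simp

lemma metric_compat:
  "open U \<Longrightarrow> smooth_vf A U X \<Longrightarrow> smooth_vf A U Y \<Longrightarrow> smooth_vf A U Z \<Longrightarrow> q \<in> U \<Longrightarrow>
    vderiv A (\<lambda>p. g p (Y p) (Z p)) q (X q) = g q (D X Y q) (Z q) + g q (Y q) (D X Z q)"
  using lc_open[THEN conjunct2, of U] by simp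

lemma D_uminus_left:
  assumes "open U" "smooth_vf A U X" "smooth_vf A U Y" "q \<in> U"
  shows "D (\<lambda>p. - X p) Y q = - D X Y q"
  using D_scale_left[OF assms(1) smooth_fun_const[of U "-1"] assms(2-4)] by simp

lemma D_uminus_right:
  assumes "open U" "smooth_vf A U X" "smooth_vf A U Y" "q \<in> U"
  shows "D X (\<lambda>p. - Y p) q = - D X Y q"
proof -
  have "vderiv A (\<lambda>_. -1) q v = 0" for v by (simp add: vderiv_def o_def)
  then show ?thesis
    using D_scale_right[OF assms(1) smooth_fun_const[of U "-1"] assms(2-4)] by simp
qed

lemma D_diff_left:
  assumes "open U" "smooth_vf A U X" "smooth_vf A U X'" "smooth_vf A U Y" "q \<in> U"
  shows "D (\<lambda>p. X p - X' p) Y q = D X Y q - D X' Y q"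
  using D_add_left[OF assms(1,2) smooth_vf_uminus[OF assms(1,3)] assms(4,5)]
    D_uminus_left[OF assms(1,3,4,5)] by simp

lemma D_diff_right:
  assumes "open U" "smooth_vf A U X" "smooth_vf A U Y" "smooth_vf A U Y'" "q \<in> U"
  shows "D X (\<lambda>p. Y p - Y' p) q = D X Y q - D X Y' q"
  using D_add_right[OF assms(1-3) smooth_vf_uminus[OF assms(1,4)] assms(5)]
    D_uminus_right[OF assms(1,2,4,5)] by simp

lemma D_zero_left: "open U \<Longrightarrow> smooth_vf A U Y \<Longrightarrow> q \<in> U \<Longrightarrow> D (\<lambda>_. 0) Y q = 0"
  using D_scale_left[OF _ smooth_fun_const[of U 0] smooth_vf_zero, of Y q] by simp

lemma D_zero_right: "open U \<Longrightarrow> smooth_vf A U X \<Longrightarrow> q \<in> U \<Longrightarrow> D X (\<lambda>_. 0) q = 0"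
  using D_add_right[OF _ _ smooth_vf_zero smooth_vf_zero, of U X q] by simp

lemma smooth_vf_lie_bracket:
  assumes U: "open U" and "smooth_vf A U X" "smooth_vf A U Y"
  shows "smooth_vf A U (lie_bracket A X Y)"
  by (rule smooth_vf_congI[OF U smooth_vf_diff[OF U D_smooth[OF U assms(2,3)] D_smooth[OF U assms(3,2)]]])
    (rule torsion_free[OF U assms(2,3), symmetric])

lemma D_sum_left:
  assumes U: "open U" and f: "\<And>i. i \<in> I \<Longrightarrow> smooth_fun A U (f i)" and E: "\<And>i. i \<in> I \<Longrightarrow> smooth_vf A U (E i)"
    and Y: "smooth_vf A U Y" and p: "p \<in> U"
  shows "D (\<lambda>q. \<Sum>i\<in>I. f i q *\<^sub>R E i q) Y p = (\<Sum>i\<in>I. f i p *\<^sub>R D (E i) Y p)"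
  using f E
proof (induction I rule: infinite_finite_induct)
  case (insert j I)
  have j: "smooth_fun A U (f j)" "smooth_vf A U (E j)" by (rule insert.prems; simp)+
  have I: "smooth_vf A U (\<lambda>q. f i q *\<^sub>R E i q)" if "i \<in> I" for i
    by (rule smooth_vf_scale[OF U]; rule insert.prems; simp add: that)
  have IH: "D (\<lambda>q. \<Sum>i\<in>I. f i q *\<^sub>R E i q) Y p = (\<Sum>i\<in>I. f i p *\<^sub>R D (E i) Y p)"
    by (rule insert.IH; rule insert.prems; simp)
  have "D (\<lambda>q. f j q *\<^sub>R E j q + (\<Sum>i\<in>I. f i q *\<^sub>R E i q)) Y p
     = D (\<lambda>q. f j q *\<^sub>R E j q) Y p + D (\<lambda>q. \<Sum>i\<in>I. f i q *\<^sub>R E i q) Y p"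
    by (rule D_add_left[OF U smooth_vf_scale[OF U j] smooth_vf_sum[OF U I] Y p])
  then show ?case
    using insert.hyps by (simp add: IH D_scale_left[OF U j Y p])
qed (simp_all add: D_zero_left[OF U Y p])

lemma D_sum_right:
  assumes U: "open U" and X: "smooth_vf A U X" and E: "\<And>i. i \<in> I \<Longrightarrow> smooth_vf A U (E i)" and p: "p \<in> U"
  shows "D X (\<lambda>q. \<Sum>i\<in>I. E i q) p = (\<Sum>i\<in>I. D X (E i) p)"
  using E
proof (induction I rule: infinite_finite_induct)
  case (insert j I)
  have j: "smooth_vf A U (E j)" by (rule insert.prems; simp)
  have I: "smooth_vf A U (E i)" if "i \<in> I" for i
    by (rule insert.prems; simp add: that)
  have IH: "D X (\<lambda>q. \<Sum>i\<in>I. E i q) p = (\<Sum>i\<in>I. D X (E i) p)"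
    by (rule insert.IH; rule insert.prems; simp)
  have "D X (\<lambda>q. E j q + (\<Sum>i\<in>I. E i q)) p = D X (E j) p + D X (\<lambda>q. \<Sum>i\<in>I. E i q) p"
    by (rule D_add_right[OF U X j smooth_vf_sum[OF U I] p])
  then show ?case using insert.hyps by (simp add: IH)
qed (simp_all add: D_zero_right[OF U X p])

text \<open>The field is expanded in the coordinate frame of a chart. Its coefficients are smooth functions that
  vanish at \<open>p\<close>, and \<open>D\<close> is linear over functions in its first argument.\<close>

lemma D_left_zero_at:
  assumes U: "open U" "p \<in> U" and X: "smooth_vf A U X" and Y: "smooth_vf A U Y" and 0: "X p = 0"
  shows "D X Y p = 0"
proof -
  define a where "a = chart_at A p"
  have a: "a \<in> maximal_atlas A" "p \<in> fst a" using chart_at_maximal chart_at_dom by (auto simp: a_def)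
  define V where "V = U \<inter> fst a"
  have V: "open V" "p \<in> V" "V \<subseteq> U" "V \<subseteq> fst a" using U maximal_open[OF a(1)] a by (auto simp: V_def)
  define f where "f b q = tcomp A a q (X q) \<bullet> b" for b q
  have f: "smooth_fun A V (f b)" for b
    unfolding f_def[abs_def] V_def by (rule smooth_fun_tcomp[OF U(1) X a(1)])
  have E: "smooth_vf A V (\<lambda>q. tvec A a q b)" for b
    by (rule smooth_vf_subset[OF smooth_vf_tvec[OF a(1)] V(4)])
  have YV: "smooth_vf A V Y" by (rule smooth_vf_subset[OF Y V(3)])
  have "D X Y p = D (\<lambda>q. \<Sum>b\<in>Basis. f b q *\<^sub>R tvec A a q b) Y p"
  proof (rule D_cong[OF V(1) smooth_vf_subset[OF X V(3)] YV _ YV _ refl V(2)])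
    show "smooth_vf A V (\<lambda>q. \<Sum>b\<in>Basis. f b q *\<^sub>R tvec A a q b)"
      by (rule smooth_vf_sum[OF V(1) smooth_vf_scale[OF V(1) f E]])
    fix q assume "q \<in> V"
    then have q: "q \<in> fst a" using V by auto
    show "X q = (\<Sum>b\<in>Basis. f b q *\<^sub>R tvec A a q b)"
      unfolding f_def using linear_Basis_expansion[OF linear_tvec[OF a(1) q], of "tcomp A a q (X q)"]
        tvec_tcomp[OF a(1) q] by simp
  qed
  also have "\<dots> = (\<Sum>b\<in>Basis. f b p *\<^sub>R D (\<lambda>q. tvec A a q b) Y p)"
    by (rule D_sum_left[OF V(1) f E YV V(2)])
  also have "\<dots> = 0" by (simp add: f_def 0 linear_0[OF linear_tcomp[OF a]])
  finally show ?thesis .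
qed

lemma D_left_tensorial:
  assumes U: "open U" "p \<in> U" and X: "smooth_vf A U X" "smooth_vf A U X'" and Y: "smooth_vf A U Y"
    and eq: "X p = X' p"
  shows "D X Y p = D X' Y p"
  using D_left_zero_at[OF U smooth_vf_diff[OF U(1) X] Y] D_diff_left[OF U(1) X Y U(2)] eq by simp

lemma curvature_field_swap:
  assumes U: "open U" "p \<in> U" and X: "smooth_vf A U X" and Y: "smooth_vf A U Y" and Z: "smooth_vf A U Z"
  shows "curvature_field A D X Y Z p = - curvature_field A D Y X Z p"
proof -
  have "lie_bracket A Y X = (\<lambda>q. - lie_bracket A X Y q)"
    by (rule ext) (simp add: lie_bracket_def Let_def)
  then have "D (lie_bracket A Y X) Z p = - D (lie_bracket A X Y) Z p"
    using D_uminus_left[OF U(1) smooth_vf_lie_bracket[OF U(1) X Y] Z U(2)] by simp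
  then show ?thesis by (simp add: curvature_field_def)
qed

text \<open>Both sides of \<open>[X,Y] f = X (Y f) - Y (X f)\<close> for \<open>f = g Z W\<close> are expanded with compatibility of the
  metric; the mixed first-order terms cancel.\<close>

lemma curvature_field_skew:
  assumes U: "open U" "p \<in> U" and X: "smooth_vf A U X" and Y: "smooth_vf A U Y"
    and Z: "smooth_vf A U Z" and W: "smooth_vf A U W"
  shows "g p (curvature_field A D X Y Z p) (W p) = - g p (curvature_field A D X Y W p) (Z p)"
proof -
  define f where "f q = g q (Z q) (W q)" for q
  have f: "smooth_fun A U f" unfolding f_def[abs_def] by (rule g_smooth[OF U(1) Z W])
  have second: "vderiv A (\<lambda>q. vderiv A f q (V q)) p (V' p)
     = g p (D V' (D V Z) p) (W p) + g p (D V Z p) (D V' W p)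
     + (g p (D V' Z p) (D V W p) + g p (Z p) (D V' (D V W) p))"
    if V: "smooth_vf A U V" and V': "smooth_vf A U V'" for V V'
  proof -
    note DZ = D_smooth[OF U(1) V Z] and DW = D_smooth[OF U(1) V W]
    have "vderiv A (\<lambda>q. vderiv A f q (V q)) p (V' p)
       = vderiv A (\<lambda>q. g q (D V Z q) (W q) + g q (Z q) (D V W q)) p (V' p)"
      by (rule vderiv_cong[OF U]) (simp add: f_def[abs_def] metric_compat[OF U(1) V Z W])
    also have "\<dots> = vderiv A (\<lambda>q. g q (D V Z q) (W q)) p (V' p) + vderiv A (\<lambda>q. g q (Z q) (D V W q)) p (V' p)"
      by (rule vderiv_add[OF U g_smooth[OF U(1) DZ W] g_smooth[OF U(1) Z DW]])
    finally show ?thesis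
      by (simp add: metric_compat[OF U(1) V' DZ W U(2)] metric_compat[OF U(1) V' Z DW U(2)])
  qed
  have "vderiv A f p (lie_bracket A X Y p)
      = g p (D (lie_bracket A X Y) Z p) (W p) + g p (Z p) (D (lie_bracket A X Y) W p)"
    unfolding f_def[abs_def] by (rule metric_compat[OF U(1) smooth_vf_lie_bracket[OF U(1) X Y] Z W U(2)])
  then show ?thesis
    using vderiv_lie_bracket[OF U f X Y] second[OF X Y] second[OF Y X]
    by (simp add: curvature_field_def g_simps g_sym[of p "Z p"])
qed

text \<open>As the torsion vanishes, the cyclic sum collapses to that of \<open>[X,[Y,Z]]\<close>.\<close>

lemma curvature_field_Bianchi:
  assumes U: "open U" "p \<in> U" and X: "smooth_vf A U X" and Y: "smooth_vf A U Y" and Z: "smooth_vf A U Z"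
  shows "curvature_field A D X Y Z p + curvature_field A D Y Z X p + curvature_field A D Z X Y p = 0"
proof -
  have *: "D V (D V' V'') p - D V (D V'' V') p - D (lie_bracket A V' V'') V p
      = lie_bracket A V (lie_bracket A V' V'') p"
    if V: "smooth_vf A U V" and V': "smooth_vf A U V'" and V'': "smooth_vf A U V''" for V V' V''
  proof -
    note s = D_smooth[OF U(1) V' V''] D_smooth[OF U(1) V'' V'] and B = smooth_vf_lie_bracket[OF U(1) V' V'']
    have "D V (D V' V'') p - D V (D V'' V') p = D V (\<lambda>q. D V' V'' q - D V'' V' q) p"
      by (rule D_diff_right[OF U(1) V s U(2), symmetric])
    also have "\<dots> = D V (lie_bracket A V' V'') p"
      by (rule D_cong[OF U(1) V smooth_vf_diff[OF U(1) s] V B refl torsion_free[OF U(1) V' V''] U(2)])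
    finally show ?thesis using torsion_free[OF U(1) V B U(2)] by simp
  qed
  show ?thesis
    using *[OF X Y Z] *[OF Y Z X] *[OF Z X Y] lie_bracket_Jacobi[OF U X Y Z]
    unfolding curvature_field_def by (simp add: algebra_simps)
qed

lemma curvature_field_pair_symmetry:
  assumes U: "open U" "p \<in> U" and X: "smooth_vf A U X" and Y: "smooth_vf A U Y"
    and Z: "smooth_vf A U Z" and W: "smooth_vf A U W"
  shows "g p (curvature_field A D X Y Z p) (W p) = g p (curvature_field A D Z W X p) (Y p)"
proof (rule pair_symmetry[where B = "{V. smooth_vf A U V}"
      and R = "\<lambda>X Y Z W. g p (curvature_field A D X Y Z p) (W p)"])
  fix X Y Z W
  assume "X \<in> {V. smooth_vf A U V}" "Y \<in> {V. smooth_vf A U V}" "Z \<in> {V. smooth_vf A U V}" "W \<in> {V. smooth_vf A U V}"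
  then have s: "smooth_vf A U X" "smooth_vf A U Y" "smooth_vf A U Z" "smooth_vf A U W" by auto
  show "g p (curvature_field A D X Y Z p) (W p) = - g p (curvature_field A D Y X Z p) (W p)"
    unfolding curvature_field_swap[OF U s(1,2,3)] by (simp add: g_simps)
  show "g p (curvature_field A D X Y Z p) (W p) = - g p (curvature_field A D X Y W p) (Z p)"
    by (rule curvature_field_skew[OF U s])
  have "g p (curvature_field A D X Y Z p + curvature_field A D Y Z X p + curvature_field A D Z X Y p) (W p) = 0"
    unfolding curvature_field_Bianchi[OF U s(1-3)] by (simp add: g_simps)
  then show "g p (curvature_field A D X Y Z p) (W p) + g p (curvature_field A D Y Z X p) (W p)
     + g p (curvature_field A D Z X Y p) (W p) = 0"
    by (simp add: g_simps)
qed (use X Y Z W in auto)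

text \<open>These are the extensions of tangent vectors by which \<open>curvature_at\<close> is defined.\<close>

definition const_field :: "'p \<Rightarrow> 'e \<Rightarrow> 'p \<Rightarrow> 'e" where
  "const_field p v q = tvec A (chart_at A p) q v"

lemma const_field_smooth: "smooth_vf A (fst (chart_at A p)) (const_field p v)"
  unfolding const_field_def[abs_def] by (rule smooth_vf_tvec[OF chart_at_maximal])

lemma const_field_at: "const_field p v p = v"
  by (simp add: const_field_def tvec_chart_at)

lemma curvature_at_eq: "curvature_at A D p x y z = curvature_field A D (const_field p x) (const_field p y) (const_field p z) p"
  by (simp add: curvature_at_def Let_def const_field_def[abs_def])

text \<open>Skew-symmetry moves the third argument to the fourth place, where only its value matters.\<close>

lemma curvature_field_third_tensorial:
  assumes U: "open U" "p \<in> U" and X: "smooth_vf A U X" and Y: "smooth_vf A U Y"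
    and Z: "smooth_vf A U Z" "smooth_vf A U Z'" "Z p = Z' p"
  shows "curvature_field A D X Y Z p = curvature_field A D X Y Z' p"
proof (rule g_eqI[of p])
  fix w
  define V where "V = U \<inter> fst (chart_at A p)"
  have V: "open V" "p \<in> V" "V \<subseteq> U"
    using U maximal_open[OF chart_at_maximal] chart_at_dom by (auto simp: V_def)
  have W: "smooth_vf A V (const_field p w)"
    by (rule smooth_vf_subset[OF const_field_smooth]) (simp add: V_def)
  note XV = smooth_vf_subset[OF X V(3)] and YV = smooth_vf_subset[OF Y V(3)]
  show "g p (curvature_field A D X Y Z p) w = g p (curvature_field A D X Y Z' p) w"
    using curvature_field_skew[OF V(1,2) XV YV smooth_vf_subset[OF Z(1) V(3)] W]
      curvature_field_skew[OF V(1,2) XV YV smooth_vf_subset[OF Z(2) V(3)] W] Z(3)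
    by (simp add: const_field_at)
qed

text \<open>Pair symmetry exchanges the first two arguments with the last two, for which tensoriality is known.\<close>

lemma curvature_field_tensorial:
  assumes U: "open U" "p \<in> U" and X: "smooth_vf A U X" and Y: "smooth_vf A U Y" and Z: "smooth_vf A U Z"
  shows "curvature_field A D X Y Z p = curvature_at A D p (X p) (Y p) (Z p)"
proof (rule g_eqI[of p])
  fix w
  define V where "V = U \<inter> fst (chart_at A p)"
  have V: "open V" "p \<in> V" "V \<subseteq> U"
    using U maximal_open[OF chart_at_maximal] chart_at_dom by (auto simp: V_def)
  have E: "smooth_vf A V (const_field p v)" for v
    by (rule smooth_vf_subset[OF const_field_smooth]) (simp add: V_def)
  note s = smooth_vf_subset[OF X V(3)] smooth_vf_subset[OF Y V(3)] smooth_vf_subset[OF Z V(3)]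
  note at = const_field_at
  have "g p (curvature_field A D X Y Z p) w = g p (curvature_field A D Z (const_field p w) X p) (Y p)"
    using curvature_field_pair_symmetry[OF V(1,2) s E[of w]] by (simp add: at)
  also have "\<dots> = g p (curvature_field A D Z (const_field p w) (const_field p (X p)) p) (const_field p (Y p) p)"
    using curvature_field_third_tensorial[OF V(1,2) s(3) E[of w] s(1) E[of "X p"]] by (simp add: at)
  also have "\<dots> = g p (curvature_field A D (const_field p (X p)) (const_field p (Y p)) Z p) w"
    using curvature_field_pair_symmetry[OF V(1,2) s(3) E[of w] E[of "X p"] E[of "Y p"]] by (simp add: at)
  also have "\<dots> = g p (curvature_at A D p (X p) (Y p) (Z p)) w"
    unfolding curvature_at_eq using curvature_field_third_tensorial[OF V(1,2) E[of "X p"] E[of "Y p"] s(3) E[of "Z p"]] by (simp add: at)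
  finally show "g p (curvature_field A D X Y Z p) w = g p (curvature_at A D p (X p) (Y p) (Z p)) w" .
qed

definition R4 :: "'p \<Rightarrow> 'e \<Rightarrow> 'e \<Rightarrow> 'e \<Rightarrow> 'e \<Rightarrow> real" where
  "R4 p x y z w = g p (curvature_at A D p x y z) w"

lemma R4_swap: "R4 p x y z w = - R4 p y x z w"
  and R4_skew: "R4 p x y z w = - R4 p x y w z"
  and R4_pair: "R4 p x y z w = R4 p z w x y"
  and R4_Bianchi: "R4 p x y z w + R4 p y z x w + R4 p z x y w = 0"
proof -
  note U = maximal_open[OF chart_at_maximal[of p]] chart_at_dom[of p] and E = const_field_smooth[of p]
    and at = const_field_at
  show "R4 p x y z w = - R4 p y x z w"
    using curvature_field_swap[OF U E[of x] E[of y] E[of z]] by (simp add: R4_def curvature_at_eq g_simps)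
  show "R4 p x y z w = - R4 p x y w z"
    using curvature_field_skew[OF U E[of x] E[of y] E[of z] E[of w]] by (simp add: R4_def curvature_at_eq at)
  show "R4 p x y z w = R4 p z w x y"
    using curvature_field_pair_symmetry[OF U E[of x] E[of y] E[of z] E[of w]]
    by (simp add: R4_def curvature_at_eq at)
  have "g p (curvature_at A D p x y z + curvature_at A D p y z x + curvature_at A D p z x y) w = 0"
    using curvature_field_Bianchi[OF U E[of x] E[of y] E[of z]] by (simp add: curvature_at_eq g_simps)
  then show "R4 p x y z w + R4 p y z x w + R4 p z x y w = 0" by (simp add: R4_def g_simps)
qed

lemma R4_linear4: "linear (R4 p x y z)"
  unfolding R4_def by (rule linearI) (simp_all add: g_simps)

lemma R4_linear3: "linear (\<lambda>z. R4 p x y z w)"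
proof -
  have "(\<lambda>z. R4 p x y z w) = (\<lambda>z. - R4 p x y w z)" by (rule ext) (rule R4_skew)
  then show ?thesis using linear_compose_neg[OF R4_linear4[of p x y w]] by simp
qed

lemma R4_linear2: "linear (\<lambda>y. R4 p x y z w)"
proof -
  have "(\<lambda>y. R4 p x y z w) = R4 p z w x" by (rule ext) (rule R4_pair)
  then show ?thesis using R4_linear4[of p z w x] by simp
qed

lemma R4_linear1: "linear (\<lambda>x. R4 p x y z w)"
proof -
  have "(\<lambda>x. R4 p x y z w) = (\<lambda>x. R4 p z w x y)" by (rule ext) (rule R4_pair)
  then show ?thesis using R4_linear3[of p z w y] by simp
qed

end

section \<open>Submanifolds and fields along them\<close>

text \<open>A vector orthogonal to \<open>E\<close> has inner product zero with \<open>f\<close> along the line, hence also with the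
  derivative in the direction of the line.\<close>

lemma fd_in_subspace:
  fixes f :: "'a::real_normed_vector \<Rightarrow> 'b::euclidean_space"
  assumes E: "subspace E" and f: "f differentiable at x" and W: "open W" "x \<in> W"
    and line: "\<And>t. x + t *\<^sub>R e \<in> W \<Longrightarrow> f (x + t *\<^sub>R e) \<in> E"
  shows "fd f x e \<in> E"
proof -
  have "orthogonal n (fd f x e)" if n: "n \<in> orthogonal_comp E" for n
  proof -
    define T where "T = (\<lambda>t. x + t *\<^sub>R e) -` W"
    have T: "open T" unfolding T_def by (rule open_vimage[OF W(1)]) (intro continuous_intros)
    have l: "((\<lambda>t. x + t *\<^sub>R e) has_derivative (\<lambda>r. r *\<^sub>R e)) (at 0)"
      by (auto intro!: derivative_eq_intros)
    have f0: "(f has_derivative fd f x) (at (x + 0 *\<^sub>R e))" using has_derivative_fd[OF f] by simp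
    have d: "((\<lambda>t. f (x + t *\<^sub>R e)) has_derivative (\<lambda>r. fd f x (r *\<^sub>R e))) (at 0)"
      using diff_chain_at[OF l f0] by (simp add: o_def)
    have d1: "((\<lambda>t. n \<bullet> f (x + t *\<^sub>R e)) has_derivative (\<lambda>r. n \<bullet> fd f x (r *\<^sub>R e))) (at 0)"
      by (rule has_derivative_inner_right[OF d])
    have "((\<lambda>t. 0) has_derivative (\<lambda>r. n \<bullet> fd f x (r *\<^sub>R e))) (at 0)"
    proof (rule has_derivative_transform_within_open[OF d1 T])
      show "0 \<in> T" using W by (simp add: T_def)
      fix t assume "t \<in> T"
      then have "f (x + t *\<^sub>R e) \<in> E" using line by (simp add: T_def)
      then show "n \<bullet> f (x + t *\<^sub>R e) = 0"
        using n by (auto simp: orthogonal_comp_def orthogonal_def inner_commute)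
    qed
    from fd_eq[OF this] have "(\<lambda>r. n \<bullet> fd f x (r *\<^sub>R e)) = (\<lambda>r::real. 0::real)" by simp
    from fun_cong[OF this, of 1] show ?thesis by (simp add: orthogonal_def)
  qed
  then have "fd f x e \<in> orthogonal_comp (orthogonal_comp E)"
    by (auto simp: orthogonal_comp_def)
  then show ?thesis by (simp add: orthogonal_comp_self[OF E])
qed

context smooth_mfd
begin

lemma slice_chartD:
  assumes "slice_chart A M k c E"
  shows "c \<in> maximal_atlas A" "subspace E" "dim E = k" "snd c ` (fst c \<inter> M) = snd c ` fst c \<inter> E"
proof -
  note * = assms[unfolded slice_chart_def]
  show "c \<in> maximal_atlas A" by (rule *[THEN conjunct1])
  show "subspace E" by (rule *[THEN conjunct2, THEN conjunct1])
  show "dim E = k" by (rule *[THEN conjunct2, THEN conjunct2, THEN conjunct1])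
  show "snd c ` (fst c \<inter> M) = snd c ` fst c \<inter> E" by (rule *[THEN conjunct2, THEN conjunct2, THEN conjunct2])
qed

lemma slice_chart_mem:
  assumes s: "slice_chart A M k c E" and q: "q \<in> fst c"
  shows "q \<in> M \<longleftrightarrow> snd c q \<in> E"
proof
  assume "q \<in> M"
  then have "snd c q \<in> snd c ` (fst c \<inter> M)" using q by (intro imageI IntI)
  then show "snd c q \<in> E" unfolding slice_chartD(4)[OF s] by (rule IntD2)
next
  assume "snd c q \<in> E"
  then have "snd c q \<in> snd c ` (fst c \<inter> M)" unfolding slice_chartD(4)[OF s] using q by (intro IntI imageI)
  then obtain q' where q': "q' \<in> fst c" "q' \<in> M" "snd c q = snd c q'" by (elim imageE IntE)
  have "chart_inv c (snd c q) = q" by (rule inv_snd[OF slice_chartD(1)[OF s] q])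
  moreover have "chart_inv c (snd c q) = q'" unfolding q'(3) by (rule inv_snd[OF slice_chartD(1)[OF s] q'(1)])
  ultimately show "q \<in> M" using q'(2) by simp
qed

lemma fd_along_slice:
  fixes f :: "'e \<Rightarrow> 'b::euclidean_space"
  assumes s: "slice_chart A M k c E" and U: "open U" "p \<in> U" "U \<subseteq> fst c" and p: "p \<in> M"
    and e: "e \<in> E" and F: "subspace F" and f: "f differentiable at (snd c p)"
    and val: "\<And>q. q \<in> U \<Longrightarrow> q \<in> M \<Longrightarrow> f (snd c q) \<in> F"
  shows "fd f (snd c p) e \<in> F"
proof (rule fd_in_subspace[OF F f, where W = "snd c ` U"])
  show "open (snd c ` U)" by (rule open_image[OF slice_chartD(1)[OF s] U(1,3)])
  show "snd c p \<in> snd c ` U" using U by auto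
  fix t assume "snd c p + t *\<^sub>R e \<in> snd c ` U"
  then obtain q where q: "q \<in> U" "snd c p + t *\<^sub>R e = snd c q" by auto
  have "p \<in> fst c" "q \<in> fst c" using U q by auto
  have "snd c p \<in> E" using slice_chart_mem[OF s \<open>p \<in> fst c\<close>] p by simp
  then have "snd c q \<in> E"
    unfolding q(2)[symmetric] using slice_chartD(2)[OF s] e by (simp add: subspace_add subspace_scale)
  then have "q \<in> M" using slice_chart_mem[OF s \<open>q \<in> fst c\<close>] by simp
  then show "f (snd c p + t *\<^sub>R e) \<in> F" unfolding q(2) by (rule val[OF q(1)])
qed

text \<open>\<open>tangent_space\<close> admits any slice chart at \<open>p\<close>. One of them decides, because transition maps
  between slice charts preserve the slices, so that their derivatives preserve the slice directions.\<close>

lemma tangent_space_slice: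
  assumes s: "slice_chart A M k c E" and p: "p \<in> fst c" "p \<in> M"
  shows "v \<in> tangent_space A M p \<longleftrightarrow> tcomp A c p v \<in> E"
proof
  assume "tcomp A c p v \<in> E"
  then show "v \<in> tangent_space A M p" using p(1) s unfolding tangent_space_def mem_Collect_eq
    by (intro exI conjI)
next
  assume "v \<in> tangent_space A M p"
  then obtain d E' k' where d: "p \<in> fst d" and s': "slice_chart A M k' d E'" and v: "tcomp A d p v \<in> E'"
    unfolding tangent_space_def mem_Collect_eq by (elim exE conjE)
  note cm = slice_chartD(1)[OF s] and dm = slice_chartD(1)[OF s']
  have "fd (transition d c) (snd d p) (tcomp A d p v) \<in> E"
  proof (rule fd_along_slice[where U = "fst c \<inter> fst d", OF s' _ _ _ p(2) v slice_chartD(2)[OF s] transition_differentiable[OF dm cm d p(1)]])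
    show "open (fst c \<inter> fst d)" using maximal_open[OF cm] maximal_open[OF dm] by auto
    show "p \<in> fst c \<inter> fst d" "fst c \<inter> fst d \<subseteq> fst d" using p d by auto
    show "transition d c (snd d q) \<in> E" if "q \<in> fst c \<inter> fst d" "q \<in> M" for q
      using that slice_chart_mem[OF s, of q] by (simp add: inv_snd[OF dm])
  qed
  then show "tcomp A c p v \<in> E" by (simp add: tcomp_change[OF dm d cm p(1)])
qed

lemma submanifoldE:
  assumes "submanifold A M k" "p \<in> M"
  obtains c E where "p \<in> fst c" "slice_chart A M k c E"
proof -
  have "\<exists>c E. p \<in> fst c \<and> slice_chart A M k c E"
    by (rule bspec[OF assms(1)[unfolded submanifold_def] assms(2)])
  then obtain c E where "p \<in> fst c" "slice_chart A M k c E" by (elim exE conjE)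
  then show ?thesis by (rule that)
qed

lemma tangent_space_props:
  assumes M: "submanifold A M k" "p \<in> M"
  shows "subspace (tangent_space A M p)" "dim (tangent_space A M p) = k"
proof -
  obtain c E where c: "p \<in> fst c" and s: "slice_chart A M k c E" by (rule submanifoldE[OF M])
  note cm = slice_chartD(1)[OF s]
  have eq: "tangent_space A M p = tvec A c p ` E"
  proof (intro set_eqI iffI)
    fix v assume "v \<in> tangent_space A M p"
    then have "tcomp A c p v \<in> E" by (simp add: tangent_space_slice[OF s c M(2)])
    then show "v \<in> tvec A c p ` E" using tvec_tcomp[OF cm c, of v] by (metis rev_image_eqI)
  next
    fix v assume "v \<in> tvec A c p ` E"
    then show "v \<in> tangent_space A M p"
      by (auto simp: tangent_space_slice[OF s c M(2)] tcomp_tvec[OF cm c])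
  qed
  show "subspace (tangent_space A M p)"
    unfolding eq by (rule linear_subspace_image[OF linear_tvec[OF cm c] slice_chartD(2)[OF s]])
  have "inj (tvec A c p)" by (rule inj_on_inverseI[of _ "tcomp A c p"]) (rule tcomp_tvec[OF cm c])
  then have "dim (tvec A c p ` E) = dim E"
    by (intro dim_image_eq[OF linear_tvec[OF cm c]]) (auto intro: inj_on_subset)
  then show "dim (tangent_space A M p) = k" by (simp add: eq slice_chartD(3)[OF s])
qed

lemma vderiv_zero_along:
  assumes M: "submanifold A M k" "p \<in> M" and U: "open U" "p \<in> U" and f: "smooth_fun A U f"
    and 0: "\<And>q. q \<in> U \<Longrightarrow> q \<in> M \<Longrightarrow> f q = 0" and v: "v \<in> tangent_space A M p"
  shows "vderiv A f p v = 0"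
proof -
  obtain c E where c: "p \<in> fst c" and s: "slice_chart A M k c E" by (rule submanifoldE[OF M])
  note cm = slice_chartD(1)[OF s]
  note dif = smooth_fun_differentiable[OF U(1) f cm U(2) c]
  have "fd (\<lambda>x. f (chart_inv c x)) (snd c p) (tcomp A c p v) \<in> {0}"
  proof (rule fd_along_slice[where U = "U \<inter> fst c", OF s _ _ _ M(2) _ _ dif])
    show "open (U \<inter> fst c)" using U maximal_open[OF cm] by auto
    show "p \<in> U \<inter> fst c" "U \<inter> fst c \<subseteq> fst c" using U c by auto
    show "tcomp A c p v \<in> E" using v tangent_space_slice[OF s c M(2)] by simp
    show "f (chart_inv c (snd c q)) \<in> {0}" if "q \<in> U \<inter> fst c" "q \<in> M" for q
      using that 0 by (simp add: inv_snd[OF cm])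
  qed (simp add: subspace_single_0)
  then show ?thesis by (simp add: vderiv_chart[OF cm c dif])
qed

text \<open>In a slice chart the components of fields tangent to \<open>M\<close> stay in the slice directions along the
  slice, and so do their derivatives along the slice.\<close>

lemma lie_bracket_tangent:
  assumes M: "submanifold A M k" "p \<in> M" and U: "open U" "p \<in> U" and X: "smooth_vf A U X" and Y: "smooth_vf A U Y"
    and tX: "\<And>q. q \<in> U \<Longrightarrow> q \<in> M \<Longrightarrow> X q \<in> tangent_space A M q"
    and tY: "\<And>q. q \<in> U \<Longrightarrow> q \<in> M \<Longrightarrow> Y q \<in> tangent_space A M q"
  shows "lie_bracket A X Y p \<in> tangent_space A M p"
proof -
  obtain c E where c: "p \<in> fst c" and s: "slice_chart A M k c E" by (rule submanifoldE[OF M])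
  note cm = slice_chartD(1)[OF s]
  have key: "fd (local_rep A c Q) (snd c p) (tcomp A c p v) \<in> E"
    if Q: "smooth_vf A U Q" and t: "\<And>q. q \<in> U \<Longrightarrow> q \<in> M \<Longrightarrow> Q q \<in> tangent_space A M q"
      and v: "v \<in> tangent_space A M p" for Q v
  proof (rule fd_along_slice[where U = "U \<inter> fst c", OF s _ _ _ M(2) _ slice_chartD(2)[OF s] local_rep_differentiable[OF U(1) Q cm U(2) c]])
    show "open (U \<inter> fst c)" using U maximal_open[OF cm] by auto
    show "p \<in> U \<inter> fst c" "U \<inter> fst c \<subseteq> fst c" using U c by auto
    show "tcomp A c p v \<in> E" using v tangent_space_slice[OF s c M(2)] by simp
    show "local_rep A c Q (snd c q) \<in> E" if "q \<in> U \<inter> fst c" "q \<in> M" for q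
      using that t[of q] tangent_space_slice[OF s _ that(2)] by (simp add: local_rep_snd[OF cm])
  qed
  show ?thesis
    unfolding tangent_space_slice[OF s c M(2)] lie_bracket_chart[OF U X Y cm c]
    by (rule subspace_diff[OF slice_chartD(2)[OF s] key[OF Y tY tX[OF U(2) M(2)]] key[OF X tX tY[OF U(2) M(2)]]])
qed

text \<open>\<open>Z\<close> is an ambient extension over \<open>U\<close> of the field \<open>X\<close> along \<open>M\<close>; in contrast to \<open>extension\<close> it serves
  all points of \<open>U \<inter> M\<close> at once.\<close>

definition extends :: "'p set \<Rightarrow> ('p \<Rightarrow> 'e) \<Rightarrow> 'p set \<Rightarrow> ('p \<Rightarrow> 'e) \<Rightarrow> bool" where
  "extends M X U Z \<longleftrightarrow> open U \<and> smooth_vf A U Z \<and> (\<forall>q\<in>U \<inter> M. Z q = X q)"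

lemma extendsD:
  assumes "extends M X U Z"
  shows "open U" "smooth_vf A U Z" "\<And>q. q \<in> U \<Longrightarrow> q \<in> M \<Longrightarrow> Z q = X q"
  using assms unfolding extends_def by simp_all

lemma extends_subset: "extends M X U Z \<Longrightarrow> open V \<Longrightarrow> V \<subseteq> U \<Longrightarrow> extends M X V Z"
  using smooth_vf_subset[of U Z V] by (auto simp: extends_def)

lemma extends_extension:
  assumes "extends M X U Z" "p \<in> U"
  obtains V where "p \<in> V" "extends M X V (extension A M X p)"
proof -
  have "\<exists>Z U. open U \<and> p \<in> U \<and> smooth_vf A U Z \<and> (\<forall>q\<in>U \<inter> M. Z q = X q)"
    using assms unfolding extends_def by (intro exI[of _ Z] exI[of _ U]) simp_all
  from someI_ex[OF this] obtain V where "open V" "p \<in> V" "smooth_vf A V (extension A M X p)"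
    "\<forall>q\<in>V \<inter> M. extension A M X p q = X q"
    unfolding extension_def[symmetric] by (elim exE conjE)
  then show ?thesis by (intro that[of V]) (simp_all add: extends_def)
qed

lemma extends_along:
  assumes V: "openin (top_of_set M) V" and X: "smooth_vf_along A V X" and p: "p \<in> V"
  obtains U Z where "p \<in> U" "extends M X U Z" "U \<inter> M \<subseteq> V"
proof -
  obtain T where T: "open T" "V = M \<inter> T" using V by (auto simp: openin_open)
  obtain U Z where U: "open U" "p \<in> U" "smooth_vf A U Z" "\<forall>q\<in>U \<inter> V. Z q = X q"
    using bspec[OF X[unfolded smooth_vf_along_def] p] by (elim exE conjE)
  have "extends M X (U \<inter> T) Z"
    unfolding extends_def using U T by (intro conjI open_Int smooth_vf_subset[OF U(3)]) auto
  moreover have "p \<in> U \<inter> T" using U T p by auto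
  ultimately show ?thesis using that[of "U \<inter> T" Z] T by auto
qed

end

context semi_riemannian
begin

text \<open>For every field \<open>W\<close> the function \<open>g Y W\<close> vanishes on \<open>M\<close>, hence so does its derivative in the tangent
  direction \<open>X p\<close>. By compatibility of the metric this derivative is \<open>g (D X Y) W\<close> at \<open>p\<close>.\<close>

lemma D_zero_along:
  assumes M: "submanifold A M k" "p \<in> M" and U: "open U" "p \<in> U" and X: "smooth_vf A U X" and Y: "smooth_vf A U Y"
    and 0: "\<And>q. q \<in> U \<Longrightarrow> q \<in> M \<Longrightarrow> Y q = 0" and t: "X p \<in> tangent_space A M p"
  shows "D X Y p = 0"
proof (rule g_nondegenerate[of p])
  fix w
  define V where "V = U \<inter> fst (chart_at A p)"
  have V: "open V" "p \<in> V" "V \<subseteq> U"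
    using U maximal_open[OF chart_at_maximal] chart_at_dom by (auto simp: V_def)
  have W: "smooth_vf A V (const_field p w)"
    by (rule smooth_vf_subset[OF const_field_smooth]) (simp add: V_def)
  note XV = smooth_vf_subset[OF X V(3)] and YV = smooth_vf_subset[OF Y V(3)]
  have "vderiv A (\<lambda>q. g q (Y q) (const_field p w q)) p (X p) = 0"
    by (rule vderiv_zero_along[OF M V(1,2) g_smooth[OF V(1) YV W] _ t]) (use 0 V(3) in \<open>auto simp: g_simps\<close>)
  then show "g p (D X Y p) w = 0"
    using metric_compat[OF V(1) XV YV W V(2)] 0[OF U(2) M(2)] by (simp add: const_field_at g_simps)
qed

lemma D_along_cong:
  assumes M: "submanifold A M k" "p \<in> M" and U: "p \<in> U" "p \<in> U'" and X: "smooth_vf A U X" "smooth_vf A U' X'"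
    and Y: "extends M Y0 U Y" "extends M Y0 U' Y'"
    and eq: "X p = X' p" and t: "X p \<in> tangent_space A M p"
  shows "D X Y p = D X' Y' p"
proof -
  define V where "V = U \<inter> U'"
  have V: "open V" "p \<in> V" using U extendsD(1)[OF Y(1)] extendsD(1)[OF Y(2)] by (auto simp: V_def)
  have XV: "smooth_vf A V X" "smooth_vf A V X'" "smooth_vf A V Y" "smooth_vf A V Y'"
    using smooth_vf_subset[OF X(1)] smooth_vf_subset[OF X(2)]
      smooth_vf_subset[OF extendsD(2)[OF Y(1)]] smooth_vf_subset[OF extendsD(2)[OF Y(2)]] by (auto simp: V_def)
  have "D X (\<lambda>q. Y q - Y' q) p = 0"
    by (rule D_zero_along[OF M V XV(1) smooth_vf_diff[OF V(1) XV(3,4)] _ t])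
      (use extendsD(3)[OF Y(1)] extendsD(3)[OF Y(2)] in \<open>simp add: V_def\<close>)
  then have "D X Y p = D X Y' p" using D_diff_right[OF V(1) XV(1,3,4) V(2)] by simp
  also have "\<dots> = D X' Y' p" by (rule D_left_tensorial[OF V XV(1,2,4) eq])
  finally show ?thesis .
qed

text \<open>\<open>nabla_bar\<close> chooses new extensions at every point. Iterated derivatives require one formula that is
  valid at all points near a given one.\<close>

lemma nabla_bar_eq:
  assumes M: "submanifold A M k" "q \<in> M" and U: "q \<in> U" and X: "extends M X U X'" and Y: "extends M Y U Y'"
    and t: "X q \<in> tangent_space A M q"
  shows "nabla_bar A D M X Y q = D X' Y' q"
proof -
  obtain V where V: "q \<in> V" "extends M X V (extension A M X q)" by (rule extends_extension[OF X U])
  obtain W where W: "q \<in> W" "extends M Y W (extension A M Y q)" by (rule extends_extension[OF Y U])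
  have o: "open (V \<inter> W)" using extendsD(1)[OF V(2)] extendsD(1)[OF W(2)] by auto
  have e: "extension A M X q q = X q" "X' q = X q"
    using extendsD(3)[OF V(2,1) M(2)] extendsD(3)[OF X U M(2)] by auto
  show ?thesis
    unfolding nabla_bar_def
  proof (rule D_along_cong[OF M _ U _ extendsD(2)[OF X] _ Y])
    show "q \<in> V \<inter> W" using V W by auto
    show "smooth_vf A (V \<inter> W) (extension A M X q)"
      by (rule smooth_vf_subset[OF extendsD(2)[OF V(2)]]) auto
    show "extends M Y (V \<inter> W) (extension A M Y q)" by (rule extends_subset[OF W(2) o]) auto
    show "extension A M X q q = X' q" "extension A M X q q \<in> tangent_space A M q" using e t by auto
  qed
qed

lemma bracket_along_eq:
  assumes M: "submanifold A M k" "q \<in> M" and U: "q \<in> U" and X: "extends M X U X'" and Y: "extends M Y U Y'"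
    and t: "X q \<in> tangent_space A M q" "Y q \<in> tangent_space A M q"
  shows "bracket_along A M X Y q = lie_bracket A X' Y' q"
proof -
  obtain V where V: "q \<in> V" "extends M X V (extension A M X q)" by (rule extends_extension[OF X U])
  obtain W where W: "q \<in> W" "extends M Y W (extension A M Y q)" by (rule extends_extension[OF Y U])
  have o: "open (V \<inter> W)" "q \<in> V \<inter> W" using extendsD(1)[OF V(2)] extendsD(1)[OF W(2)] V W by auto
  have s: "smooth_vf A (V \<inter> W) (extension A M X q)" "smooth_vf A (V \<inter> W) (extension A M Y q)"
    by (rule smooth_vf_subset[OF extendsD(2)[OF V(2)]], simp)
      (rule smooth_vf_subset[OF extendsD(2)[OF W(2)]], simp)
  have "bracket_along A M X Y q = nabla_bar A D M X Y q - nabla_bar A D M Y X q"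
    unfolding bracket_along_def nabla_bar_def torsion_free[OF o(1) s o(2)] ..
  also have "\<dots> = lie_bracket A X' Y' q"
    unfolding nabla_bar_eq[OF M U X Y t(1)] nabla_bar_eq[OF M U Y X t(2)]
    by (rule torsion_free[OF extendsD(1)[OF X] extendsD(2)[OF X] extendsD(2)[OF Y] U])
  finally show ?thesis .
qed

end

section \<open>Tangent fields with a prescribed value\<close>

text \<open>The flat function is \<open>flat_exp 0\<close>; the powers of \<open>1/t\<close> make the family closed under differentiation,
  up to linear combinations.\<close>

definition flat_exp :: "nat \<Rightarrow> real \<Rightarrow> real" where
  "flat_exp n t = (if t > 0 then inverse t ^ n * exp (- inverse t) else 0)"

lemma flat_exp_tendsto: "(flat_exp n \<longlongrightarrow> 0) (at 0)"
proof -
  have "((\<lambda>u::real. u ^ n / exp u) \<longlongrightarrow> 0) at_top" by (rule tendsto_power_div_exp_0)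
  then have "((\<lambda>t::real. inverse t ^ n / exp (inverse t)) \<longlongrightarrow> 0) (at_right 0)"
    by (rule filterlim_compose[OF _ filterlim_inverse_at_top_right])
  moreover have "\<forall>\<^sub>F t in at_right 0. flat_exp n t = inverse t ^ n / exp (inverse t)"
    unfolding eventually_at_right_field by (rule exI[of _ 1]) (simp add: flat_exp_def exp_minus divide_inverse)
  ultimately have r: "(flat_exp n \<longlongrightarrow> 0) (at_right 0)" using tendsto_cong by fast
  have "\<forall>\<^sub>F t in at_left 0. flat_exp n t = 0"
    unfolding eventually_at_left_field by (rule exI[of _ "-1"]) (simp add: flat_exp_def)
  then have l: "(flat_exp n \<longlongrightarrow> 0) (at_left 0)" by (rule tendsto_eventually)
  show ?thesis using filterlim_split_at[OF l r] .
qed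

text \<open>At \<open>0\<close> the difference quotient of \<open>flat_exp n\<close> is \<open>flat_exp (n + 1)\<close>, which tends to \<open>0\<close>.\<close>

lemma flat_exp_deriv:
  "(flat_exp n has_real_derivative (flat_exp (n + 2) t - real n * flat_exp (n + 1) t)) (at t)"
proof -
  consider "t > 0" | "t < 0" | "t = 0" by linarith
  then show ?thesis
  proof cases
    case 1
    have "((\<lambda>t. inverse t ^ n * exp (- inverse t)) has_real_derivative
        (real n * inverse t ^ (n - 1) * (- (inverse t ^ 2)) * exp (- inverse t)
          + inverse t ^ n * (exp (- inverse t) * inverse t ^ 2))) (at t)"
      using 1 by (auto intro!: derivative_eq_intros simp: power2_eq_square)
    moreover have "real n * inverse t ^ (n - 1) * (- (inverse t ^ 2)) * exp (- inverse t)
          + inverse t ^ n * (exp (- inverse t) * inverse t ^ 2)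
        = flat_exp (n + 2) t - real n * flat_exp (n + 1) t"
      using 1 by (cases n) (simp_all add: flat_exp_def algebra_simps power2_eq_square)
    ultimately have "((\<lambda>t. inverse t ^ n * exp (- inverse t)) has_real_derivative
        (flat_exp (n + 2) t - real n * flat_exp (n + 1) t)) (at t)" by simp
    then show ?thesis
      by (rule has_field_derivative_transform_within_open[where S = "{0<..}"])
        (use 1 in \<open>simp_all add: flat_exp_def\<close>)
  next
    case 2
    have "((\<lambda>t::real. 0::real) has_real_derivative (flat_exp (n + 2) t - real n * flat_exp (n + 1) t)) (at t)"
      using 2 by (simp add: flat_exp_def)
    then show ?thesis
      by (rule has_field_derivative_transform_within_open[where S = "{..<0}"])
        (use 2 in \<open>simp_all add: flat_exp_def\<close>)
  next
    case 3
    have "(\<lambda>h. (flat_exp n (0 + h) - flat_exp n 0) / h) = flat_exp (n + 1)"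
      by (rule ext) (simp add: flat_exp_def divide_inverse mult_ac)
    then have "(flat_exp n has_real_derivative 0) (at 0)"
      unfolding DERIV_def using flat_exp_tendsto[of "n + 1"] by simp
    then show ?thesis using 3 by (simp add: flat_exp_def)
  qed
qed

lemma smooth_flat_exp: "smooth_on UNIV (flat_exp n)"
proof -
  have "Ck_on k UNIV (flat_exp n)" for k
  proof (induction k arbitrary: n)
    case 0
    have "isCont (flat_exp n) t" for t by (rule DERIV_isCont[OF flat_exp_deriv])
    then show ?case by (simp add: continuous_at_imp_continuous_on)
  next
    case (Suc k)
    have d: "(flat_exp n has_derivative (*) (flat_exp (n + 2) t - real n * flat_exp (n + 1) t)) (at t)" for t
      using flat_exp_deriv unfolding has_field_derivative_def .
    have "Ck_on k UNIV (\<lambda>t. fd (flat_exp n) t v)" for v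
    proof -
      have "Ck_on k UNIV (\<lambda>t. v * (flat_exp (n + 2) t + (- real n) * flat_exp (n + 1) t))"
        by (rule Ck_on_bounded_linear[OF bounded_linear_mult_right open_UNIV Ck_on_add[OF open_UNIV Suc
              Ck_on_bounded_linear[OF bounded_linear_mult_right open_UNIV Suc]]])
      then show ?thesis by (rule Ck_on_congI[OF open_UNIV]) (simp add: fd_eq[OF d] algebra_simps)
    qed
    moreover have "flat_exp n differentiable at t" for t by (rule differentiableI[OF d])
    ultimately show ?case by simp
  qed
  then show ?thesis by (simp add: smooth_on_def)
qed

context smooth_mfd
begin

text \<open>A field with constant components in a slice chart is cut off by a bump function. Screen conformality
  speaks of sections over a prescribed neighbourhood; globally defined fields restrict to sections
  over any such neighbourhood, so the condition can be evaluated on all tangent vectors at a point.\<close>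

lemma tangent_vector_extends:
  assumes M: "submanifold A M k" "p \<in> M" and v: "v \<in> tangent_space A M p"
  obtains X where "smooth_vf A UNIV X" "X p = v" "\<forall>q\<in>M. X q \<in> tangent_space A M q"
proof -
  obtain c E where c: "p \<in> fst c" and s: "slice_chart A M k c E" by (rule submanifoldE[OF M])
  note cm = slice_chartD(1)[OF s] and subE = slice_chartD(2)[OF s]
  define x0 where "x0 = snd c p"
  have o: "open (snd c ` fst c)" by (rule open_image[OF cm maximal_open[OF cm]]) simp
  have "x0 \<in> snd c ` fst c" using c by (simp add: x0_def)
  then obtain e where e: "e > 0" "cball x0 e \<subseteq> snd c ` fst c" using o open_contains_cball by blast
  define \<psi> where "\<psi> x = flat_exp 0 (e\<^sup>2 + - ((x + - x0) \<bullet> (x + - x0)))" for x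
  have dist: "(x + - x0) \<bullet> (x + - x0) = (dist x x0)\<^sup>2" for x
    by (simp add: dist_norm power2_norm_eq_inner)
  have \<psi>0: "\<psi> x0 > 0" using e by (simp add: \<psi>_def flat_exp_def)
  have \<psi>out: "\<psi> x = 0" if "x \<notin> cball x0 e" for x
  proof -
    have "e < dist x x0" using that by (simp add: dist_commute)
    then have "e\<^sup>2 < (dist x x0)\<^sup>2" using e(1) by (intro power_strict_mono) auto
    then show ?thesis unfolding \<psi>_def dist flat_exp_def by simp
  qed
  have sq: "smooth_on UNIV (\<lambda>x::'e. e\<^sup>2 + (-1) *\<^sub>R ((x + - x0) \<bullet> (x + - x0)))"
    by (intro smooth_on_add smooth_on_scaleR smooth_on_inner smooth_on_const smooth_on_ident open_UNIV)
  have \<psi>: "smooth_on UNIV \<psi>"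
    unfolding \<psi>_def[abs_def]
    using smooth_on_compose[OF open_UNIV open_UNIV subset_UNIV smooth_flat_exp sq, of 0] by simp
  (* normalised so that the cut-off field has the value v at p *)
  define w where "w = (1 / \<psi> x0) *\<^sub>R tcomp A c p v"
  have w: "w \<in> E"
    unfolding w_def using v tangent_space_slice[OF s c M(2)] by (simp add: subspace_scale[OF subE])
  define X where "X q = (if q \<in> fst c then \<psi> (snd c q) *\<^sub>R tvec A c q w else 0)" for q
  (* the support of the cut-off field; it is closed in the whole manifold since it is compact *)
  define K where "K = chart_inv c ` cball x0 e"
  have "continuous_on (snd c ` fst c) (chart_inv c)"
    using maximal_is_chart[OF cm] unfolding is_chart_def homeomorphism_def by (elim conjE)
  then have "compact K" unfolding K_def
    by (intro compact_continuous_image compact_cball) (rule continuous_on_subset[OF _ e(2)])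
  then have openK: "open (- K)" by (intro open_Compl compact_imp_closed)
  have Kc: "K \<subseteq> fst c"
  proof
    fix q assume "q \<in> K"
    then obtain x where x: "x \<in> cball x0 e" "q = chart_inv c x" unfolding K_def by (elim imageE)
    from x(1) e(2) have "x \<in> snd c ` fst c" by (rule subsetD[rotated])
    then obtain q' where "q' \<in> fst c" "x = snd c q'" by (elim imageE)
    then show "q \<in> fst c" using x(2) inv_snd[OF cm] by simp
  qed
  have "smooth_vf A (fst c) X"
  proof (rule smooth_vfI_chart[OF maximal_open[OF cm] subset_refl cm])
    have "smooth_on (snd c ` fst c) (\<lambda>x. \<psi> x *\<^sub>R w)"
      by (rule smooth_on_scaleR[OF o smooth_on_subset[OF \<psi> subset_UNIV] smooth_on_const])
    then show "smooth_on (snd c ` fst c) (local_rep A c X)"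
    proof (rule smooth_on_congI[OF o])
      fix x assume "x \<in> snd c ` fst c"
      then obtain q where "q \<in> fst c" "x = snd c q" by (elim imageE)
      then show "local_rep A c X x = \<psi> x *\<^sub>R w"
        by (simp add: local_rep_snd[OF cm] X_def linear_scale[OF linear_tcomp[OF cm]] tcomp_tvec[OF cm])
    qed
  qed
  moreover have "smooth_vf A (- K) X"
  proof (rule smooth_vf_congI[OF openK smooth_vf_zero[OF openK]])
    fix q assume q: "q \<in> - K"
    show "X q = 0"
    proof (cases "q \<in> fst c")
      case True
      have "snd c q \<notin> cball x0 e"
      proof
        assume "snd c q \<in> cball x0 e"
        then have "chart_inv c (snd c q) \<in> K" unfolding K_def by (rule imageI)
        then show False using q by (simp add: inv_snd[OF cm True])
      qed
      then show ?thesis by (simp add: X_def \<psi>out)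
    qed (simp add: X_def)
  qed
  ultimately have "smooth_vf A UNIV X"
  proof (intro smooth_vf_locally open_UNIV)
    fix q assume f: "smooth_vf A (fst c) X" and K: "smooth_vf A (- K) X"
    show "\<exists>V. open V \<and> q \<in> V \<and> smooth_vf A V X"
    proof (cases "q \<in> fst c")
      case True
      then show ?thesis using f maximal_open[OF cm] by (intro exI[of _ "fst c"] conjI)
    next
      case False
      then have "q \<in> - K" using Kc by (simp add: subset_eq) blast
      then show ?thesis using K openK by (intro exI[of _ "- K"] conjI)
    qed
  qed
  moreover have "X p = v"
  proof -
    have "X p = \<psi> x0 *\<^sub>R ((1 / \<psi> x0) *\<^sub>R v)"
      using c by (simp add: X_def x0_def[symmetric] w_def linear_scale[OF linear_tvec[OF cm c]] tvec_tcomp[OF cm c])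
    then show ?thesis using \<psi>0 by simp
  qed
  moreover have "\<forall>q\<in>M. X q \<in> tangent_space A M q"
  proof
    fix q assume q: "q \<in> M"
    show "X q \<in> tangent_space A M q"
    proof (cases "q \<in> fst c")
    case True
    then show ?thesis
      unfolding tangent_space_slice[OF s True q]
      by (simp add: X_def linear_scale[OF linear_tcomp[OF cm]] tcomp_tvec[OF cm] subspace_scale[OF subE w])
  next
    case False
    then show ?thesis by (simp add: X_def subspace_0[OF tangent_space_props(1)[OF M(1) q]])
    qed
  qed
  ultimately show ?thesis by (rule that)
qed

end

section \<open>Algebraic curvature tensors\<close>

lemma algebraic_curvature_tensor_add:
  assumes "algebraic_curvature_tensor W F" "algebraic_curvature_tensor W G"
  shows "algebraic_curvature_tensor W (\<lambda>x y z w. F x y z w + G x y z w)"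
  unfolding algebraic_curvature_tensor_def
proof (intro conjI ballI)
  note F = assms(1)[unfolded algebraic_curvature_tensor_def linear_on_sub_def]
  note G = assms(2)[unfolded algebraic_curvature_tensor_def linear_on_sub_def]
  fix x y z assume s: "x \<in> W" "y \<in> W" "z \<in> W"
  note FL = F[THEN conjunct1, THEN bspec, OF s(1), THEN bspec, OF s(2), THEN bspec, OF s(3)]
  note GL = G[THEN conjunct1, THEN bspec, OF s(1), THEN bspec, OF s(2), THEN bspec, OF s(3)]
  show "linear_on_sub W (\<lambda>t. F t x y z + G t x y z)" "linear_on_sub W (\<lambda>t. F x t y z + G x t y z)"
    "linear_on_sub W (\<lambda>t. F x y t z + G x y t z)" "linear_on_sub W (\<lambda>t. F x y z t + G x y z t)"
    using FL GL by (simp_all add: linear_on_sub_def algebra_simps)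
  fix w assume w: "w \<in> W"
  note FS = F[THEN conjunct2, THEN bspec, OF s(1), THEN bspec, OF s(2), THEN bspec, OF s(3), THEN bspec, OF w]
  note GS = G[THEN conjunct2, THEN bspec, OF s(1), THEN bspec, OF s(2), THEN bspec, OF s(3), THEN bspec, OF w]
  show "F x y z w + G x y z w = - (F y x z w + G y x z w)"
    using FS[THEN conjunct1] GS[THEN conjunct1] by linarith
  show "F x y z w + G x y z w = F z w x y + G z w x y"
    using FS[THEN conjunct2, THEN conjunct1] GS[THEN conjunct2, THEN conjunct1] by linarith
  show "F x y z w + G x y z w + (F y z x w + G y z x w) + (F z x y w + G z x y w) = 0"
    using FS[THEN conjunct2, THEN conjunct2] GS[THEN conjunct2, THEN conjunct2] by linarith
qed

lemma algebraic_curvature_tensor_zero: "algebraic_curvature_tensor W (\<lambda>x y z w. 0)"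
  by (simp add: algebraic_curvature_tensor_def linear_on_sub_def)

lemma algebraic_curvature_tensor_sum:
  assumes "\<And>i. i \<in> I \<Longrightarrow> algebraic_curvature_tensor W (F i)"
  shows "algebraic_curvature_tensor W (\<lambda>x y z w. \<Sum>i\<in>I. F i x y z w)"
  using assms
proof (induction I rule: infinite_finite_induct)
  case (insert j I)
  have "algebraic_curvature_tensor W (\<lambda>x y z w. F j x y z w + (\<Sum>i\<in>I. F i x y z w))"
    by (rule algebraic_curvature_tensor_add[OF insert.prems insert.IH[OF insert.prems]]) simp_all
  then show ?case using insert.hyps by simp
qed (simp_all add: algebraic_curvature_tensor_zero)

text \<open>Up to a factor, the curvature of a hypersurface of a flat space with second fundamental form \<open>h\<close>.
  Symmetry of \<open>h\<close> on \<open>W\<close> is what the cyclic identity needs.\<close>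

lemma algebraic_curvature_tensor_square:
  assumes W: "subspace W" and lin: "\<And>x. linear (h x)" and sym: "\<And>x y. x \<in> W \<Longrightarrow> y \<in> W \<Longrightarrow> h x y = h y x"
  shows "algebraic_curvature_tensor W (\<lambda>x y z w. (k::real) * (h y z * h x w - h x z * h y w))"
  unfolding algebraic_curvature_tensor_def
proof (intro conjI ballI)
  have R: "h x (a *\<^sub>R t + b *\<^sub>R s) = a * h x t + b * h x s" for x t s a b
    by (simp add: linear_add[OF lin] linear_scale[OF lin])
  have L: "h (a *\<^sub>R t + b *\<^sub>R s) x = a * h t x + b * h s x" if "t \<in> W" "s \<in> W" "x \<in> W" for t s x a b
  proof -
    have "a *\<^sub>R t + b *\<^sub>R s \<in> W" using that by (intro subspace_add[OF W] subspace_scale[OF W])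
    then have "h (a *\<^sub>R t + b *\<^sub>R s) x = h x (a *\<^sub>R t + b *\<^sub>R s)" using that(3) by (rule sym)
    then show ?thesis unfolding R using sym[OF that(1,3)] sym[OF that(2,3)] by simp
  qed
  fix x y z assume s: "x \<in> W" "y \<in> W" "z \<in> W"
  show "linear_on_sub W (\<lambda>t. k * (h x y * h t z - h t y * h x z))"
    "linear_on_sub W (\<lambda>t. k * (h t y * h x z - h x y * h t z))"
    "linear_on_sub W (\<lambda>t. k * (h y t * h x z - h x t * h y z))"
    "linear_on_sub W (\<lambda>t. k * (h y z * h x t - h x z * h y t))"
    unfolding linear_on_sub_def using s by (simp_all add: L R algebra_simps)
  fix w assume w: "w \<in> W"
  note e = sym[OF s(1,2)] sym[OF s(1,3)] sym[OF s(2,3)] sym[OF s(1) w] sym[OF s(2) w] sym[OF s(3) w]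
  show "k * (h y z * h x w - h x z * h y w) = - (k * (h x z * h y w - h y z * h x w))"
    by (simp add: algebra_simps)
  show "k * (h y z * h x w - h x z * h y w) = k * (h w x * h z y - h z x * h w y)"
    unfolding e by (simp add: algebra_simps)
  show "k * (h y z * h x w - h x z * h y w) + k * (h z x * h y w - h y x * h z w)
      + k * (h x y * h z w - h z y * h x w) = 0"
    unfolding e by (simp add: algebra_simps)
qed

lemma proj_along_eqI:
  assumes "subspace V" "subspace W" and int: "\<And>x. x \<in> V \<Longrightarrow> x \<in> W \<Longrightarrow> x = 0"
    and v: "v \<in> V" "x - v \<in> W"
  shows "proj_along V W x = v"
  unfolding proj_along_def
proof (rule the_equality)
  show "v \<in> V \<and> x - v \<in> W" using v by simp
  fix u assume u: "u \<in> V \<and> x - u \<in> W"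
  have "u - v \<in> V" using u v by (intro subspace_diff[OF assms(1)]) auto
  moreover have "u - v = (x - v) - (x - u)" by simp
  then have "u - v \<in> W" using u v(2) subspace_diff[OF assms(2), of "x - v" "x - u"] by simp
  ultimately have "u - v = 0" by (rule int)
  then show "u = v" by simp
qed

context semi_riemannian
begin

lemma R4_pullback_algebraic:
  assumes P: "linear P"
  shows "algebraic_curvature_tensor W (\<lambda>x y z w. R4 p (P x) (P y) (P z) (P w))"
  unfolding algebraic_curvature_tensor_def
proof (intro conjI ballI)
  have P': "P (a *\<^sub>R s + b *\<^sub>R t) = a *\<^sub>R P s + b *\<^sub>R P t" for a b s t
    by (simp add: linear_add[OF P] linear_scale[OF P])
  fix x y z
  show "linear_on_sub W (\<lambda>t. R4 p (P t) (P x) (P y) (P z))"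
    by (simp add: linear_on_sub_def P' linear_add[OF R4_linear1] linear_scale[OF R4_linear1])
  show "linear_on_sub W (\<lambda>t. R4 p (P x) (P t) (P y) (P z))"
    by (simp add: linear_on_sub_def P' linear_add[OF R4_linear2] linear_scale[OF R4_linear2])
  show "linear_on_sub W (\<lambda>t. R4 p (P x) (P y) (P t) (P z))"
    by (simp add: linear_on_sub_def P' linear_add[OF R4_linear3] linear_scale[OF R4_linear3])
  show "linear_on_sub W (\<lambda>t. R4 p (P x) (P y) (P z) (P t))"
    by (simp add: linear_on_sub_def P' linear_add[OF R4_linear4] linear_scale[OF R4_linear4])
  fix w
  show "R4 p (P x) (P y) (P z) (P w) = - R4 p (P y) (P x) (P z) (P w)" by (rule R4_swap)
  show "R4 p (P x) (P y) (P z) (P w) = R4 p (P z) (P w) (P x) (P y)" by (rule R4_pair)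
  show "R4 p (P x) (P y) (P z) (P w) + R4 p (P y) (P z) (P x) (P w) + R4 p (P z) (P x) (P y) (P w) = 0"
    by (rule R4_Bianchi)
qed

section \<open>Second fundamental forms\<close>

text \<open>The second fundamental form of \<open>M\<close> with respect to a normal field \<open>B\<close>, in Weingarten form: \<open>B\<close> is
  differentiated instead of the second tangent field, so the form is pointwise and linear in \<open>y\<close> by
  construction.\<close>

definition sff :: "'p set \<Rightarrow> 'p \<Rightarrow> ('p \<Rightarrow> 'e) \<Rightarrow> 'e \<Rightarrow> 'e \<Rightarrow> real" where
  "sff M p B x y = - g p y (D (const_field p x) (extension A M B p) p)"

lemma sff_linear: "linear (sff M p B x)"
  unfolding sff_def by (rule linearI) (simp_all add: g_simps)

lemma sff_eq:
  assumes M: "submanifold A M k" "p \<in> M" and U: "p \<in> U" and X: "smooth_vf A U X'" and B: "extends M B U B'"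
    and t: "X' p \<in> tangent_space A M p"
  shows "sff M p B (X' p) y = - g p y (D X' B' p)"
proof -
  obtain V where V: "p \<in> V" "extends M B V (extension A M B p)" by (rule extends_extension[OF B U])
  define W where "W = V \<inter> fst (chart_at A p)"
  have W: "open W" "p \<in> W" "W \<subseteq> V" "W \<subseteq> fst (chart_at A p)"
    using V extendsD(1)[OF V(2)] maximal_open[OF chart_at_maximal] chart_at_dom by (auto simp: W_def)
  have "D (const_field p (X' p)) (extension A M B p) p = D X' B' p"
  proof (rule D_along_cong[OF M W(2) U _ X extends_subset[OF V(2) W(1,3)] B])
    show "smooth_vf A W (const_field p (X' p))" by (rule smooth_vf_subset[OF const_field_smooth W(4)])
  qed (simp_all add: const_field_at t)
  then show ?thesis by (simp add: sff_def)
qed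

text \<open>Differentiate \<open>g Y B = 0\<close> in a tangent direction. The field \<open>Y\<close> need not be tangent, only orthogonal
  to \<open>B\<close>: the lemma is applied to \<open>B = \<xi> i\<close> with \<open>Y\<close> tangent, and to \<open>B = N i\<close> with \<open>Y\<close> in the screen.\<close>

lemma sff_normal:
  assumes M: "submanifold A M k" "p \<in> M" and U: "p \<in> U" and X: "smooth_vf A U X'" and B: "extends M B U B'"
    and Y: "smooth_vf A U Y'" and perp: "\<And>q. q \<in> U \<Longrightarrow> q \<in> M \<Longrightarrow> g q (Y' q) (B q) = 0"
    and t: "X' p \<in> tangent_space A M p"
  shows "g p (D X' Y' p) (B p) = sff M p B (X' p) (Y' p)"
proof -
  have "vderiv A (\<lambda>q. g q (Y' q) (B' q)) p (X' p) = 0"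
  proof (rule vderiv_zero_along[OF M extendsD(1)[OF B] U g_smooth[OF extendsD(1)[OF B] Y extendsD(2)[OF B]] _ t])
    show "g q (Y' q) (B' q) = 0" if "q \<in> U" "q \<in> M" for q
      using perp[OF that] extendsD(3)[OF B that] by simp
  qed
  then show ?thesis
    using metric_compat[OF extendsD(1)[OF B] X Y extendsD(2)[OF B] U] extendsD(3)[OF B U M(2)]
      sff_eq[OF M U X B t] by simp
qed

end

section \<open>Coisotropic submanifolds with a dual pair of frames\<close>

text \<open>Everything takes place over the domain \<open>V\<close> of dual frames of the radical and of the transversal
  bundle. By \<open>dims\<close> the rank of the radical is the codimension of \<open>M\<close>, which is the coisotropy.\<close>

locale coisotropic_frame = semi_riemannian A g D \<nu>
  for A :: "('p::t2_space, 'e::euclidean_space) chart set" and g D \<nu> +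
  fixes M :: "'p set" and m r :: nat and S L :: "'p \<Rightarrow> 'e set" and V :: "'p set"
    and \<xi> N :: "nat \<Rightarrow> 'p \<Rightarrow> 'e"
  assumes submfd: "submanifold A M m" and dims: "DIM('e) = m + r"
    and screen: "screen_distribution A g M S"
    and V: "openin (top_of_set M) V"
    and frame: "frame_on A V r (Rad A g M) \<xi>"
    and transversal: "transversal_frame A g S r L V \<xi> N"
begin

abbreviation T :: "'p \<Rightarrow> 'e set" where "T \<equiv> tangent_space A M"
abbreviation Rd :: "'p \<Rightarrow> 'e set" where "Rd \<equiv> Rad A g M"
abbreviation J :: "nat set" where "J \<equiv> {1..r}"

lemma V_subset_M: "q \<in> V \<Longrightarrow> q \<in> M"
  using openin_subset[OF V] by auto

lemma xi_smooth: "i \<in> J \<Longrightarrow> smooth_vf_along A V (\<xi> i)"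
  by (rule bspec[OF frame[unfolded frame_on_def, THEN conjunct1]])

lemmas frame_at = bspec[OF frame[unfolded frame_on_def, THEN conjunct2]]

lemma Rad_span: "q \<in> V \<Longrightarrow> span ((\<lambda>i. \<xi> i q) ` J) = Rd q"
  by (rule frame_at[THEN conjunct2, THEN conjunct2])

lemma N_smooth: "i \<in> J \<Longrightarrow> smooth_vf_along A V (N i)"
  by (rule bspec[OF transversal[unfolded transversal_frame_def, THEN conjunct1]])

lemmas transversal_at = bspec[OF transversal[unfolded transversal_frame_def, THEN conjunct2]]

lemma L_span: "q \<in> V \<Longrightarrow> span ((\<lambda>i. N i q) ` J) = L q"
  by (rule transversal_at[THEN conjunct2, THEN conjunct2])

lemma N_screen:
  assumes "q \<in> V" "i \<in> J" "s \<in> S q"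
  shows "g q (N i q) s = 0"
proof -
  have "N i q \<in> perp_in (g q) (S q)" by (rule bspec[OF transversal_at[OF assms(1), THEN conjunct1] assms(2)])
  then show ?thesis using assms(3) by (simp add: perp_in_def)
qed

lemma xi_N: "q \<in> V \<Longrightarrow> i \<in> J \<Longrightarrow> j \<in> J \<Longrightarrow> g q (\<xi> i q) (N j q) = (if i = j then 1 else 0)"
  by (rule transversal_at[THEN conjunct2, THEN conjunct1, THEN bspec, THEN bspec, THEN conjunct1])

lemma N_N: "q \<in> V \<Longrightarrow> i \<in> J \<Longrightarrow> j \<in> J \<Longrightarrow> g q (N i q) (N j q) = 0"
  by (rule transversal_at[THEN conjunct2, THEN conjunct1, THEN bspec, THEN bspec, THEN conjunct2])

lemma N_xi: "q \<in> V \<Longrightarrow> i \<in> J \<Longrightarrow> j \<in> J \<Longrightarrow> g q (N i q) (\<xi> j q) = (if i = j then 1 else 0)"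
  using xi_N[of q j i] by (simp add: g_sym[of q "N i q"])

lemma T_subspace: "q \<in> M \<Longrightarrow> subspace (T q)" and T_dim: "q \<in> M \<Longrightarrow> dim (T q) = m"
  using tangent_space_props[OF submfd] by auto

lemma Rad_T: "x \<in> Rd q \<Longrightarrow> x \<in> T q"
  by (simp add: Rad_def)

lemma Rad_perp: "x \<in> Rd q \<Longrightarrow> y \<in> T q \<Longrightarrow> g q x y = 0"
  by (simp add: Rad_def perp_in_def)

lemma Rad_perp': "x \<in> Rd q \<Longrightarrow> y \<in> T q \<Longrightarrow> g q y x = 0"
  using Rad_perp g_sym by simp

lemma xi_Rad: "q \<in> V \<Longrightarrow> i \<in> J \<Longrightarrow> \<xi> i q \<in> Rd q"
  unfolding Rad_span[symmetric] by (rule span_base) (rule imageI)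

lemma xi_T: "q \<in> V \<Longrightarrow> i \<in> J \<Longrightarrow> \<xi> i q \<in> T q"
  by (rule Rad_T[OF xi_Rad])

lemma N_L: "q \<in> V \<Longrightarrow> i \<in> J \<Longrightarrow> N i q \<in> L q"
  unfolding L_span[symmetric] by (rule span_base) (rule imageI)

lemma L_subspace: "q \<in> V \<Longrightarrow> subspace (L q)"
  unfolding L_span[symmetric] by (rule subspace_span)

lemma Rad_subspace: "q \<in> V \<Longrightarrow> subspace (Rd q)"
  unfolding Rad_span[symmetric] by (rule subspace_span)

lemma dual_expansion:
  assumes dual: "\<And>i j. i \<in> J \<Longrightarrow> j \<in> J \<Longrightarrow> g q (u i) (w j) = (if i = j then 1 else 0)"
    and x: "x \<in> span (u ` J)"
  shows "x = (\<Sum>i\<in>J. g q x (w i) *\<^sub>R u i)"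
proof -
  have "subspace {x. x = (\<Sum>i\<in>J. g q x (w i) *\<^sub>R u i)}"
  proof (rule subspaceI; unfold mem_Collect_eq)
    show "0 = (\<Sum>i\<in>J. g q 0 (w i) *\<^sub>R u i)" by (simp add: g_simps)
    show "x + y = (\<Sum>i\<in>J. g q (x + y) (w i) *\<^sub>R u i)"
      if "x = (\<Sum>i\<in>J. g q x (w i) *\<^sub>R u i)" "y = (\<Sum>i\<in>J. g q y (w i) *\<^sub>R u i)" for x y
      unfolding g_simps scaleR_left_distrib sum.distrib that[symmetric] ..
    show "c *\<^sub>R x = (\<Sum>i\<in>J. g q (c *\<^sub>R x) (w i) *\<^sub>R u i)"
      if "x = (\<Sum>i\<in>J. g q x (w i) *\<^sub>R u i)" for c x
      unfolding g_simps real_scaleR_def scaleR_scaleR[symmetric] scaleR_sum_right[symmetric] that[symmetric] ..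
  qed
  moreover have "u ` J \<subseteq> {x. x = (\<Sum>i\<in>J. g q x (w i) *\<^sub>R u i)}"
  proof
    fix x assume "x \<in> u ` J"
    then obtain j where j: "j \<in> J" "x = u j" by (elim imageE)
    have "(\<Sum>i\<in>J. g q (u j) (w i) *\<^sub>R u i) = (\<Sum>i\<in>J. if j = i then u i else 0)"
      by (rule sum.cong[OF refl]) (simp add: dual[OF j(1)])
    also have "\<dots> = u j" using j(1) by simp
    finally show "x \<in> {x. x = (\<Sum>i\<in>J. g q x (w i) *\<^sub>R u i)}" using j(2) by simp
  qed
  ultimately have "span (u ` J) \<subseteq> {x. x = (\<Sum>i\<in>J. g q x (w i) *\<^sub>R u i)}" by (rule span_minimal[rotated])
  then show ?thesis using x by auto
qed

lemma L_expansion: "q \<in> V \<Longrightarrow> x \<in> L q \<Longrightarrow> x = (\<Sum>i\<in>J. g q x (\<xi> i q) *\<^sub>R N i q)"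
  by (rule dual_expansion[where u = "\<lambda>i. N i q" and w = "\<lambda>i. \<xi> i q"])
    (erule (2) N_xi, simp only: L_span)

lemma Rad_expansion: "q \<in> V \<Longrightarrow> x \<in> Rd q \<Longrightarrow> x = (\<Sum>i\<in>J. g q x (N i q) *\<^sub>R \<xi> i q)"
  by (rule dual_expansion[where u = "\<lambda>i. \<xi> i q" and w = "\<lambda>i. N i q"])
    (erule (2) xi_N, simp only: Rad_span)

lemma dual_sum:
  assumes "j \<in> J" "\<And>i. i \<in> J \<Longrightarrow> g q (u i) z = (if i = j then 1 else 0)"
  shows "g q (\<Sum>i\<in>J. c i *\<^sub>R u i) z = c j"
proof -
  have "g q (\<Sum>i\<in>J. c i *\<^sub>R u i) z = (\<Sum>i\<in>J. if j = i then c i else 0)"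
    unfolding g_sum_left by (rule sum.cong[OF refl]) (auto simp: g_simps assms(2))
  then show ?thesis using assms(1) by simp
qed

lemma L_dim:
  assumes q: "q \<in> V"
  shows "dim (L q) = r"
proof -
  define u where "u i = N i q" for i
  have val: "g q (\<Sum>i\<in>J. c i *\<^sub>R u i) (\<xi> j q) = c j" if "j \<in> J" for c j
    by (rule dual_sum[OF that]) (simp add: u_def N_xi[OF q _ that])
  have inj: "inj_on u J"
  proof (rule inj_onI)
    fix i j assume ij: "i \<in> J" "j \<in> J" "u i = u j"
    have "g q (u j) (\<xi> i q) = 1" using N_xi[OF q ij(1,1)] ij(3) by (simp add: u_def)
    then show "i = j" using N_xi[OF q ij(2,1)] by (simp add: u_def split: if_splits)
  qed
  have "independent (u ` J)"
  proof (rule independent_if_scalars_zero)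
    fix f x assume 0: "(\<Sum>x\<in>u ` J. f x *\<^sub>R x) = 0" and x: "x \<in> u ` J"
    then obtain j where j: "j \<in> J" "x = u j" by (elim imageE)
    have "(\<Sum>i\<in>J. f (u i) *\<^sub>R u i) = 0" using 0 unfolding sum.reindex[OF inj] o_def .
    then have "f (u j) = 0" using val[OF j(1), of "\<lambda>i. f (u i)"] by (simp add: g_simps)
    then show "f x = 0" using j by simp
  qed simp
  then have "dim (span (u ` J)) = card (u ` J)" by (rule dim_span_eq_card_independent)
  moreover have "span (u ` J) = L q" unfolding u_def by (rule L_span[OF q])
  ultimately have "dim (L q) = card J" by (simp only: card_image[OF inj])
  then show ?thesis by simp
qed

text \<open>Coisotropy enters here. The orthogonal complement \<open>H\<close> of the radical contains \<open>T q\<close>, and it is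
  complementary to \<open>L q\<close>, which is dual to the radical. So \<open>H\<close> has the dimension of \<open>T q\<close>.\<close>

lemma tangent_if_perp_frame:
  assumes q: "q \<in> V" and v: "\<And>i. i \<in> J \<Longrightarrow> g q v (\<xi> i q) = 0"
  shows "v \<in> T q"
proof -
  define H where "H = {v. \<forall>i\<in>J. g q v (\<xi> i q) = 0}"
  have H: "subspace H" by (auto simp: H_def subspace_def g_simps)
  have TH: "T q \<subseteq> H" using Rad_perp'[OF xi_Rad[OF q]] by (auto simp: H_def)
  have "{x + y |x y. x \<in> H \<and> y \<in> L q} = UNIV"
  proof -
    have "z \<in> {x + y |x y. x \<in> H \<and> y \<in> L q}" for z
    proof -
      define y where "y = (\<Sum>i\<in>J. g q z (\<xi> i q) *\<^sub>R N i q)"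
      have "y \<in> L q" unfolding y_def
        by (intro subspace_sum[OF L_subspace[OF q]] subspace_scale[OF L_subspace[OF q]] N_L[OF q])
      moreover have "g q y (\<xi> j q) = g q z (\<xi> j q)" if "j \<in> J" for j
        unfolding y_def by (rule dual_sum[OF that]) (simp add: N_xi[OF q _ that])
      then have "z - y \<in> H" by (simp add: H_def g_simps)
      moreover have "z = (z - y) + y" by simp
      ultimately show ?thesis unfolding mem_Collect_eq by (intro exI conjI)
    qed
    then show ?thesis by auto
  qed
  moreover have "H \<inter> L q = {0}"
  proof (intro equalityI subsetI)
    fix x assume x: "x \<in> H \<inter> L q"
    then have "x = (\<Sum>i\<in>J. g q x (\<xi> i q) *\<^sub>R N i q)" by (intro L_expansion[OF q]) simp
    also have "\<dots> = 0" using x by (intro sum.neutral) (simp add: H_def)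
    finally show "x \<in> {0}" by simp
  qed (use subspace_0[OF H] subspace_0[OF L_subspace[OF q]] in auto)
  ultimately have "dim H + dim (L q) = DIM('e)"
    using dim_sums_Int[OF H L_subspace[OF q]] by simp
  then have "dim H = m" using dims L_dim[OF q] by simp
  then have "T q = H"
    by (intro subspace_dim_equal[OF T_subspace[OF V_subset_M[OF q]] H TH]) (simp add: T_dim[OF V_subset_M[OF q]])
  then show ?thesis using v by (simp add: H_def)
qed

text \<open>The projection onto \<open>T q\<close> along \<open>L q\<close>, by means of the dual frames; the formula shows that it
  preserves smoothness.\<close>

definition tangent_part :: "'p \<Rightarrow> 'e \<Rightarrow> 'e" where
  "tangent_part q v = v - (\<Sum>i\<in>J. g q v (\<xi> i q) *\<^sub>R N i q)"

lemma tangent_part_T: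
  assumes q: "q \<in> V"
  shows "tangent_part q v \<in> T q"
proof (rule tangent_if_perp_frame[OF q])
  fix j assume j: "j \<in> J"
  have "g q (\<Sum>i\<in>J. g q v (\<xi> i q) *\<^sub>R N i q) (\<xi> j q) = g q v (\<xi> j q)"
    by (rule dual_sum[OF j]) (simp add: N_xi[OF q _ j])
  then show "g q (tangent_part q v) (\<xi> j q) = 0" by (simp add: tangent_part_def g_simps)
qed

lemma tangent_part_L:
  assumes q: "q \<in> V"
  shows "v - tangent_part q v \<in> L q"
  unfolding tangent_part_def
  using subspace_sum[OF L_subspace[OF q], of J "\<lambda>i. g q v (\<xi> i q) *\<^sub>R N i q"]
    subspace_scale[OF L_subspace[OF q] N_L[OF q]] by simp

lemma T_L_zero:
  assumes q: "q \<in> V" and x: "x \<in> T q" "x \<in> L q"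
  shows "x = 0"
proof -
  have "x = (\<Sum>i\<in>J. g q x (\<xi> i q) *\<^sub>R N i q)" by (rule L_expansion[OF q x(2)])
  also have "\<dots> = 0"
    by (rule sum.neutral) (simp add: Rad_perp'[OF xi_Rad[OF q] x(1)])
  finally show ?thesis .
qed

lemma proj_T:
  assumes q: "q \<in> V"
  shows "proj_along (T q) (L q) v = tangent_part q v"
  by (rule proj_along_eqI[OF T_subspace[OF V_subset_M[OF q]] L_subspace[OF q] T_L_zero[OF q] tangent_part_T[OF q] tangent_part_L[OF q]])

lemma proj_L:
  assumes q: "q \<in> V"
  shows "proj_along (L q) (T q) v = v - tangent_part q v"
  by (rule proj_along_eqI[OF L_subspace[OF q] T_subspace[OF V_subset_M[OF q]] _ tangent_part_L[OF q]])
    (simp_all add: T_L_zero[OF q] tangent_part_T[OF q])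

lemma nabla_eq: "q \<in> V \<Longrightarrow> nabla A D M L X Y q = tangent_part q (nabla_bar A D M X Y q)"
  by (simp add: nabla_def proj_T)

lemma screen_at:
  assumes "q \<in> M"
  shows "S q \<inter> Rd q = {0}" "{s + \<xi> | s \<xi>. s \<in> S q \<and> \<xi> \<in> Rd q} = T q"
proof -
  note * = bspec[OF screen[unfolded screen_distribution_def, THEN conjunct2] assms]
  show "S q \<inter> Rd q = {0}" by (rule *[THEN conjunct1])
  show "{s + \<xi> | s \<xi>. s \<in> S q \<and> \<xi> \<in> Rd q} = T q" by (rule *[THEN conjunct2, THEN conjunct1])
qed

lemma screen_subspace:
  assumes q: "q \<in> M"
  shows "subspace (S q)"
proof -
  obtain k where "smooth_distribution A M k S"
    using screen[unfolded screen_distribution_def, THEN conjunct1] by (elim exE)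
  from bspec[OF this[unfolded smooth_distribution_def] q]
  obtain W \<zeta> where W: "q \<in> W" "frame_on A W k S \<zeta>" by (elim exE conjE)
  have "span ((\<lambda>i. \<zeta> i q) ` {1..k}) = S q"
    by (rule bspec[OF W(2)[unfolded frame_on_def, THEN conjunct2] W(1), THEN conjunct2, THEN conjunct2])
  then show ?thesis using subspace_span by metis
qed

text \<open>On \<open>T q\<close> this is the projection onto the screen along the radical. Unlike \<open>screen_proj\<close> it is linear
  on the whole ambient tangent space.\<close>

definition screen_part :: "'p \<Rightarrow> 'e \<Rightarrow> 'e" where
  "screen_part q u = u - (\<Sum>i\<in>J. g q u (N i q) *\<^sub>R \<xi> i q)"

lemma linear_screen_part: "linear (screen_part q)"
  unfolding screen_part_def
  by (rule linearI) (simp_all add: g_simps scaleR_left_distrib sum.distrib scaleR_diff_right scaleR_sum_right)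

lemma screen_part_diff_Rad: "q \<in> V \<Longrightarrow> u - screen_part q u \<in> Rd q"
  unfolding screen_part_def
  using subspace_sum[OF Rad_subspace, of q J "\<lambda>i. g q u (N i q) *\<^sub>R \<xi> i q"]
    subspace_scale[OF Rad_subspace xi_Rad] by simp

lemma screen_part_S:
  assumes q: "q \<in> V" and u: "u \<in> T q"
  shows "screen_part q u \<in> S q"
proof -
  have "u \<in> {s + \<xi> | s \<xi>. s \<in> S q \<and> \<xi> \<in> Rd q}" unfolding screen_at(2)[OF V_subset_M[OF q]] by (rule u)
  then obtain s \<rho> where s: "u = s + \<rho>" "s \<in> S q" "\<rho> \<in> Rd q" by auto
  have "g q u (N i q) = g q \<rho> (N i q)" if "i \<in> J" for i
    using N_screen[OF q that s(2)] by (simp add: s(1) g_simps g_sym[of q s])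
  then have "screen_part q u = s + \<rho> - (\<Sum>i\<in>J. g q \<rho> (N i q) *\<^sub>R \<xi> i q)"
    by (simp add: screen_part_def s(1))
  then show ?thesis using Rad_expansion[OF q s(3)] s(2) by simp
qed

lemma S_T: "q \<in> V \<Longrightarrow> s \<in> S q \<Longrightarrow> s \<in> T q"
proof -
  assume q: "q \<in> V" and s: "s \<in> S q"
  have "s = s + 0" by simp
  then have "s \<in> {s + \<xi> | s \<xi>. s \<in> S q \<and> \<xi> \<in> Rd q}"
    unfolding mem_Collect_eq using s subspace_0[OF Rad_subspace[OF q]] by (intro exI conjI)
  then show "s \<in> T q" by (simp add: screen_at(2)[OF V_subset_M[OF q]])
qed

lemma S_Rad_zero: "q \<in> V \<Longrightarrow> x \<in> S q \<Longrightarrow> x \<in> Rd q \<Longrightarrow> x = 0"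
  using screen_at(1)[OF V_subset_M] by (metis IntI singletonD)

lemma screen_proj_eq:
  assumes q: "q \<in> V" and u: "u \<in> T q"
  shows "screen_proj A g M S q u = screen_part q u"
  unfolding screen_proj_def
  by (rule proj_along_eqI[OF screen_subspace[OF V_subset_M[OF q]] Rad_subspace[OF q] S_Rad_zero[OF q] screen_part_S[OF q u]
        screen_part_diff_Rad[OF q]])

lemma proj_Rad:
  assumes q: "q \<in> V" and u: "u \<in> T q"
  shows "proj_along (Rd q) (S q) u = u - screen_part q u"
  by (rule proj_along_eqI[OF Rad_subspace[OF q] screen_subspace[OF V_subset_M[OF q]] _ screen_part_diff_Rad[OF q]])
    (simp_all add: S_Rad_zero[OF q] screen_part_S[OF q u])

abbreviation xi_ext :: "'p \<Rightarrow> nat \<Rightarrow> 'p \<Rightarrow> 'e" where "xi_ext p i \<equiv> extension A M (\<xi> i) p"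
abbreviation N_ext :: "'p \<Rightarrow> nat \<Rightarrow> 'p \<Rightarrow> 'e" where "N_ext p i \<equiv> extension A M (N i) p"

text \<open>A single neighbourhood for all the finitely many fields of both frames.\<close>

lemma frame_extends:
  assumes p: "p \<in> V"
  obtains U where "open U" "p \<in> U" "U \<inter> M \<subseteq> V"
    "\<forall>i\<in>J. extends M (\<xi> i) U (xi_ext p i)" "\<forall>i\<in>J. extends M (N i) U (N_ext p i)"
proof -
  have ex: "\<exists>U. p \<in> U \<and> extends M B U (extension A M B p)" if B: "smooth_vf_along A V B" for B
  proof -
    obtain U Z where U: "p \<in> U" "extends M B U Z" by (rule extends_along[OF V B p])
    obtain W where "p \<in> W" "extends M B W (extension A M B p)" by (rule extends_extension[OF U(2,1)])
    then show ?thesis by (intro exI conjI)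
  qed
  have "\<forall>i\<in>J. \<exists>U. p \<in> U \<and> extends M (\<xi> i) U (xi_ext p i)" by (intro ballI ex xi_smooth)
  then obtain U1 where U1: "\<forall>i\<in>J. p \<in> U1 i \<and> extends M (\<xi> i) (U1 i) (xi_ext p i)"
    by (rule bchoice[THEN exE])
  have "\<forall>i\<in>J. \<exists>U. p \<in> U \<and> extends M (N i) U (N_ext p i)" by (intro ballI ex N_smooth)
  then obtain U2 where U2: "\<forall>i\<in>J. p \<in> U2 i \<and> extends M (N i) (U2 i) (N_ext p i)"
    by (rule bchoice[THEN exE])
  obtain O0 where O0: "open O0" "V = M \<inter> O0" using V by (auto simp: openin_open)
  define U where "U = O0 \<inter> (\<Inter>i\<in>J. U1 i) \<inter> (\<Inter>i\<in>J. U2 i)"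
  have U: "open U" unfolding U_def using O0 U1 U2 extendsD(1) by (intro open_Int open_INT) auto
  show ?thesis
  proof (rule that[OF U])
    show "p \<in> U" using p O0 U1 U2 by (simp add: U_def)
    show "U \<inter> M \<subseteq> V" using O0 by (auto simp: U_def)
    show "\<forall>i\<in>J. extends M (\<xi> i) U (xi_ext p i)"
      by (rule ballI, rule extends_subset[OF bspec[OF U1, THEN conjunct2] U]) (auto simp: U_def)
    show "\<forall>i\<in>J. extends M (N i) U (N_ext p i)"
      by (rule ballI, rule extends_subset[OF bspec[OF U2, THEN conjunct2] U]) (auto simp: U_def)
  qed
qed

abbreviation h :: "nat \<Rightarrow> 'p \<Rightarrow> 'e \<Rightarrow> 'e \<Rightarrow> real" where "h i p \<equiv> sff M p (\<xi> i)"
abbreviation b :: "nat \<Rightarrow> 'p \<Rightarrow> 'e \<Rightarrow> 'e \<Rightarrow> real" where "b i p \<equiv> sff M p (N i)"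

text \<open>The geometric meaning of the Weingarten form \<open>h i\<close>: the component of the ambient derivative along
  \<open>N i\<close>, which is the local second fundamental form of \<open>M\<close>.\<close>

lemma h_eq:
  assumes U: "p \<in> U" "U \<inter> M \<subseteq> V" "p \<in> M" and i: "i \<in> J" and B: "extends M (\<xi> i) U B'"
    and X: "smooth_vf A U X'" "X' p \<in> T p" and Y: "smooth_vf A U Y'" "\<And>q. q \<in> U \<Longrightarrow> q \<in> M \<Longrightarrow> Y' q \<in> T q"
  shows "g p (D X' Y' p) (\<xi> i p) = h i p (X' p) (Y' p)"
proof (rule sff_normal[OF submfd U(3,1) X(1) B Y(1) _ X(2)])
  fix q assume q: "q \<in> U" "q \<in> M"
  then have "q \<in> V" using U(2) by auto
  then show "g q (Y' q) (\<xi> i q) = 0" by (rule Rad_perp'[OF xi_Rad[OF _ i] Y(2)[OF q]])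
qed

text \<open>Likewise \<open>b i\<close> is the local second fundamental form of the screen, if the second field is a section
  of the screen.\<close>

lemma b_eq:
  assumes U: "p \<in> U" "U \<inter> M \<subseteq> V" "p \<in> M" and i: "i \<in> J" and B: "extends M (N i) U B'"
    and X: "smooth_vf A U X'" "X' p \<in> T p" and Y: "smooth_vf A U Y'" "\<And>q. q \<in> U \<Longrightarrow> q \<in> M \<Longrightarrow> Y' q \<in> S q"
  shows "g p (D X' Y' p) (N i p) = b i p (X' p) (Y' p)"
proof (rule sff_normal[OF submfd U(3,1) X(1) B Y(1) _ X(2)])
  fix q assume q: "q \<in> U" "q \<in> M"
  then have "g q (N i q) (Y' q) = 0" using U(2) by (intro N_screen[OF _ i] Y(2)) auto
  then show "g q (Y' q) (N i q) = 0" by (simp add: g_sym[of q "Y' q"])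
qed

text \<open>The torsion vanishes, and brackets of tangent fields are tangent, hence orthogonal to \<open>\<xi> i\<close>.\<close>

lemma h_sym:
  assumes p: "p \<in> V" and i: "i \<in> J" and x: "x \<in> T p" and y: "y \<in> T p"
  shows "h i p x y = h i p y x"
proof -
  obtain U where U: "open U" "p \<in> U" "U \<inter> M \<subseteq> V" and exts: "\<forall>i\<in>J. extends M (\<xi> i) U (xi_ext p i)" "\<forall>i\<in>J. extends M (N i) U (N_ext p i)"
    by (rule frame_extends[OF p])
  note \<xi> = bspec[OF exts(1)]
  obtain X where X0: "smooth_vf A UNIV X" "X p = x" "\<forall>q\<in>M. X q \<in> T q"
    by (rule tangent_vector_extends[OF submfd V_subset_M[OF p] x])
  note X = X0(1,2) bspec[OF X0(3)]
  obtain Y where Y0: "smooth_vf A UNIV Y" "Y p = y" "\<forall>q\<in>M. Y q \<in> T q"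
    by (rule tangent_vector_extends[OF submfd V_subset_M[OF p] y])
  note Y = Y0(1,2) bspec[OF Y0(3)]
  note XU = smooth_vf_subset[OF X(1) subset_UNIV[of U]] and YU = smooth_vf_subset[OF Y(1) subset_UNIV[of U]]
  note pM = V_subset_M[OF p]
  have "lie_bracket A X Y p \<in> T p"
    by (rule lie_bracket_tangent[OF submfd pM U(1,2) XU YU X(3) Y(3)])
  then have "g p (lie_bracket A X Y p) (\<xi> i p) = 0" by (rule Rad_perp'[OF xi_Rad[OF p i]])
  then have "g p (D X Y p) (\<xi> i p) = g p (D Y X p) (\<xi> i p)"
    using torsion_free[OF U(1) XU YU U(2), symmetric] by (simp add: g_simps)
  moreover have "g p (D X Y p) (\<xi> i p) = h i p (X p) (Y p)"
    by (rule h_eq[OF U(2,3) pM i \<xi>[OF i] XU X(3)[OF pM] YU Y(3)])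
  moreover have "g p (D Y X p) (\<xi> i p) = h i p (Y p) (X p)"
    by (rule h_eq[OF U(2,3) pM i \<xi>[OF i] YU Y(3)[OF pM] XU X(3)])
  ultimately show ?thesis using X(2) Y(2) by simp
qed

text \<open>On radical vectors \<open>h k x (\<xi> l)\<close> is both skew and symmetric in \<open>k\<close> and \<open>l\<close>. Skewness comes from
  \<open>g (\<xi> k) (\<xi> l) = 0\<close>; symmetry is the statement that \<open>[\<xi> l, \<xi> k]\<close> is orthogonal to \<open>x\<close>, which holds
  since the bracket is tangent to the leaves of the radical.\<close>

lemma h_Rad:
  assumes integrable: "integrable_distribution A M r (Rad A g M)"
    and p: "p \<in> V" and i: "i \<in> J" and x: "x \<in> T p" and \<rho>: "\<rho> \<in> Rd p"
  shows "h i p x \<rho> = 0"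
proof -
  obtain U where U: "open U" "p \<in> U" "U \<inter> M \<subseteq> V" and exts: "\<forall>i\<in>J. extends M (\<xi> i) U (xi_ext p i)" "\<forall>i\<in>J. extends M (N i) U (N_ext p i)"
    by (rule frame_extends[OF p])
  note \<xi> = bspec[OF exts(1)]
  obtain X where X0: "smooth_vf A UNIV X" "X p = x" "\<forall>q\<in>M. X q \<in> T q"
    by (rule tangent_vector_extends[OF submfd V_subset_M[OF p] x])
  note X = X0(1,2) bspec[OF X0(3)]
  note XU = smooth_vf_subset[OF X(1) subset_UNIV[of U]]
  note pM = V_subset_M[OF p]
  (* the leaf of the radical through p *)
  obtain I where I: "p \<in> I" "I \<subseteq> M" "submanifold A I r" "\<forall>q\<in>I. tangent_space A I q = Rd q"
    using bspec[OF integrable[unfolded integrable_distribution_def] pM] by (elim exE conjE)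
  have ext: "xi_ext p k q = \<xi> k q" if "k \<in> J" "q \<in> U" "q \<in> M" for k q
    by (rule extendsD(3)[OF \<xi>[OF that(1)] that(2,3)])
  have extT: "xi_ext p k q \<in> Rd q" if "k \<in> J" "q \<in> U" "q \<in> M" for k q
    unfolding ext[OF that] by (rule xi_Rad[OF _ that(1)]) (use that U in auto)
  have sm: "smooth_vf A U (xi_ext p k)" if "k \<in> J" for k by (rule extendsD(2)[OF \<xi>[OF that]])
  have skew: "h k p x (\<xi> l p) = - h l p x (\<xi> k p)" if k: "k \<in> J" and l: "l \<in> J" for k l
  proof -
    have "g p (D X (xi_ext p l) p) (\<xi> k p) = h k p (X p) (xi_ext p l p)"
      by (rule h_eq[OF U(2,3) pM k \<xi>[OF k] XU X(3)[OF pM] sm[OF l] Rad_T[OF extT[OF l]]])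
    moreover have "h l p (X p) (\<xi> k p) = - g p (\<xi> k p) (D X (xi_ext p l) p)"
      by (rule sff_eq[OF submfd pM U(2) XU \<xi>[OF l] X(3)[OF pM]])
    ultimately show ?thesis using X(2) ext[OF l U(2) pM] by (simp add: g_sym[of p "\<xi> k p"])
  qed
  have symm: "h k p x (\<xi> l p) = h l p x (\<xi> k p)" if k: "k \<in> J" and l: "l \<in> J" for k l
  proof -
    have tI: "xi_ext p j q \<in> tangent_space A I q" if "j \<in> J" "q \<in> U" "q \<in> I" for j q
      using extT[of j q] that I by auto
    have "lie_bracket A (xi_ext p l) (xi_ext p k) p \<in> tangent_space A I p"
      by (rule lie_bracket_tangent[OF I(3,1) U(1,2) sm[OF l] sm[OF k] tI[OF l] tI[OF k]])
    then have "lie_bracket A (xi_ext p l) (xi_ext p k) p \<in> Rd p" using I(1,4) by simp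
    then have "g p x (lie_bracket A (xi_ext p l) (xi_ext p k) p) = 0" by (rule Rad_perp'[OF _ x])
    then have "g p x (D (xi_ext p l) (xi_ext p k) p) = g p x (D (xi_ext p k) (xi_ext p l) p)"
      using torsion_free[OF U(1) sm[OF l] sm[OF k] U(2), symmetric] by (simp add: g_simps)
    moreover have "h k p (xi_ext p l p) x = - g p x (D (xi_ext p l) (xi_ext p k) p)"
      by (rule sff_eq[OF submfd pM U(2) sm[OF l] \<xi>[OF k] Rad_T[OF extT[OF l U(2) pM]]])
    moreover have "h l p (xi_ext p k p) x = - g p x (D (xi_ext p k) (xi_ext p l) p)"
      by (rule sff_eq[OF submfd pM U(2) sm[OF k] \<xi>[OF l] Rad_T[OF extT[OF k U(2) pM]]])
    ultimately have "h k p (\<xi> l p) x = h l p (\<xi> k p) x" using ext[OF k U(2) pM] ext[OF l U(2) pM] by simp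
    then show ?thesis using h_sym[OF p k x xi_T[OF p l]] h_sym[OF p l x xi_T[OF p k]] by simp
  qed
  have 0: "h i p x (\<xi> j p) = 0" if "j \<in> J" for j
    using skew[OF i that] symm[OF i that] by simp
  have "h i p x \<rho> = h i p x (\<Sum>j\<in>J. g p \<rho> (N j p) *\<^sub>R \<xi> j p)"
    using Rad_expansion[OF p \<rho>] by simp
  also have "\<dots> = (\<Sum>j\<in>J. g p \<rho> (N j p) *\<^sub>R h i p x (\<xi> j p))"
    by (simp add: linear_sum[OF sff_linear] linear_scale[OF sff_linear])
  also have "\<dots> = 0" by (rule sum.neutral) (simp add: 0)
  finally show ?thesis .
qed

lemma h_screen_part:
  assumes integrable: "integrable_distribution A M r (Rad A g M)"
    and p: "p \<in> V" and i: "i \<in> J" and x: "x \<in> T p"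
  shows "h i p x (screen_part p u) = h i p x u"
  using h_Rad[OF integrable p i x screen_part_diff_Rad[OF p, of u]] by (simp add: linear_diff[OF sff_linear])

text \<open>Both sides of the conformality condition are components of one ambient derivative, namely of the
  screen part of a tangent field; they are the two second fundamental forms.\<close>

lemma conformal_forms:
  assumes conf: "\<And>X Y i q. X \<in> sections A V T \<Longrightarrow> Y \<in> sections A V T \<Longrightarrow> i \<in> J \<Longrightarrow> q \<in> V \<Longrightarrow>
      g q (h_star A g D M S L X (\<lambda>q. screen_proj A g M S q (Y q)) q) (N i q)
      = \<phi> i q * g q (h_l A D M L X (\<lambda>q. screen_proj A g M S q (Y q)) q) (\<xi> i q)"
    and p: "p \<in> V" and i: "i \<in> J" and x: "x \<in> T p" and u: "u \<in> T p"
  shows "b i p x (screen_part p u) = \<phi> i p * h i p x (screen_part p u)"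
proof -
  obtain U where U: "open U" "p \<in> U" "U \<inter> M \<subseteq> V" and exts: "\<forall>i\<in>J. extends M (\<xi> i) U (xi_ext p i)" "\<forall>i\<in>J. extends M (N i) U (N_ext p i)"
    by (rule frame_extends[OF p])
  note \<xi> = bspec[OF exts(1)] and N = bspec[OF exts(2)]
  note pM = V_subset_M[OF p]
  obtain X where X0: "smooth_vf A UNIV X" "X p = x" "\<forall>q\<in>M. X q \<in> T q"
    by (rule tangent_vector_extends[OF submfd pM x])
  note X = X0(1,2) bspec[OF X0(3)]
  obtain Y where Y0: "smooth_vf A UNIV Y" "Y p = u" "\<forall>q\<in>M. Y q \<in> T q"
    by (rule tangent_vector_extends[OF submfd pM u])
  note Y = Y0(1,2) bspec[OF Y0(3)]
  note XU = smooth_vf_subset[OF X(1) subset_UNIV[of U]] and YU = smooth_vf_subset[OF Y(1) subset_UNIV[of U]]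
  have sec: "Z \<in> sections A V T" if Z: "smooth_vf A UNIV Z" "\<And>q. q \<in> M \<Longrightarrow> Z q \<in> T q" for Z
    unfolding sections_def mem_Collect_eq smooth_vf_along_def
  proof (intro conjI ballI)
    fix q assume q: "q \<in> V"
    show "Z q \<in> T q" by (rule Z(2)[OF V_subset_M[OF q]])
    show "\<exists>U F. open U \<and> q \<in> U \<and> smooth_vf A U F \<and> (\<forall>q\<in>U \<inter> V. F q = Z q)"
      using Z(1) by (intro exI[of _ UNIV] exI[of _ Z]) simp
  qed
  define PY where "PY q = screen_proj A g M S q (Y q)" for q
  (* a smooth ambient extension of P Y, from the frame formula of the projection *)
  define PY' where "PY' q = Y q - (\<Sum>i\<in>J. g q (Y q) (N_ext p i q) *\<^sub>R xi_ext p i q)" for q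
  have smPY: "smooth_vf A U PY'"
    unfolding PY'_def[abs_def]
    by (intro smooth_vf_diff[OF U(1)] YU smooth_vf_sum[OF U(1)] smooth_vf_scale[OF U(1)] g_smooth[OF U(1)]
        extendsD(2)[OF \<xi>] extendsD(2)[OF N])
  have PY'_screen_part: "PY' q = screen_part q (Y q)" if "q \<in> U" "q \<in> M" for q
    unfolding PY'_def screen_part_def
    by (simp add: extendsD(3)[OF \<xi> that] extendsD(3)[OF N that])
  have PY_eq: "PY q = PY' q" if "q \<in> U" "q \<in> M" for q
    unfolding PY_def PY'_screen_part[OF that] using that U(3) by (intro screen_proj_eq Y(3)) auto
  have ePY: "extends M PY U PY'"
    using U(1) smPY PY_eq by (simp add: extends_def)
  have eX: "extends M X U X" using U(1) XU by (simp add: extends_def)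
  define v where "v = D X PY' p"
  have nb: "nabla_bar A D M X PY p = v"
    unfolding v_def by (rule nabla_bar_eq[OF submfd pM U(2) eX ePY X(3)[OF pM]])
  have bv: "g p v (N i p) = b i p x (screen_part p u)"
  proof -
    have "PY' q \<in> S q" if "q \<in> U" "q \<in> M" for q
      unfolding PY'_screen_part[OF that] using that U(3) by (intro screen_part_S Y(3)) auto
    then have "g p (D X PY' p) (N i p) = b i p (X p) (PY' p)"
      by (intro b_eq[OF U(2,3) pM i N[OF i] XU X(3)[OF pM] smPY])
    then show ?thesis by (simp add: v_def X(2) PY'_screen_part[OF U(2) pM] Y(2))
  qed
  have hv: "g p v (\<xi> i p) = h i p x (screen_part p u)"
  proof -
    have "PY' q \<in> T q" if "q \<in> U" "q \<in> M" for q
      unfolding PY'_screen_part[OF that] using that U(3) by (intro S_T screen_part_S Y(3)) auto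
    then have "g p (D X PY' p) (\<xi> i p) = h i p (X p) (PY' p)"
      by (intro h_eq[OF U(2,3) pM i \<xi>[OF i] XU X(3)[OF pM] smPY])
    then show ?thesis by (simp add: v_def X(2) PY'_screen_part[OF U(2) pM] Y(2))
  qed
  have "g p (h_star A g D M S L X PY p) (N i p) = g p v (N i p)"
  proof -
    have "h_star A g D M S L X PY p = (\<Sum>j\<in>J. g p (tangent_part p v) (N j p) *\<^sub>R \<xi> j p)"
      unfolding h_star_def nabla_eq[OF p] nb proj_Rad[OF p tangent_part_T[OF p]] by (simp add: screen_part_def)
    then have "g p (h_star A g D M S L X PY p) (N i p) = g p (tangent_part p v) (N i p)"
      using dual_sum[OF i, of p "\<lambda>j. \<xi> j p" "N i p"] xi_N[OF p _ i] by simp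
    also have "\<dots> = g p v (N i p)"
      unfolding tangent_part_def by (simp add: g_simps g_sum_left N_N[OF p _ i])
    finally show ?thesis .
  qed
  moreover have "g p (h_l A D M L X PY p) (\<xi> i p) = g p v (\<xi> i p)"
    unfolding h_l_def nb proj_L[OF p] using Rad_perp'[OF xi_Rad[OF p i] tangent_part_T[OF p]] by (simp add: g_simps)
  ultimately show ?thesis
    using conf[OF sec[OF X(1,3)] sec[OF Y(1,3)] i p] bv hv by (simp add: PY_def[abs_def])
qed

text \<open>The radical part of \<open>u\<close> is orthogonal to \<open>T p\<close>, and its screen part is orthogonal to \<open>L p\<close>.\<close>

lemma g_tangent_part:
  assumes p: "p \<in> V" and u: "u \<in> T p"
  shows "g p (tangent_part p v) u = g p v (screen_part p u)"
proof -
  have "g p (tangent_part p v) (u - screen_part p u) = 0" by (rule Rad_perp'[OF screen_part_diff_Rad[OF p] tangent_part_T[OF p]])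
  then have "g p (tangent_part p v) u = g p (tangent_part p v) (screen_part p u)" by (simp add: g_simps)
  also have "\<dots> = g p v (screen_part p u)"
    unfolding tangent_part_def by (simp add: g_simps g_sum_left N_screen[OF p _ screen_part_S[OF p u]])
  finally show ?thesis .
qed

text \<open>An ambient extension \<open>G Y'\<close> of \<open>nabla Y Z\<close> is obtained by subtracting the transversal part from the
  ambient derivative. Differentiating it, the terms in which the coefficients are differentiated are
  multiples of \<open>N i\<close> and disappear against the screen vector \<open>screen_part p u\<close>; what remains of the
  other terms is \<open>D X (N i)\<close>, that is, \<open>b i\<close>.\<close>

lemma Gauss_equation:
  assumes p: "p \<in> V" and V': "p \<in> V'" "openin (top_of_set M) V'"
    and X: "X \<in> sections A V' T" and Y: "Y \<in> sections A V' T" and Z: "Z \<in> sections A V' T"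
    and u: "u \<in> T p"
  shows "g p (induced_curvature A D M L X Y Z p) u
    = R4 p (X p) (Y p) (Z p) (screen_part p u)
      + (\<Sum>i\<in>J. h i p (Y p) (Z p) * b i p (X p) (screen_part p u) - h i p (X p) (Z p) * b i p (Y p) (screen_part p u))"
proof -
  note pM = V_subset_M[OF p]
  obtain U0 where U0: "open U0" "p \<in> U0" "U0 \<inter> M \<subseteq> V" and exts: "\<forall>i\<in>J. extends M (\<xi> i) U0 (xi_ext p i)" "\<forall>i\<in>J. extends M (N i) U0 (N_ext p i)"
    by (rule frame_extends[OF p])
  note \<xi>0 = bspec[OF exts(1)] and N0 = bspec[OF exts(2)]
  have al: "smooth_vf_along A V' Q" "\<And>q. q \<in> V' \<Longrightarrow> Q q \<in> T q" if "Q \<in> sections A V' T" for Q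
    using that by (simp_all add: sections_def)
  obtain U1 X' where U1: "p \<in> U1" "extends M X U1 X'" "U1 \<inter> M \<subseteq> V'" by (rule extends_along[OF V'(2) al(1)[OF X] V'(1)])
  obtain U2 Y' where U2: "p \<in> U2" "extends M Y U2 Y'" "U2 \<inter> M \<subseteq> V'" by (rule extends_along[OF V'(2) al(1)[OF Y] V'(1)])
  obtain U3 Z' where U3: "p \<in> U3" "extends M Z U3 Z'" "U3 \<inter> M \<subseteq> V'" by (rule extends_along[OF V'(2) al(1)[OF Z] V'(1)])
  define U where "U = U0 \<inter> U1 \<inter> U2 \<inter> U3"
  have U: "open U" "p \<in> U" "U \<inter> M \<subseteq> V" "U \<inter> M \<subseteq> V'"
    using U0 U1 U2 U3 extendsD(1)[OF U1(2)] extendsD(1)[OF U2(2)] extendsD(1)[OF U3(2)] by (auto simp: U_def)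
  have \<xi>: "extends M (\<xi> i) U (xi_ext p i)" and N: "extends M (N i) U (N_ext p i)" if "i \<in> J" for i
    by (rule extends_subset[OF \<xi>0[OF that] U(1)], simp add: U_def le_infI1)
      (rule extends_subset[OF N0[OF that] U(1)], simp add: U_def le_infI1)
  have eX: "extends M X U X'" and eY: "extends M Y U Y'" and eZ: "extends M Z U Z'"
    by (rule extends_subset[OF U1(2) U(1)], force simp: U_def)
      (rule extends_subset[OF U2(2) U(1)], force simp: U_def,
       rule extends_subset[OF U3(2) U(1)], force simp: U_def)
  note sX = extendsD(2)[OF eX] and sY = extendsD(2)[OF eY] and sZ = extendsD(2)[OF eZ]
  have at: "X' p = X p" "Y' p = Y p" "Z' p = Z p"
    using extendsD(3)[OF eX U(2) pM] extendsD(3)[OF eY U(2) pM] extendsD(3)[OF eZ U(2) pM] by auto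
  have tan: "Q q \<in> T q" if "Q \<in> sections A V' T" "q \<in> U" "q \<in> M" for Q q
    by (rule al(2)[OF that(1)]) (use that U(4) in auto)
  have tan': "Q' q \<in> T q" if "Q \<in> sections A V' T" "extends M Q U Q'" "q \<in> U" "q \<in> M" for Q Q' q
    unfolding extendsD(3)[OF that(2,3,4)] by (rule tan[OF that(1,3,4)])
  (* G Q' is an ambient extension of nabla Q Z, if Q' is one of Q *)
  define G where "G Q' q = D Q' Z' q - (\<Sum>i\<in>J. g q (D Q' Z' q) (xi_ext p i q) *\<^sub>R N_ext p i q)" for Q' q
  have sG: "smooth_fun A U (\<lambda>q. g q (D Q' Z' q) (xi_ext p i q))" if "smooth_vf A U Q'" "i \<in> J" for Q' i
    by (rule g_smooth[OF U(1) D_smooth[OF U(1) that(1) sZ] extendsD(2)[OF \<xi>[OF that(2)]]])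
  have eG: "extends M (nabla A D M L Q Z) U (G Q')"
    if Q: "Q \<in> sections A V' T" and eQ: "extends M Q U Q'" for Q Q'
    unfolding extends_def
  proof (intro conjI ballI U(1))
    note sQ = extendsD(2)[OF eQ]
    show "smooth_vf A U (G Q')"
      unfolding G_def[abs_def]
      by (intro smooth_vf_diff[OF U(1)] D_smooth[OF U(1) sQ sZ] smooth_vf_sum[OF U(1)] smooth_vf_scale[OF U(1)]
          sG[OF sQ] extendsD(2)[OF N])
    fix q assume q0: "q \<in> U \<inter> M"
    then have q: "q \<in> U" "q \<in> M" "q \<in> V" using U(3) by auto
    have "nabla A D M L Q Z q = tangent_part q (D Q' Z' q)"
      unfolding nabla_eq[OF q(3)] nabla_bar_eq[OF submfd q(2,1) eQ eZ tan[OF Q q(1,2)]] ..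
    then show "G Q' q = nabla A D M L Q Z q"
      unfolding tangent_part_def G_def by (simp add: extendsD(3)[OF \<xi> q(1,2)] extendsD(3)[OF N q(1,2)])
  qed
  have second: "g p (nabla A D M L W (nabla A D M L Q Z) p) u
      = g p (D W' (D Q' Z') p) (screen_part p u) + (\<Sum>i\<in>J. h i p (Q p) (Z p) * b i p (W p) (screen_part p u))"
    if Q: "Q \<in> sections A V' T" and eQ: "extends M Q U Q'" and W: "W \<in> sections A V' T" and eW: "extends M W U W'"
    for Q Q' W W'
  proof -
    note sQ = extendsD(2)[OF eQ] and sW = extendsD(2)[OF eW]
    have WQ: "W' p = W p" "Q' p = Q p" using extendsD(3)[OF eW U(2) pM] extendsD(3)[OF eQ U(2) pM] by auto
    define f where "f i q = g q (D Q' Z' q) (xi_ext p i q)" for i q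
    have f: "smooth_fun A U (f i)" if "i \<in> J" for i
      unfolding f_def[abs_def] by (rule sG[OF sQ that])
    have fN: "smooth_vf A U (\<lambda>q. f i q *\<^sub>R N_ext p i q)" if "i \<in> J" for i
      by (rule smooth_vf_scale[OF U(1) f[OF that] extendsD(2)[OF N[OF that]]])
    have fp: "f i p = h i p (Q p) (Z p)" if i: "i \<in> J" for i
    proof -
      have "g p (D Q' Z' p) (\<xi> i p) = h i p (Q' p) (Z' p)"
        by (rule h_eq[OF U(2,3) pM i \<xi>[OF i] sQ tan'[OF Q eQ U(2) pM] sZ tan'[OF Z eZ]])
      then show ?thesis by (simp add: f_def WQ at extendsD(3)[OF \<xi>[OF i] U(2) pM])
    qed
    have DN: "g p (D W' (N_ext p i) p) (screen_part p u) = - b i p (W p) (screen_part p u)" if i: "i \<in> J" for i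
      using sff_eq[OF submfd pM U(2) sW N[OF i] tan'[OF W eW U(2) pM], of "screen_part p u"]
      by (simp add: WQ g_sym[of p "screen_part p u"])
    have Npart: "g p (N_ext p i p) (screen_part p u) = 0" if i: "i \<in> J" for i
      unfolding extendsD(3)[OF N[OF i] U(2) pM] by (rule N_screen[OF p i screen_part_S[OF p u]])
    have "D W' (G Q') p = D W' (D Q' Z') p - D W' (\<lambda>q. \<Sum>i\<in>J. f i q *\<^sub>R N_ext p i q) p"
      unfolding G_def[abs_def] f_def[symmetric]
      by (rule D_diff_right[OF U(1) sW D_smooth[OF U(1) sQ sZ] smooth_vf_sum[OF U(1) fN] U(2)])
    also have "D W' (\<lambda>q. \<Sum>i\<in>J. f i q *\<^sub>R N_ext p i q) p = (\<Sum>i\<in>J. D W' (\<lambda>q. f i q *\<^sub>R N_ext p i q) p)"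
      by (rule D_sum_right[OF U(1) sW fN U(2)])
    also have "\<dots> = (\<Sum>i\<in>J. vderiv A (f i) p (W' p) *\<^sub>R N_ext p i p + f i p *\<^sub>R D W' (N_ext p i) p)"
      by (rule sum.cong[OF refl]) (rule D_scale_right[OF U(1) f sW extendsD(2)[OF N] U(2)])
    finally have DG: "D W' (G Q') p = D W' (D Q' Z') p
      - (\<Sum>i\<in>J. vderiv A (f i) p (W' p) *\<^sub>R N_ext p i p + f i p *\<^sub>R D W' (N_ext p i) p)" .
    have "nabla_bar A D M W (nabla A D M L Q Z) p = D W' (G Q') p"
      by (rule nabla_bar_eq[OF submfd pM U(2) eW eG[OF Q eQ] tan[OF W U(2) pM]])
    then have "g p (nabla A D M L W (nabla A D M L Q Z) p) u = g p (D W' (G Q') p) (screen_part p u)"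
      by (simp add: nabla_eq[OF p] g_tangent_part[OF p u])
    also have "\<dots> = g p (D W' (D Q' Z') p) (screen_part p u)
        - (\<Sum>i\<in>J. f i p * (- b i p (W p) (screen_part p u)))"
      unfolding DG by (simp add: g_simps g_sum_left Npart DN)
    also have "\<dots> = g p (D W' (D Q' Z') p) (screen_part p u) + (\<Sum>i\<in>J. f i p * b i p (W p) (screen_part p u))"
      by (simp add: sum_negf)
    finally show ?thesis by (simp add: fp)
  qed
  have br: "g p (nabla A D M L (bracket_along A M X Y) Z p) u = g p (D (lie_bracket A X' Y') Z' p) (screen_part p u)"
  proof -
    have beq: "bracket_along A M X Y q = lie_bracket A X' Y' q" if "q \<in> U" "q \<in> M" for q
      by (rule bracket_along_eq[OF submfd that(2,1) eX eY tan[OF X that] tan[OF Y that]])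
    have "extends M (bracket_along A M X Y) U (lie_bracket A X' Y')"
      using U(1) smooth_vf_lie_bracket[OF U(1) sX sY] beq by (simp add: extends_def)
    moreover have "lie_bracket A X' Y' p \<in> T p"
      by (rule lie_bracket_tangent[OF submfd pM U(1,2) sX sY tan'[OF X eX] tan'[OF Y eY]])
    ultimately have "nabla_bar A D M (bracket_along A M X Y) Z p = D (lie_bracket A X' Y') Z' p"
      by (intro nabla_bar_eq[OF submfd pM U(2) _ eZ]) (simp_all add: beq[OF U(2) pM])
    then show ?thesis by (simp add: nabla_eq[OF p] g_tangent_part[OF p u])
  qed
  have "curvature_at A D p (X p) (Y p) (Z p) = curvature_field A D X' Y' Z' p"
    using curvature_field_tensorial[OF U(1,2) sX sY sZ] by (simp add: at)
  then have "R4 p (X p) (Y p) (Z p) (screen_part p u) = g p (curvature_field A D X' Y' Z' p) (screen_part p u)"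
    by (simp add: R4_def)
  also have "\<dots> = g p (D X' (D Y' Z') p) (screen_part p u)
     - g p (D Y' (D X' Z') p) (screen_part p u) - g p (D (lie_bracket A X' Y') Z' p) (screen_part p u)"
    by (simp add: curvature_field_def g_simps)
  finally have "R4 p (X p) (Y p) (Z p) (screen_part p u) = g p (D X' (D Y' Z') p) (screen_part p u)
     - g p (D Y' (D X' Z') p) (screen_part p u) - g p (D (lie_bracket A X' Y') Z' p) (screen_part p u)" .
  then show ?thesis
    unfolding induced_curvature_def
    by (simp add: g_simps second[OF Y eY X eX] second[OF X eX Y eY] br sum_subtractf)
qed

text \<open>The holonomy condition says that \<open>R4 p a (P c) \<rho> d = 0\<close> for radical \<open>\<rho>\<close>. With \<open>P u\<close> moved to the second
  place by pair symmetry, it allows to replace \<open>x\<close> and \<open>y\<close> by their screen parts; moved back, it does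
  the same for \<open>z\<close>.\<close>

lemma R4_screen:
  assumes hol: "\<And>x y \<rho>. x \<in> T p \<Longrightarrow> y \<in> T p \<Longrightarrow> \<rho> \<in> Rd p \<Longrightarrow> curvature_at A D p x (screen_part p y) \<rho> \<in> Rd p"
    and p: "p \<in> V" and x: "x \<in> T p" and y: "y \<in> T p" and z: "z \<in> T p" and u: "u \<in> T p"
  shows "R4 p x y z (screen_part p u) = R4 p (screen_part p x) (screen_part p y) (screen_part p z) (screen_part p u)"
proof -
  have H: "R4 p a (screen_part p c) \<rho> d = 0" if "a \<in> T p" "c \<in> T p" "\<rho> \<in> Rd p" "d \<in> T p" for a c \<rho> d
    unfolding R4_def by (rule Rad_perp[OF hol[OF that(1-3)] that(4)])
  have sT: "screen_part p a \<in> T p" if "a \<in> T p" for a by (rule S_T[OF p screen_part_S[OF p that]])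
  note Rd = screen_part_diff_Rad[OF p]
  have "R4 p x y z (screen_part p u) = R4 p z (screen_part p u) x y" by (rule R4_pair)
  also have "\<dots> = R4 p z (screen_part p u) (screen_part p x) y"
    using H[OF z u Rd[of x] y] by (simp add: linear_diff[OF R4_linear3])
  also have "\<dots> = - R4 p z (screen_part p u) y (screen_part p x)" by (rule R4_skew)
  also have "\<dots> = - R4 p z (screen_part p u) (screen_part p y) (screen_part p x)"
    using H[OF z u Rd[of y] sT[OF x]] by (simp add: linear_diff[OF R4_linear3])
  also have "\<dots> = R4 p z (screen_part p u) (screen_part p x) (screen_part p y)" by (rule R4_skew[symmetric])
  also have "\<dots> = R4 p (screen_part p x) (screen_part p y) z (screen_part p u)" by (rule R4_pair)
  also have "\<dots> = R4 p (screen_part p x) (screen_part p y) (screen_part p z) (screen_part p u)"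
    using H[OF sT[OF x] y Rd[of z] sT[OF u]] by (simp add: linear_diff[OF R4_linear3])
  finally show ?thesis .
qed

end

section \<open>Screen conformal coisotropic submanifolds\<close>

theorem theorem3p5:
  fixes A :: "('p::{t2_space, second_countable_topology}, 'e::euclidean_space) chart set"
    and g :: "'p \<Rightarrow> 'e \<Rightarrow> 'e \<Rightarrow> real"
    and D :: "('p \<Rightarrow> 'e) \<Rightarrow> ('p \<Rightarrow> 'e) \<Rightarrow> 'p \<Rightarrow> 'e"
    and M :: "'p set"
    and S L :: "'p \<Rightarrow> 'e set"
    and m n r \<nu> :: nat
  assumes "1 \<le> m" "1 \<le> n" "DIM('e) = m + n" "1 \<le> \<nu>" "\<nu> < m + n"
    and "smooth_atlas A"
    and "semi_riemannian_metric A g \<nu>"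
    and "levi_civita A g D"
    and "submanifold A M m"
    and "lightlike_submanifold A g M r"
    and coisotropic: "r = n"
    and "screen_distribution A g M S"
    and "lightlike_transversal A g M S r L"
    and "integrable_distribution A M r (Rad A g M)"
    and "screen_conformal A g D M S r L"
    and holonomy: "\<And>p x y \<xi>. p \<in> M \<Longrightarrow> x \<in> tangent_space A M p \<Longrightarrow> y \<in> tangent_space A M p \<Longrightarrow>
           \<xi> \<in> Rad A g M p \<Longrightarrow> curvature_at A D p x (screen_proj A g M S p y) \<xi> \<in> Rad A g M p"
  shows "defines_algebraic_curvature_tensor A g M (induced_curvature A D M L)"
  unfolding defines_algebraic_curvature_tensor_def
proof (rule ballI)
  note integrable = \<open>integrable_distribution A M r (Rad A g M)\<close>
  fix p assume pM: "p \<in> M"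
  obtain V \<xi> N \<phi> where p: "p \<in> V" and V: "openin (top_of_set M) V"
    and frame: "frame_on A V r (Rad A g M) \<xi>" and trans: "transversal_frame A g S r L V \<xi> N"
    and conf: "\<forall>X\<in>sections A V (tangent_space A M). \<forall>Y\<in>sections A V (tangent_space A M).
           let PY = (\<lambda>q. screen_proj A g M S q (Y q)) in
           \<forall>i\<in>{1..r}. \<forall>q\<in>V.
             g q (h_star A g D M S L X PY q) (N i q) = \<phi> i q * g q (h_l A D M L X PY q) (\<xi> i q)"
    using bspec[OF \<open>screen_conformal A g D M S r L\<close>[unfolded screen_conformal_def] pM] by (elim exE conjE)
  interpret coisotropic_frame A g D \<nu> M m r S L V \<xi> N
    by unfold_locales (use assms V frame trans in simp_all)
  define F where "F x y z w = R4 p (screen_part p x) (screen_part p y) (screen_part p z) (screen_part p w)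
      + (\<Sum>i\<in>{1..r}. \<phi> i p * (h i p y z * h i p x w - h i p x z * h i p y w))" for x y z w
  have b: "b i p x (screen_part p u) = \<phi> i p * h i p x u" if "i \<in> {1..r}" "x \<in> T p" "u \<in> T p" for i x u
  proof -
    have "b i p x (screen_part p u) = \<phi> i p * h i p x (screen_part p u)"
    proof (rule conformal_forms[OF _ p that])
      fix X Y i q assume XY: "X \<in> sections A V T" "Y \<in> sections A V T" and iq: "i \<in> {1..r}" "q \<in> V"
      show "g q (h_star A g D M S L X (\<lambda>q. screen_proj A g M S q (Y q)) q) (N i q)
        = \<phi> i q * g q (h_l A D M L X (\<lambda>q. screen_proj A g M S q (Y q)) q) (\<xi> i q)"
        by (rule conf[THEN bspec, OF XY(1), THEN bspec, OF XY(2), unfolded Let_def, THEN bspec, OF iq(1),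
              THEN bspec, OF iq(2)])
    qed
    then show ?thesis by (simp add: h_screen_part[OF integrable p that(1,2)])
  qed
  have hol: "curvature_at A D p x (screen_part p y) \<rho> \<in> Rd p" if "x \<in> T p" "y \<in> T p" "\<rho> \<in> Rd p" for x y \<rho>
    using holonomy[OF pM that] by (simp add: screen_proj_eq[OF p that(2)])
  have "algebraic_curvature_tensor (T p) F"
    unfolding F_def[abs_def]
    by (intro algebraic_curvature_tensor_add R4_pullback_algebraic[OF linear_screen_part] algebraic_curvature_tensor_sum
        algebraic_curvature_tensor_square[OF T_subspace[OF pM] sff_linear] h_sym[OF p])
  moreover have "g p (induced_curvature A D M L X Y Z p) (U p) = F (X p) (Y p) (Z p) (U p)"
    if V': "p \<in> V'" "openin (top_of_set M) V'" and XYZU: "{X, Y, Z, U} \<subseteq> sections A V' T" for V' X Y Z U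
  proof -
    have s: "X \<in> sections A V' T" "Y \<in> sections A V' T" "Z \<in> sections A V' T" "U \<in> sections A V' T"
      using XYZU by simp_all
    have t: "Q p \<in> T p" if "Q \<in> sections A V' T" for Q using that V'(1) by (simp add: sections_def)
    have "(\<Sum>i\<in>{1..r}. h i p (Y p) (Z p) * b i p (X p) (screen_part p (U p)) - h i p (X p) (Z p) * b i p (Y p) (screen_part p (U p)))
      = (\<Sum>i\<in>{1..r}. \<phi> i p * (h i p (Y p) (Z p) * h i p (X p) (U p) - h i p (X p) (Z p) * h i p (Y p) (U p)))"
      by (rule sum.cong[OF refl]) (simp add: b t s algebra_simps)
    moreover have "R4 p (X p) (Y p) (Z p) (screen_part p (U p))
        = R4 p (screen_part p (X p)) (screen_part p (Y p)) (screen_part p (Z p)) (screen_part p (U p))"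
      by (rule R4_screen[OF hol p t[OF s(1)] t[OF s(2)] t[OF s(3)] t[OF s(4)]])
    ultimately show ?thesis
      unfolding F_def Gauss_equation[OF p V' s(1-3) t[OF s(4)]] by (simp only:)
  qed
  ultimately show "\<exists>F. algebraic_curvature_tensor (tangent_space A M p) F \<and>
        (\<forall>V X Y Z U. p \<in> V \<and> openin (top_of_set M) V \<and>
           {X, Y, Z, U} \<subseteq> sections A V (tangent_space A M) \<longrightarrow>
           g p (induced_curvature A D M L X Y Z p) (U p) = F (X p) (Y p) (Z p) (U p))"
    by (intro exI[of _ F] conjI allI impI) auto
qed

end
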